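(* Let $E$ be a reflexive Banach space and let $\{M^{n}\}_{n}$ be a sequence of $E$-valued càdlàg martingales. Suppose that $$\mathrm{co}\left\{(M^{n})^{\ast}_{\infty}:n\in\mathbb{N}\right\}$$ is bounded in $L^{0}(\mu)$, and that $$\left\{\Delta M^{n}_{T}:n\in\mathbb{N},\ T\text{ a stopping time}\right\}$$ is bounded in $L^{1}(\mu,E)$. Then there exist convex combinations $N^{i}\in\mathrm{co}\{M^{n}:n\geq i\}$ ($i\in\mathbb{N}$) such that $\{N^{i}\}_{i}$ converges pointwise in $\sigma(E,E')$ to an $\mathscr{O}$-measurable process $N$ outside of an evanescent subset of $[0,\infty)\times X$.
   Context: Stochastic basis: $(X,\mathscr{F},\mu)$ is a complete probability space with a filtration $\{\mathscr{F}_{t}:t\geq0\}$ of sub-$\sigma$-algebras of $\mathscr{F}$ such that $\mathscr{F}_{0}$ is the $\sigma$-algebra generated by the $\mu$-null sets and $\mathscr{F}_{t}=\bigcap_{s>t}\mathscr{F}_{s}$ for all $t\geq0$. All processes are indexed by $[0,\infty)$. A set $A\subset[0,\infty)\times X$ is evanescent if its projection $\{\omega\in X:\exists t\in[0,\infty)\text{ with }(t,\omega)\in A\}$ is $\mu$-null. $\mathscr{O}$ is the optional $\sigma$-algebra on $[0,\infty)\times X$, generated by the right-continuous real-valued adapted processes. Banach spaces are real, $E'$ is the dual of $E$, and $\sigma(E,E')$ is the weak topology of $E$; $E$-valued measurability is with respect to the Borel $\sigma$-algebra of the norm topology. $\mathrm{co}$ denotes the convex hull. For an $E$-valued process $M$,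 $M^{\ast}_{t}=\sup_{s\leq t}\Vert M_{s}\Vert_{E}$ and $M^{\ast}_{\infty}=\sup_{t>0}M^{\ast}_{t}$. $L^{0}(\mu)$ is the space of (classes of) real-valued measurable functions with the topology of convergence in measure; a set $C\subset L^{0}(\mu)$ is bounded if for every $\varepsilon>0$ there is $\delta>0$ with $\sup_{\xi\in C}\mu(\{|\xi|\geq\delta\})\leq\varepsilon$. $L^{1}(\mu,E)$ is the Bochner-Lebesgue space. Stopping times take values in $[0,\infty]$; $\Delta M_{t}=M_{t}-M_{t-}$ is the jump of a càdlàg process at time $t$ (with $M_{0-}=M_0$), and $\Delta M_{T}$ is set equal to $0$ on $\{T=\infty\}$. *)

theory Defs
  imports "HOL-Probability.Probability"
begin

text \<open>
  Conventions. The time axis \<open>[0,\<infinity>)\<close> is \<open>{0..}\<close> in \<^typ>\<open>real\<close>; a process is a function on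
  \<^typ>\<open>real \<times> 'x\<close> whose values off \<open>{0..} \<times> space \<mu>\<close> are irrelevant. The \<open>\<sigma>\<close>-algebra at time
  \<open>t\<close> is \<^term>\<open>sets (F t)\<close>; only \<open>t \<ge> 0\<close> matters, and the measure carried by \<^term>\<open>F t\<close> is never used.
\<close>

locale stochastic_basis = prob_space \<mu> + complete_measure \<mu>
  for \<mu> :: "'x measure" and F :: "real \<Rightarrow> 'x measure" +
  assumes subalgebra_F: "\<And>t. 0 \<le> t \<Longrightarrow> subalgebra \<mu> (F t)"
    and F_mono: "\<And>s t. 0 \<le> s \<Longrightarrow> s \<le> t \<Longrightarrow> sets (F s) \<subseteq> sets (F t)"
    and F_zero: "sets (F 0) = sigma_sets (space \<mu>) (null_sets \<mu>)"
    and F_right_cont: "\<And>t. 0 \<le> t \<Longrightarrow> sets (F t) = (\<Inter>s\<in>{t<..}. sets (F s))"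

definition evanescent :: "'x measure \<Rightarrow> (real \<times> 'x) set \<Rightarrow> bool" where
  "evanescent \<mu> A \<longleftrightarrow> A \<subseteq> {0..} \<times> space \<mu> \<and> {\<omega>\<in>space \<mu>. \<exists>t\<ge>0. (t, \<omega>) \<in> A} \<in> null_sets \<mu>"

definition adapted_process ::
    "(real \<Rightarrow> 'x measure) \<Rightarrow> (real \<times> 'x \<Rightarrow> 'b::topological_space) \<Rightarrow> bool" where
  "adapted_process F Z \<longleftrightarrow> (\<forall>t\<ge>0. (\<lambda>\<omega>. Z (t, \<omega>)) \<in> borel_measurable (F t))"

definition right_continuous_process ::
    "'x measure \<Rightarrow> (real \<times> 'x \<Rightarrow> 'b::topological_space) \<Rightarrow> bool" where
  "right_continuous_process \<mu> Z \<longleftrightarrow>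
     (\<forall>\<omega>\<in>space \<mu>. \<forall>t\<ge>0. ((\<lambda>s. Z (s, \<omega>)) \<longlongrightarrow> Z (t, \<omega>)) (at_right t))"

definition cadlag_process ::
    "'x measure \<Rightarrow> (real \<times> 'x \<Rightarrow> 'b::topological_space) \<Rightarrow> bool" where
  "cadlag_process \<mu> Z \<longleftrightarrow> right_continuous_process \<mu> Z \<and>
     (\<forall>\<omega>\<in>space \<mu>. \<forall>t>0. \<exists>l. ((\<lambda>s. Z (s, \<omega>)) \<longlongrightarrow> l) (at_left t))"

definition optional_algebra :: "'x measure \<Rightarrow> (real \<Rightarrow> 'x measure) \<Rightarrow> (real \<times> 'x) measure" where
  "optional_algebra \<mu> F = sigma ({0..} \<times> space \<mu>)
     {Y -` B \<inter> ({0..} \<times> space \<mu>) | (Y :: real \<times> 'x \<Rightarrow> real) B.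
        right_continuous_process \<mu> Y \<and> adapted_process F Y \<and> B \<in> sets borel}"

definition ext_stopping_time ::
    "'x measure \<Rightarrow> (real \<Rightarrow> 'x measure) \<Rightarrow> ('x \<Rightarrow> ennreal) \<Rightarrow> bool" where
  "ext_stopping_time \<mu> F T \<longleftrightarrow> (\<forall>t\<ge>0. {\<omega>\<in>space \<mu>. T \<omega> \<le> ennreal t} \<in> sets (F t))"


text \<open>
  The library restricts \<^const>\<open>has_bochner_integral\<close> to separable (second countable) spaces. The
  following is the same definition without that restriction; the approximating simple functions
  force the integrand to be essentially separably valued, as usual for the Bochner integral.
\<close>

definition has_bochner_int ::
    "'x measure \<Rightarrow> ('x \<Rightarrow> 'b) \<Rightarrow> 'b::real_normed_vector \<Rightarrow> bool" where
  "has_bochner_int \<mu> f x \<longleftrightarrow> f \<in> borel_measurable \<mu> \<and>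
     (\<exists>s :: nat \<Rightarrow> 'x \<Rightarrow> 'b. (\<forall>i. Bochner_Integration.simple_bochner_integrable \<mu> (s i)) \<and>
        (\<lambda>i. \<integral>\<^sup>+\<omega>. ennreal (norm (f \<omega> - s i \<omega>)) \<partial>\<mu>) \<longlonglongrightarrow> 0 \<and>
        (\<lambda>i. Bochner_Integration.simple_bochner_integral \<mu> (s i)) \<longlonglongrightarrow> x)"

lemma has_bochner_int_iff_library:
  fixes f :: "'x \<Rightarrow> 'b::{real_normed_vector, second_countable_topology}"
  shows "has_bochner_int \<mu> f x \<longleftrightarrow> has_bochner_integral \<mu> f x"
  unfolding has_bochner_int_def has_bochner_integral.simps by auto

definition bochner_integrable :: "'x measure \<Rightarrow> ('x \<Rightarrow> 'b::real_normed_vector) \<Rightarrow> bool" where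
  "bochner_integrable \<mu> f \<longleftrightarrow> (\<exists>x. has_bochner_int \<mu> f x)"

text \<open>\<open>g\<close> is a version of the conditional expectation of \<open>f\<close> given \<open>G\<close>.\<close>

definition is_cond_exp ::
    "'x measure \<Rightarrow> 'x measure \<Rightarrow> ('x \<Rightarrow> 'b::real_normed_vector) \<Rightarrow> ('x \<Rightarrow> 'b) \<Rightarrow> bool" where
  "is_cond_exp \<mu> G f g \<longleftrightarrow>
     bochner_integrable \<mu> f \<and> bochner_integrable \<mu> g \<and> g \<in> borel_measurable G \<and>
     (\<forall>A\<in>sets G. \<exists>x. has_bochner_int \<mu> (\<lambda>\<omega>. indicator A \<omega> *\<^sub>R f \<omega>) x \<and>
                      has_bochner_int \<mu> (\<lambda>\<omega>. indicator A \<omega> *\<^sub>R g \<omega>) x)"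

definition cadlag_martingale ::
    "'x measure \<Rightarrow> (real \<Rightarrow> 'x measure) \<Rightarrow> (real \<times> 'x \<Rightarrow> 'b::real_normed_vector) \<Rightarrow> bool" where
  "cadlag_martingale \<mu> F Z \<longleftrightarrow>
     adapted_process F Z \<and> cadlag_process \<mu> Z \<and>
     (\<forall>t\<ge>0. bochner_integrable \<mu> (\<lambda>\<omega>. Z (t, \<omega>))) \<and>
     (\<forall>s\<ge>0. \<forall>t\<ge>s. is_cond_exp \<mu> (F s) (\<lambda>\<omega>. Z (t, \<omega>)) (\<lambda>\<omega>. Z (s, \<omega>)))"


definition running_max :: "(real \<times> 'x \<Rightarrow> 'b::real_normed_vector) \<Rightarrow> real \<Rightarrow> 'x \<Rightarrow> ennreal" where
  "running_max Z t \<omega> = (SUP s\<in>{0..t}. ennreal (norm (Z (s, \<omega>))))"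

definition total_max :: "(real \<times> 'x \<Rightarrow> 'b::real_normed_vector) \<Rightarrow> 'x \<Rightarrow> ennreal" where
  "total_max Z \<omega> = (SUP t\<in>{0<..}. running_max Z t \<omega>)"

definition left_limit :: "(real \<times> 'x \<Rightarrow> 'b::t2_space) \<Rightarrow> real \<Rightarrow> 'x \<Rightarrow> 'b" where
  "left_limit Z t \<omega> = (if t = 0 then Z (0, \<omega>) else Lim (at_left t) (\<lambda>s. Z (s, \<omega>)))"

definition jump_at :: "(real \<times> 'x \<Rightarrow> 'b::real_normed_vector) \<Rightarrow> ('x \<Rightarrow> ennreal) \<Rightarrow> 'x \<Rightarrow> 'b" where
  "jump_at Z T \<omega> = (if T \<omega> = \<infinity> then 0
     else Z (enn2real (T \<omega>), \<omega>) - left_limit Z (enn2real (T \<omega>)) \<omega>)"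


text \<open>
  Function types are not an instance of \<^class>\<open>real_vector\<close>, so \<open>convex hull\<close> does not apply to
  sets of functions; this is its explicit form.
\<close>

definition co :: "('z \<Rightarrow> 'b::real_vector) set \<Rightarrow> ('z \<Rightarrow> 'b) set" where
  "co A = {(\<lambda>z. \<Sum>f\<in>S. c f *\<^sub>R f z) | S c.
     finite S \<and> S \<subseteq> A \<and> (\<forall>f\<in>S. 0 \<le> c f) \<and> sum c S = 1}"

definition L0_bounded :: "'x measure \<Rightarrow> ('x \<Rightarrow> real) set \<Rightarrow> bool" where
  "L0_bounded \<mu> C \<longleftrightarrow> C \<subseteq> borel_measurable \<mu> \<and>
     (\<forall>\<epsilon>>0. \<exists>\<delta>>0. \<forall>\<xi>\<in>C. measure \<mu> {\<omega>\<in>space \<mu>. \<delta> \<le> \<bar>\<xi> \<omega>\<bar>} \<le> \<epsilon>)"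

definition L1_bounded :: "'x measure \<Rightarrow> ('x \<Rightarrow> 'b::real_normed_vector) set \<Rightarrow> bool" where
  "L1_bounded \<mu> D \<longleftrightarrow> (\<forall>f\<in>D. bochner_integrable \<mu> f) \<and>
     (\<exists>K::real. \<forall>f\<in>D. (\<integral>\<^sup>+\<omega>. ennreal (norm (f \<omega>)) \<partial>\<mu>) \<le> ennreal K)"


text \<open>Surjectivity of the canonical embedding into the bidual.\<close>

definition reflexive_space :: "'b::real_normed_vector itself \<Rightarrow> bool" where
  "reflexive_space _ \<longleftrightarrow>
     (\<forall>\<Phi> :: ('b \<Rightarrow>\<^sub>L real) \<Rightarrow>\<^sub>L real. \<exists>x::'b. \<forall>\<phi>. blinfun_apply \<Phi> \<phi> = blinfun_apply \<phi> x)"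

text \<open>The initial topology with respect to all continuous linear functionals, set up in the same
  way as \<^const>\<open>strong_operator_topology\<close>.\<close>

definition weak_topology :: "'b::real_normed_vector topology" where
  "weak_topology = pullback_topology UNIV (\<lambda>x (\<phi> :: 'b \<Rightarrow>\<^sub>L real). blinfun_apply \<phi> x) euclidean"

lemma limitin_weak_topology_iff:
  "limitin weak_topology f l G \<longleftrightarrow>
     (\<forall>\<phi> :: 'b::real_normed_vector \<Rightarrow>\<^sub>L real. ((\<lambda>i. blinfun_apply \<phi> (f i)) \<longlongrightarrow> blinfun_apply \<phi> l) G)"
proof -
  let ?J = "\<lambda>x (\<phi> :: 'b \<Rightarrow>\<^sub>L real). blinfun_apply \<phi> x"
  have "limitin weak_topology f l G \<longleftrightarrow> ((\<lambda>i. ?J (f i)) \<longlongrightarrow> ?J l) G"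
    unfolding limitin_def weak_topology_def tendsto_def openin_pullback_topology
      topspace_pullback_topology
    by auto
  also have "\<dots> \<longleftrightarrow> limitin (product_topology (\<lambda>_. euclidean) UNIV) (\<lambda>i. ?J (f i)) (?J l) G"
    by (simp add: euclidean_product_topology)
  also have "\<dots> \<longleftrightarrow> (\<forall>\<phi> :: 'b \<Rightarrow>\<^sub>L real. ((\<lambda>i. blinfun_apply \<phi> (f i)) \<longlongrightarrow> blinfun_apply \<phi> l) G)"
    by (simp add: limitin_componentwise)
  finally show ?thesis .
qed

end

theory Submission
  imports Defs
begin

text \<open>
  In a reflexive space, weak convergence of a norm bounded sequence with values in a separable closed
  subspace can be tested on a countable norming set of functionals, so the problem reduces to
  countably many real-valued ones. After a first passage to convex combinations the maximal functions
  are almost surely bounded uniformly in the index. Let \<open>T\<close> be the first time at which one of the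
  processes leaves \<open>[-l, l]\<close>. The jump condition turns the real processes restricted to \<open>[0, T)\<close> into
  quasimartingales bounded by \<open>l\<close> whose mean variations are bounded uniformly. Each of them
  is the sum of an \<open>L\<^sup>2\<close>-bounded martingale and a process of integrable variation. Convex combinations of
  the martingale parts converge in \<open>L\<^sup>2\<close> and hence, by the maximal inequality, uniformly in time. The
  parts of finite variation are differences of increasing processes, and convex combinations of these
  converge at all dyadic times and at the countably many random times where the limit jumps, hence
  everywhere. Letting \<open>l\<close> tend to infinity exhausts \<open>[0, \<infinity>)\<close> almost surely.
\<close>


section \<open>Forward convex combinations\<close>

text \<open>Conditional expectations are determined only up to null sets at each fixed time, and no
  regular version of \<open>cexp t U\<close> in \<open>t\<close> is ever chosen. Martingale and
  variation parts are therefore handled at dyadic times only, and right-continuity of the given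
  processes carries the result to all other times. A process is cut to zero at its exit time rather
  than stopped there, since its value at that time is merely integrable; the cut costs one drift
  term, whose mean is controlled by \<open>l\<close> and the mean jump norm. One exit time serves
  all indices, so that combinations of cut processes are again cut combinations; it is infinite for
  large levels only because the maximal functions were bounded beforehand. Every passage is recorded
  as weights on the original indices (\<open>wts\<close>): the same weights act on vectors,
  projections, maxima and integrals, and a further passage is a product of weight matrices
  (\<open>comp_wts\<close>). Convergence already achieved survives such products, which makes
  countably many requirements compatible.\<close>

definition wts :: "nat \<Rightarrow> (nat \<Rightarrow> real) set" where
  "wts i = {w. (\<forall>k. 0 \<le> w k) \<and> finite {k. w k \<noteq> 0} \<and> (\<forall>k<i. w k = 0) \<and> (\<Sum>k | w k \<noteq> 0. w k) = 1}"

definition comb :: "(nat \<Rightarrow> real) \<Rightarrow> (nat \<Rightarrow> 'b::real_vector) \<Rightarrow> 'b" where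
  "comb w f = (\<Sum>k | w k \<noteq> 0. w k *\<^sub>R f k)"

text \<open>Row vector times matrix: the rows \<open>C j\<close> are weights, and the result is the
  weight on the original indices obtained by forming the combinations \<open>C j\<close> and then
  averaging them with \<open>w\<close>.\<close>

definition comp_wts :: "(nat \<Rightarrow> real) \<Rightarrow> (nat \<Rightarrow> nat \<Rightarrow> real) \<Rightarrow> nat \<Rightarrow> real" where
  "comp_wts w C k = comb w (\<lambda>j. C j k)"

lemma comb_eq_sum:
  assumes "finite S" "\<And>k. k \<notin> S \<Longrightarrow> w k = 0"
  shows "comb w f = (\<Sum>k\<in>S. w k *\<^sub>R f k)"
  unfolding comb_def by (rule sum.mono_neutral_left) (use assms in auto)

lemma wts_nonneg: "w \<in> wts i \<Longrightarrow> 0 \<le> w k"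
  and wts_finite: "w \<in> wts i \<Longrightarrow> finite {k. w k \<noteq> 0}"
  and wts_below: "w \<in> wts i \<Longrightarrow> k < i \<Longrightarrow> w k = 0"
  by (auto simp: wts_def)

lemma wts_sum:
  assumes "w \<in> wts i" "finite S" "\<And>k. k \<notin> S \<Longrightarrow> w k = 0"
  shows "sum w S = 1"
proof -
  have "sum w {k. w k \<noteq> 0} = sum w S"
    by (rule sum.mono_neutral_left) (use assms in auto)
  then show ?thesis using assms(1) by (simp add: wts_def)
qed

lemma wts_antimono: "i \<le> j \<Longrightarrow> wts j \<subseteq> wts i"
  by (auto simp: wts_def)

lemma wtsI:
  assumes "finite S" "\<And>k. k \<notin> S \<Longrightarrow> w k = 0" "\<And>k. 0 \<le> w k" "\<And>k. k < i \<Longrightarrow> w k = 0" "sum w S = 1"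
  shows "w \<in> wts i"
proof -
  have "{k. w k \<noteq> 0} \<subseteq> S" using assms(2) by auto
  then have "finite {k. w k \<noteq> 0}" using assms(1) finite_subset by auto
  moreover have "(\<Sum>k | w k \<noteq> 0. w k) = sum w S"
    by (rule sum.mono_neutral_left) (use assms in auto)
  ultimately show ?thesis using assms by (auto simp: wts_def)
qed

lemma unit_wts: "(\<lambda>k. if k = i then 1 else 0) \<in> wts i"
  by (rule wtsI[of "{i}"]) auto

lemma comb_unit: "comb (\<lambda>k. if k = i then 1 else 0) f = f i"
  by (subst comb_eq_sum[of "{i}"]) auto

lemma mid_wts:
  assumes "w \<in> wts i" "v \<in> wts i"
  shows "(\<lambda>k. (w k + v k) / 2) \<in> wts i"
proof -
  let ?S = "{k. w k \<noteq> 0} \<union> {k. v k \<noteq> 0}"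
  have S: "finite ?S" using wts_finite[OF assms(1)] wts_finite[OF assms(2)] by blast
  have z: "w k = 0 \<and> v k = 0" if "k \<notin> ?S" for k using that by blast
  have "sum w ?S = 1" "sum v ?S = 1"
    using wts_sum[OF assms(1) S] wts_sum[OF assms(2) S] z by blast+
  moreover have "(\<Sum>k\<in>?S. (w k + v k) / 2) = (sum w ?S + sum v ?S) / 2"
    unfolding sum.distrib[symmetric] sum_divide_distrib ..
  ultimately have 1: "(\<Sum>k\<in>?S. (w k + v k) / 2) = 1" by (simp only: one_add_one)
  show ?thesis
  proof (rule wtsI[OF S _ _ _ 1])
    show "(w k + v k) / 2 = 0" if "k \<notin> ?S" for k using z[OF that] by simp
    show "0 \<le> (w k + v k) / 2" for k
      using wts_nonneg[OF assms(1), of k] wts_nonneg[OF assms(2), of k] by simp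
    show "(w k + v k) / 2 = 0" if "k < i" for k
      using wts_below[OF assms(1) that] wts_below[OF assms(2) that] by simp
  qed
qed

lemma comb_mid:
  assumes "w \<in> wts i" "v \<in> wts i"
  shows "comb (\<lambda>k. (w k + v k) / 2) f = (1/2) *\<^sub>R (comb w f + comb v f)"
proof -
  let ?S = "{k. w k \<noteq> 0} \<union> {k. v k \<noteq> 0}"
  have S: "finite ?S" using wts_finite[OF assms(1)] wts_finite[OF assms(2)] by simp
  have "comb (\<lambda>k. (w k + v k) / 2) f = (\<Sum>k\<in>?S. ((w k + v k) / 2) *\<^sub>R f k)"
    by (rule comb_eq_sum[OF S]) auto
  also have "\<dots> = (\<Sum>k\<in>?S. (1/2) *\<^sub>R (w k *\<^sub>R f k + v k *\<^sub>R f k))"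
    by (rule sum.cong) (simp_all add: add_divide_distrib scaleR_add_left scaleR_add_right)
  also have "\<dots> = (1/2) *\<^sub>R ((\<Sum>k\<in>?S. w k *\<^sub>R f k) + (\<Sum>k\<in>?S. v k *\<^sub>R f k))"
    unfolding scaleR_sum_right[symmetric] sum.distrib ..
  also have "(\<Sum>k\<in>?S. w k *\<^sub>R f k) = comb w f"
    by (rule comb_eq_sum[OF S, symmetric]) auto
  also have "(\<Sum>k\<in>?S. v k *\<^sub>R f k) = comb v f"
    by (rule comb_eq_sum[OF S, symmetric]) auto
  finally show ?thesis .
qed

lemma comb_const: "w \<in> wts i \<Longrightarrow> comb w (\<lambda>_. c) = c"
  by (simp add: comb_def wts_def flip: scaleR_sum_left)

lemma comb_add: "comb w (\<lambda>k. f k + g k) = comb w f + comb w g"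
  by (simp add: comb_def sum.distrib scaleR_add_right)

lemma comb_diff: "comb w (\<lambda>k. f k - g k) = comb w f - comb w g"
  by (simp add: comb_def sum_subtractf scaleR_diff_right)

lemma comb_cmult: "comb w (\<lambda>k. c * f k) = c * comb w f" for c :: real
  by (simp add: comb_def sum_distrib_left mult.left_commute)

lemma comb_linear: "linear h \<Longrightarrow> h (comb w f) = comb w (\<lambda>k. h (f k))"
  by (simp add: comb_def linear_sum linear_scale)

lemma comb_cong:
  assumes "w \<in> wts i" "\<And>k. i \<le> k \<Longrightarrow> f k = g k"
  shows "comb w f = comb w g"
  unfolding comb_def
proof (rule sum.cong)
  fix k assume "k \<in> {k. w k \<noteq> 0}"
  then have "i \<le> k" using wts_below[OF assms(1), of k] by (meson leI mem_Collect_eq)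
  then show "w k *\<^sub>R f k = w k *\<^sub>R g k" using assms(2) by simp
qed simp

lemma comb_mono:
  fixes f g :: "nat \<Rightarrow> real"
  assumes "w \<in> wts i" "\<And>k. i \<le> k \<Longrightarrow> f k \<le> g k"
  shows "comb w f \<le> comb w g"
  unfolding comb_def
proof (rule sum_mono)
  fix k assume "k \<in> {k. w k \<noteq> 0}"
  then have "i \<le> k" using wts_below[OF assms(1), of k] by (meson leI mem_Collect_eq)
  then show "w k *\<^sub>R f k \<le> w k *\<^sub>R g k" using assms(2) wts_nonneg[OF assms(1), of k] by (simp add: mult_left_mono)
qed

lemma comb_le:
  fixes f :: "nat \<Rightarrow> real"
  assumes "w \<in> wts i" "\<And>k. i \<le> k \<Longrightarrow> f k \<le> c"
  shows "comb w f \<le> c"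
  using comb_mono[OF assms(1), of f "\<lambda>_. c"] comb_const[OF assms(1), of c] assms(2) by simp

lemma comb_ge:
  fixes f :: "nat \<Rightarrow> real"
  assumes "w \<in> wts i" "\<And>k. i \<le> k \<Longrightarrow> c \<le> f k"
  shows "c \<le> comb w f"
  using comb_mono[OF assms(1), of "\<lambda>_. c" f] comb_const[OF assms(1), of c] assms(2) by simp

lemma norm_comb_le:
  assumes "w \<in> wts i"
  shows "norm (comb w f) \<le> comb w (\<lambda>k. norm (f k))"
proof -
  have "norm (comb w f) \<le> (\<Sum>k | w k \<noteq> 0. norm (w k *\<^sub>R f k))"
    unfolding comb_def by (rule norm_sum)
  also have "\<dots> = comb w (\<lambda>k. norm (f k))"
    unfolding comb_def using wts_nonneg[OF assms] by simp
  finally show ?thesis .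
qed

lemma norm_comb_bound:
  assumes "w \<in> wts i" "\<And>k. i \<le> k \<Longrightarrow> norm (f k) \<le> c"
  shows "norm (comb w f) \<le> c"
  by (rule order_trans[OF norm_comb_le[OF assms(1)] comb_le[OF assms]])

text \<open>The variance of \<open>f\<close> under the probability weights \<open>w\<close> is
  nonnegative.\<close>

lemma comb_power2_le:
  fixes f :: "nat \<Rightarrow> real"
  assumes "w \<in> wts i"
  shows "(comb w f)\<^sup>2 \<le> comb w (\<lambda>k. (f k)\<^sup>2)"
proof -
  let ?a = "comb w f"
  have "0 \<le> comb w (\<lambda>k. (f k - ?a)\<^sup>2)"
    by (rule comb_ge[OF assms]) simp
  also have "(\<lambda>k. (f k - ?a)\<^sup>2) = (\<lambda>k. ((f k)\<^sup>2 - (2 * ?a) * f k) + ?a\<^sup>2)"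
    by (auto simp: power2_diff algebra_simps)
  also have "comb w \<dots> = comb w (\<lambda>k. (f k)\<^sup>2) - ?a\<^sup>2"
    unfolding comb_add comb_diff comb_cmult comb_const[OF assms]
    by (simp add: power2_eq_square)
  finally show ?thesis by simp
qed

lemma comp_wts:
  assumes "w \<in> wts i" "\<And>j. C j \<in> wts j"
  shows "comp_wts w C \<in> wts i"
    and "comb (comp_wts w C) f = comb w (\<lambda>j. comb (C j) f)"
proof -
  let ?W = "{j. w j \<noteq> 0}"
  let ?S = "\<Union>j\<in>?W. {k. C j k \<noteq> 0}"
  have fin: "finite ?W" "finite ?S"
    using wts_finite[OF assms(1)] wts_finite[OF assms(2)] by auto
  have z: "comp_wts w C k = 0" if "k \<notin> ?S" for k
    using that by (auto simp: comp_wts_def comb_def intro!: sum.neutral)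
  have inS: "comb (C j) f = (\<Sum>k\<in>?S. C j k *\<^sub>R f k)" if "j \<in> ?W" for j and f :: "nat \<Rightarrow> 'z::real_vector"
    using that fin by (intro comb_eq_sum) auto
  have eq: "comb (comp_wts w C) f = comb w (\<lambda>j. comb (C j) f)" for f :: "nat \<Rightarrow> 'z::real_vector"
  proof -
    have "comb (comp_wts w C) f = (\<Sum>k\<in>?S. comp_wts w C k *\<^sub>R f k)"
      using fin z by (intro comb_eq_sum) auto
    also have "\<dots> = (\<Sum>k\<in>?S. \<Sum>j\<in>?W. (w j * C j k) *\<^sub>R f k)"
      by (simp add: comp_wts_def comb_def scaleR_sum_left)
    also have "\<dots> = (\<Sum>j\<in>?W. \<Sum>k\<in>?S. (w j * C j k) *\<^sub>R f k)"
      by (rule sum.swap)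
    also have "\<dots> = (\<Sum>j\<in>?W. w j *\<^sub>R comb (C j) f)"
      by (intro sum.cong refl, subst inS) (auto simp: scaleR_sum_right)
    finally show ?thesis by (simp add: comb_def)
  qed
  show "comb (comp_wts w C) f = comb w (\<lambda>j. comb (C j) f)" by (rule eq)
  show "comp_wts w C \<in> wts i"
  proof (rule wtsI[of ?S])
    show "0 \<le> comp_wts w C k" for k
      unfolding comp_wts_def by (rule comb_ge[OF assms(1)]) (use wts_nonneg[OF assms(2)] in auto)
    show "comp_wts w C k = 0" if "k < i" for k
    proof -
      have "comp_wts w C k = comb w (\<lambda>_. 0)"
        unfolding comp_wts_def
        by (rule comb_cong[OF assms(1)]) (use wts_below[OF assms(2)] that in auto)
      then show ?thesis by (simp add: comb_def)
    qed
    have "sum (comp_wts w C) ?S = comb (comp_wts w C) (\<lambda>_. 1)"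
      using fin z by (subst comb_eq_sum[of ?S]) auto
    also have "\<dots> = 1"
      unfolding eq by (simp add: comb_const[OF assms(2)] comb_const[OF assms(1)])
    finally show "sum (comp_wts w C) ?S = 1" .
  qed (use fin z in auto)
qed

lemma comp_wts_assoc:
  assumes "w \<in> wts i" "\<And>j. C j \<in> wts j"
  shows "comp_wts (comp_wts w C) W = comp_wts w (\<lambda>j. comp_wts (C j) W)"
  by (rule ext, unfold comp_wts_def[of _ W], subst comp_wts(2)[OF assms]) (simp add: comp_wts_def)

text \<open>Weights in \<open>wts i\<close> see only indices from \<open>i\<close> on, so they
  average terms that are already close to the limit. Hence no later passage to convex combinations
  can destroy a convergence.\<close>

lemma comb_tendsto:
  fixes a :: "nat \<Rightarrow> 'b::real_normed_vector"
  assumes a: "a \<longlonglongrightarrow> l" and C: "\<And>i. i0 \<le> i \<Longrightarrow> C i \<in> wts i"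
  shows "(\<lambda>i. comb (C i) a) \<longlonglongrightarrow> l"
proof (rule LIMSEQ_I)
  fix r :: real assume "0 < r"
  then obtain N where N: "\<And>n. n \<ge> N \<Longrightarrow> norm (a n - l) < r/2"
    using LIMSEQ_D[OF a, of "r/2"] by auto
  have "norm (comb (C i) a - l) < r" if "i \<ge> max i0 N" for i
  proof -
    have Ci: "C i \<in> wts i" using C that by auto
    have "norm (comb (C i) (\<lambda>k. a k - l)) \<le> r/2"
      by (rule norm_comb_bound[OF Ci]) (use N that in \<open>auto intro: less_imp_le\<close>)
    then show ?thesis using \<open>0 < r\<close> by (simp add: comb_diff comb_const[OF Ci])
  qed
  then show "\<exists>no. \<forall>n\<ge>no. norm (comb (C n) a - l) < r" by blast
qed

lemma comb_convergent:
  fixes a :: "nat \<Rightarrow> 'b::real_normed_vector"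
  assumes "convergent a" and "\<And>i. i0 \<le> i \<Longrightarrow> C i \<in> wts i"
  shows "convergent (\<lambda>i. comb (C i) a)"
  using assms comb_tendsto[of a _ i0 C] unfolding convergent_def by blast

lemma comb_tendsto_filter:
  fixes f :: "nat \<Rightarrow> 'a \<Rightarrow> 'b::real_normed_vector"
  assumes "\<And>k. (f k \<longlongrightarrow> l k) G"
  shows "((\<lambda>x. comb w (\<lambda>k. f k x)) \<longlongrightarrow> comb w l) G"
  unfolding comb_def by (intro tendsto_sum tendsto_scaleR tendsto_const assms)

text \<open>The parallelogram argument: near-minimisers of \<open>\<Phi>\<close> over the tails are automatically
  \<open>d\<close>-close to each other.\<close>

lemma forward_minimizers:
  fixes \<Phi> :: "(nat \<Rightarrow> real) \<Rightarrow> real" and \<epsilon> :: "nat \<Rightarrow> real"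
  assumes nonneg: "\<And>w. w \<in> wts 0 \<Longrightarrow> 0 \<le> \<Phi> w"
    and bdd: "\<And>w. w \<in> wts 0 \<Longrightarrow> \<Phi> w \<le> c"
    and d: "\<And>w v. w \<in> wts 0 \<Longrightarrow> v \<in> wts 0 \<Longrightarrow> d w v \<le> \<Phi> w + \<Phi> v - 2 * \<Phi> (\<lambda>k. (w k + v k) / 2)"
    and \<epsilon>: "\<And>i. 0 < \<epsilon> i" "decseq \<epsilon>"
  shows "\<exists>C. (\<forall>i. C i \<in> wts i) \<and> (\<forall>i j. i \<le> j \<longrightarrow> d (C i) (C j) \<le> \<epsilon> i)"
proof -
  define a where "a i = Inf (\<Phi> ` wts i)" for i
  have w0: "w \<in> wts 0" if "w \<in> wts i" for w i using that wts_antimono[of 0 i] by auto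
  have ne: "wts i \<noteq> {}" for i using unit_wts[of i] by auto
  have bb: "bdd_below (\<Phi> ` wts i)" for i
    using nonneg w0 by (intro bdd_belowI[of _ 0]) auto
  have a_le: "a i \<le> \<Phi> w" if "w \<in> wts i" for i w
    unfolding a_def using that bb by (intro cInf_lower) auto
  have "a i \<le> a j" if "i \<le> j" for i j
    unfolding a_def by (rule cInf_superset_mono) (use ne bb image_mono[OF wts_antimono[OF that], of \<Phi>] in auto)
  then have "incseq a" by (simp add: incseq_def)
  have "a i \<le> c" for i
    using a_le[OF unit_wts[of i]] bdd[OF w0[OF unit_wts[of i]]] by linarith
  then obtain l where l: "a \<longlonglongrightarrow> l" "\<And>i. a i \<le> l"
    using incseq_convergent[OF \<open>incseq a\<close>, of c] by auto
  \<comment> \<open>The tail infima \<open>a\<close> increase to \<open>l\<close>. Two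
    near-minimisers lie below \<open>l + \<epsilon> i / 4\<close> and their midpoint above
    \<open>l - \<epsilon> i / 4\<close>, so the midpoint defect is at most
    \<open>\<epsilon> i\<close>.\<close>
  have "\<exists>p\<ge>i. l - a p \<le> \<epsilon> i / 4" for i
  proof -
    have "eventually (\<lambda>p. l - \<epsilon> i / 4 < a p) sequentially"
      using l(1) \<epsilon>(1)[of i] by (intro order_tendstoD) auto
    then obtain N where "\<And>p. p \<ge> N \<Longrightarrow> l - \<epsilon> i / 4 < a p" by (auto simp: eventually_sequentially)
    from this[of "max i N"] show ?thesis by (intro exI[of _ "max i N"]) auto
  qed
  then obtain p where p: "\<And>i. p i \<ge> i" "\<And>i. l - a (p i) \<le> \<epsilon> i / 4" by metis
  have "\<exists>w\<in>wts (p i). \<Phi> w < a (p i) + \<epsilon> i / 4" for i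
    using cInf_lessD[of "\<Phi> ` wts (p i)" "a (p i) + \<epsilon> i / 4"] ne \<epsilon>(1)[of i] by (auto simp: a_def)
  then obtain C where C: "\<And>i. C i \<in> wts (p i)" "\<And>i. \<Phi> (C i) < a (p i) + \<epsilon> i / 4" by metis
  have "d (C i) (C j) \<le> \<epsilon> i" if "i \<le> j" for i j
  proof -
    let ?m = "min (p i) (p j)"
    have eps: "\<epsilon> j \<le> \<epsilon> i" using \<epsilon>(2) that by (auto simp: decseq_def)
    have "(\<lambda>k. (C i k + C j k) / 2) \<in> wts ?m"
      by (rule mid_wts) (use C(1)[of i] C(1)[of j] wts_antimono[of ?m "p i"] wts_antimono[of ?m "p j"] in auto)
    from a_le[OF this] have "a ?m \<le> \<Phi> (\<lambda>k. (C i k + C j k) / 2)" .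
    moreover have "l - a ?m \<le> \<epsilon> i / 4" using p(2)[of i] p(2)[of j] eps by (auto simp: min_def)
    moreover have "\<Phi> (C i) \<le> l + \<epsilon> i / 4" "\<Phi> (C j) \<le> l + \<epsilon> i / 4"
      using C(2)[of i] C(2)[of j] l(2)[of "p i"] l(2)[of "p j"] eps by linarith+
    ultimately show ?thesis using d[OF w0[OF C(1)[of i]] w0[OF C(1)[of j]]] by linarith
  qed
  moreover have "C i \<in> wts i" for i using C(1)[of i] wts_antimono[OF p(1)[of i]] by auto
  ultimately show ?thesis by blast
qed

text \<open>Requirement \<open>j\<close> is met by refining the weights found for the earlier ones.
  On the diagonal all rows from \<open>Suc j\<close> on are forward combinations of stage
  \<open>Suc j\<close>, and \<open>stable\<close> transfers \<open>P j\<close> to them; the index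
  \<open>i0\<close> there accounts for the finitely many earlier rows.\<close>

lemma diagonal_wts:
  fixes P :: "nat \<Rightarrow> (nat \<Rightarrow> nat \<Rightarrow> real) \<Rightarrow> bool"
  assumes ex: "\<And>j W. (\<And>i. W i \<in> wts i) \<Longrightarrow> \<exists>C. (\<forall>i. C i \<in> wts i) \<and> P j (\<lambda>i. comp_wts (C i) W)"
    and stable: "\<And>j W C V i0. (\<And>i. W i \<in> wts i) \<Longrightarrow> P j W \<Longrightarrow> (\<And>i. C i \<in> wts i) \<Longrightarrow>
        (\<And>i. i0 \<le> i \<Longrightarrow> V i = comp_wts (C i) W) \<Longrightarrow> P j V"
  shows "\<exists>V. (\<forall>i. V i \<in> wts i) \<and> (\<forall>j. P j V)"
proof -
  \<comment> \<open>Vacuous unless \<open>W\<close> consists of weights, so that a refinement can be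
    selected for every \<open>W\<close> and the recursion \<open>U\<close> is total.\<close>
  define Q where "Q j W C \<longleftrightarrow> (\<forall>i. C i \<in> wts i) \<and> ((\<forall>i. W i \<in> wts i) \<longrightarrow> P j (\<lambda>i. comp_wts (C i) W))" for j W C
  have Qex: "\<exists>C. Q j W C" for j W
  proof (cases "\<forall>i. W i \<in> wts i")
    case True
    then show ?thesis using ex[of W j] by (auto simp: Q_def)
  next
    case False
    then show ?thesis using unit_wts by (intro exI[of _ "\<lambda>i k. if k = i then 1 else 0"]) (auto simp: Q_def)
  qed
  define C where "C j W = (SOME C. Q j W C)" for j W
  have "Q j W (C j W)" for j W unfolding C_def by (rule someI_ex[OF Qex])
  then have C: "\<And>j W i. C j W i \<in> wts i"
    "\<And>j W. (\<And>i. W i \<in> wts i) \<Longrightarrow> P j (\<lambda>i. comp_wts (C j W i) W)" by (auto simp: Q_def)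
  define U where "U = rec_nat (\<lambda>i k. if k = i then 1 else 0) (\<lambda>j W i. comp_wts (C j W i) W)"
  have U0: "U 0 = (\<lambda>i k. if k = i then 1 else 0)" and US: "U (Suc j) = (\<lambda>i. comp_wts (C j (U j) i) (U j))" for j
    by (auto simp: U_def)
  have Uw: "U j i \<in> wts i" for i j
  proof (induction j arbitrary: i)
    case 0 then show ?case by (simp add: U0 unit_wts)
  next
    case (Suc j) then show ?case unfolding US by (intro comp_wts(1) C(1))
  qed
  have PU: "P j (U (Suc j))" for j unfolding US by (rule C(2)[OF Uw])
  \<comment> \<open>Associativity of \<open>comp_wts\<close> collapses the \<open>n\<close>
    refinements after stage \<open>j\<close> into a single one.\<close>
  have tail: "\<exists>D. (\<forall>l. D l \<in> wts l) \<and> U (j + n) = (\<lambda>l. comp_wts (D l) (U j))" for j n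
  proof (induction n)
    case 0
    have "U j = (\<lambda>l. comp_wts (\<lambda>k. if k = l then 1 else 0) (U j))"
      by (auto simp: comp_wts_def comb_unit fun_eq_iff)
    then show ?case using unit_wts by (intro exI[of _ "\<lambda>l k. if k = l then 1 else 0"]) auto
  next
    case (Suc n)
    then obtain D where D: "\<And>l. D l \<in> wts l" "U (j + n) = (\<lambda>l. comp_wts (D l) (U j))" by blast
    have "U (j + Suc n) = (\<lambda>l. comp_wts (comp_wts (C (j + n) (U (j + n)) l) D) (U j))"
      unfolding add_Suc_right US by (subst comp_wts_assoc[OF C(1) D(1)]) (simp add: D(2))
    then show ?case
      using comp_wts(1)[OF C(1) D(1)] by (intro exI[of _ "\<lambda>l. comp_wts (C (j + n) (U (j + n)) l) D"]) blast
  qed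
  have "P j (\<lambda>i. U i i)" for j
  proof -
    have "\<exists>D. D \<in> wts i \<and> (Suc j \<le> i \<longrightarrow> U i i = comp_wts D (U (Suc j)))" for i
    proof (cases "Suc j \<le> i")
      case True
      then obtain n where "i = Suc j + n" using le_Suc_ex by blast
      then show ?thesis using tail[of "Suc j" n] by auto
    next
      case False then show ?thesis using unit_wts by blast
    qed
    then obtain D where "\<And>i. D i \<in> wts i" "\<And>i. Suc j \<le> i \<Longrightarrow> U i i = comp_wts (D i) (U (Suc j))" by metis
    from stable[OF Uw PU this] show ?thesis .
  qed
  then show ?thesis using Uw by (intro exI[of _ "\<lambda>i. U i i"]) auto
qed

lemma comb_in_co:
  fixes f :: "nat \<Rightarrow> 'z \<Rightarrow> 'b::real_vector"
  assumes "w \<in> wts i"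
  shows "(\<lambda>z. comb w (\<lambda>n. f n z)) \<in> co {f n | n. i \<le> n}"
proof -
  let ?I = "{k. w k \<noteq> 0}"
  have I: "finite ?I" and Ii: "k \<in> ?I \<Longrightarrow> i \<le> k" for k
    using wts_finite[OF assms] wts_below[OF assms, of k] by (auto simp: not_less[symmetric])
  \<comment> \<open>\<open>co\<close> sums over a set of functions, so indices with equal
    \<open>f k\<close> must be merged and their weights added.\<close>
  define c where "c g = (\<Sum>k | k \<in> ?I \<and> f k = g. w k)" for g
  have "(\<lambda>z. comb w (\<lambda>n. f n z)) = (\<lambda>z. \<Sum>g\<in>f ` ?I. c g *\<^sub>R g z)"
  proof
    fix z
    have "comb w (\<lambda>n. f n z) = (\<Sum>g\<in>f ` ?I. \<Sum>k | k \<in> ?I \<and> f k = g. w k *\<^sub>R f k z)"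
      unfolding comb_def by (rule sum.image_gen[OF I])
    also have "\<dots> = (\<Sum>g\<in>f ` ?I. c g *\<^sub>R g z)"
      unfolding c_def scaleR_sum_left by (intro sum.cong) auto
    finally show "comb w (\<lambda>n. f n z) = (\<Sum>g\<in>f ` ?I. c g *\<^sub>R g z)" .
  qed
  moreover have "sum c (f ` ?I) = 1"
    unfolding c_def using sum.image_gen[OF I, of w f] assms by (simp add: wts_def)
  moreover have "0 \<le> c g" for g unfolding c_def using wts_nonneg[OF assms] by (auto intro: sum_nonneg)
  ultimately show ?thesis
    unfolding co_def using I Ii by (intro CollectI exI[of _ "f ` ?I"] exI[of _ c]) auto
qed

lemma comb_measurable [measurable (raw)]:
  fixes f :: "nat \<Rightarrow> 'a \<Rightarrow> real"
  assumes "\<And>n. f n \<in> borel_measurable M"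
  shows "(\<lambda>x. comb w (\<lambda>n. f n x)) \<in> borel_measurable M"
  unfolding comb_def using assms by measurable

lemma comb_integrable:
  fixes f :: "nat \<Rightarrow> 'a \<Rightarrow> real"
  assumes "\<And>n. integrable M (f n)"
  shows "integrable M (\<lambda>x. comb w (\<lambda>n. f n x))"
    and "(\<integral>x. comb w (\<lambda>n. f n x) \<partial>M) = comb w (\<lambda>n. \<integral>x. f n x \<partial>M)"
  unfolding comb_def using assms by (auto simp: integral_sum)

section \<open>Almost sure convergence from summable mean increments\<close>

lemma AE_summable_of_integral:
  fixes f :: "nat \<Rightarrow> 'a \<Rightarrow> real"
  assumes int: "\<And>i. integrable M (f i)" and le: "\<And>i. (\<integral>x. \<bar>f i x\<bar> \<partial>M) \<le> (1/2)^i"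
  shows "AE x in M. summable (\<lambda>i. \<bar>f i x\<bar>)"
proof -
  have [measurable]: "f i \<in> borel_measurable M" for i using int by auto
  have "(\<integral>\<^sup>+x. (\<Sum>i. ennreal \<bar>f i x\<bar>) \<partial>M) = (\<Sum>i. \<integral>\<^sup>+x. ennreal \<bar>f i x\<bar> \<partial>M)"
    by (rule nn_integral_suminf) auto
  also have "\<dots> \<le> (\<Sum>i. ennreal ((1/2)^i))"
  proof (rule suminf_le)
    fix i
    have "(\<integral>\<^sup>+x. ennreal \<bar>f i x\<bar> \<partial>M) = ennreal (\<integral>x. \<bar>f i x\<bar> \<partial>M)"
      by (rule nn_integral_eq_integral) (use int in auto)
    then show "(\<integral>\<^sup>+x. ennreal \<bar>f i x\<bar> \<partial>M) \<le> ennreal ((1/2)^i)"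
      using le[of i] by (simp add: ennreal_leI)
  qed auto
  also have "\<dots> < \<infinity>"
    by (subst suminf_ennreal_eq[of _ 2]) (use geometric_sums[of "1/2::real"] in auto)
  finally have "AE x in M. (\<Sum>i. ennreal \<bar>f i x\<bar>) \<noteq> \<infinity>"
    by (intro nn_integral_PInf_AE) (auto simp: less_top)
  then show ?thesis
    by eventually_elim (auto intro: summable_suminf_not_top)
qed

lemma AE_convergent_of_integral:
  fixes f :: "nat \<Rightarrow> 'a \<Rightarrow> real"
  assumes int: "\<And>i. integrable M (f i)"
    and le: "\<And>i. (\<integral>x. \<bar>f (Suc i) x - f i x\<bar> \<partial>M) \<le> (1/2)^i"
  shows "AE x in M. convergent (\<lambda>i. f i x)"
proof -
  have "AE x in M. summable (\<lambda>i. \<bar>f (Suc i) x - f i x\<bar>)"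
    by (rule AE_summable_of_integral) (use int le in auto)
  then show ?thesis
  proof eventually_elim
    case (elim x)
    from summable_rabs_cancel[OF elim] have "summable (\<lambda>i. f (Suc i) x - f i x)" .
    then have "convergent (\<lambda>n. \<Sum>i<n. f (Suc i) x - f i x)"
      by (simp add: summable_iff_convergent)
    then have "convergent (\<lambda>n. f n x - f 0 x)"
      using sum_lessThan_telescope[of "\<lambda>i. f i x"] by simp
    from convergent_add[OF this convergent_const[of "f 0 x"]] show ?case by simp
  qed
qed

section \<open>Komlos-type lemmas for square-integrable and for nonnegative random variables\<close>

context prob_space
begin

text \<open>Integrating \<open>\<bar>y\<bar> \<le> s / 2 + y\<^sup>2 / (2 * s)\<close> does the work
  of the Cauchy-Schwarz inequality; the choice \<open>s = 1\<close> already gives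
  integrability.\<close>

lemma L1_le_L2:
  fixes f :: "'a \<Rightarrow> real"
  assumes [measurable]: "f \<in> borel_measurable M" and int: "integrable M (\<lambda>x. (f x)\<^sup>2)"
  shows "integrable M f"
    and "0 < s \<Longrightarrow> (\<integral>x. (f x)\<^sup>2 \<partial>M) \<le> s\<^sup>2 \<Longrightarrow> (\<integral>x. \<bar>f x\<bar> \<partial>M) \<le> s"
proof -
  have amgm: "\<bar>y\<bar> \<le> s / 2 + y\<^sup>2 / (2 * s)" if "0 < s" for s y :: real
  proof -
    have "0 \<le> (\<bar>y\<bar> - s)\<^sup>2" by simp
    then have "2 * s * \<bar>y\<bar> \<le> s\<^sup>2 + y\<^sup>2" by (simp add: power2_diff ac_simps)
    then show ?thesis using that by (simp add: field_simps power2_eq_square)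
  qed
  show i: "integrable M f"
    by (rule Bochner_Integration.integrable_bound[of _ "\<lambda>x. 1 / 2 + (f x)\<^sup>2 / 2"])
       (use int amgm[of 1] in \<open>auto intro!: order_trans[OF _ abs_ge_self]\<close>)
  assume s: "0 < s" and le: "(\<integral>x. (f x)\<^sup>2 \<partial>M) \<le> s\<^sup>2"
  have "(\<integral>x. \<bar>f x\<bar> \<partial>M) \<le> (\<integral>x. s / 2 + (f x)\<^sup>2 / (2 * s) \<partial>M)"
    by (rule integral_mono) (use i int amgm[OF s] in auto)
  also have "\<dots> = s / 2 + (\<integral>x. (f x)\<^sup>2 \<partial>M) / (2 * s)"
    using int by (simp add: prob_space)
  also have "\<dots> \<le> s / 2 + s\<^sup>2 / (2 * s)"
    using le s by (intro add_left_mono divide_right_mono) auto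
  also have "\<dots> = s" using s by (simp add: power2_eq_square)
  finally show "(\<integral>x. \<bar>f x\<bar> \<partial>M) \<le> s" .
qed

lemma comb_square_integrable:
  fixes f :: "nat \<Rightarrow> 'a \<Rightarrow> real"
  assumes f [measurable]: "\<And>n. f n \<in> borel_measurable M"
    and int: "\<And>n. integrable M (\<lambda>x. (f n x)\<^sup>2)" and le: "\<And>n. (\<integral>x. (f n x)\<^sup>2 \<partial>M) \<le> c"
    and w: "w \<in> wts i"
  shows "integrable M (\<lambda>x. (comb w (\<lambda>n. f n x))\<^sup>2)"
    and "(\<integral>x. (comb w (\<lambda>n. f n x))\<^sup>2 \<partial>M) \<le> c"
proof -
  have ic: "integrable M (\<lambda>x. comb w (\<lambda>n. (f n x)\<^sup>2))" by (rule comb_integrable[OF int])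
  show isq: "integrable M (\<lambda>x. (comb w (\<lambda>n. f n x))\<^sup>2)"
    by (rule Bochner_Integration.integrable_bound[OF ic])
       (auto intro!: order_trans[OF comb_power2_le[OF w] abs_ge_self])
  have "(\<integral>x. (comb w (\<lambda>n. f n x))\<^sup>2 \<partial>M) \<le> (\<integral>x. comb w (\<lambda>n. (f n x)\<^sup>2) \<partial>M)"
    by (rule integral_mono[OF isq ic comb_power2_le[OF w]])
  also have "\<dots> \<le> c" unfolding comb_integrable(2)[OF int] by (rule comb_le[OF w le])
  finally show "(\<integral>x. (comb w (\<lambda>n. f n x))\<^sup>2 \<partial>M) \<le> c" .
qed

lemma integrable_square_diff:
  fixes f g :: "'a \<Rightarrow> real"
  assumes [measurable]: "f \<in> borel_measurable M" "g \<in> borel_measurable M"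
    and "integrable M (\<lambda>x. (f x)\<^sup>2)" "integrable M (\<lambda>x. (g x)\<^sup>2)"
  shows "integrable M (\<lambda>x. (f x - g x)\<^sup>2)"
proof (rule Bochner_Integration.integrable_bound)
  show "integrable M (\<lambda>x. 2 * (f x)\<^sup>2 + 2 * (g x)\<^sup>2)" using assms by auto
  have "(a - b)\<^sup>2 \<le> 2 * a\<^sup>2 + 2 * b\<^sup>2" for a b :: real
    using zero_le_power2[of "a + b"] by (simp add: power2_diff power2_sum)
  then show "AE x in M. norm ((f x - g x)\<^sup>2) \<le> norm (2 * (f x)\<^sup>2 + 2 * (g x)\<^sup>2)" by auto
qed measurable

text \<open>By the parallelogram law the midpoint defect of the second moment is a multiple of the
  squared distance, so near-minimisers are Cauchy in mean square; Fatou's lemma carries the bounds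
  to the limit. The rate \<open>(1/4)^i\<close> is chosen so that a maximal inequality at level
  \<open>(1/2)^i\<close> still leaves summable probabilities.\<close>

lemma L2_forward_convex:
  fixes f :: "nat \<Rightarrow> 'a \<Rightarrow> real"
  assumes f [measurable]: "\<And>n. f n \<in> borel_measurable M"
    and int: "\<And>n. integrable M (\<lambda>x. (f n x)\<^sup>2)" and le: "\<And>n. (\<integral>x. (f n x)\<^sup>2 \<partial>M) \<le> c"
  shows "\<exists>C g. (\<forall>i. C i \<in> wts i) \<and> g \<in> borel_measurable M \<and>
    integrable M (\<lambda>x. (g x)\<^sup>2) \<and> (\<integral>x. (g x)\<^sup>2 \<partial>M) \<le> c \<and>
    (\<forall>i. (\<integral>x. \<bar>comb (C i) (\<lambda>n. f n x) - g x\<bar> \<partial>M) \<le> (1/4)^i)"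
proof -
  define \<Phi> where "\<Phi> w = (\<integral>x. (comb w (\<lambda>n. f n x))\<^sup>2 \<partial>M)" for w
  define d where "d w v = (1/2) * (\<integral>x. (comb w (\<lambda>n. f n x) - comb v (\<lambda>n. f n x))\<^sup>2 \<partial>M)" for w v
  note sq = comb_square_integrable[OF f int le]
  have "\<exists>C. (\<forall>i. C i \<in> wts i) \<and> (\<forall>i j. i \<le> j \<longrightarrow> d (C i) (C j) \<le> (1/2) * (1/16)^i)"
  proof (rule forward_minimizers[where \<Phi> = \<Phi> and c = c])
    show "0 \<le> \<Phi> w" for w by (simp add: \<Phi>_def)
    show "\<Phi> w \<le> c" if "w \<in> wts 0" for w unfolding \<Phi>_def by (rule sq(2)[OF that])
    show "d w v \<le> \<Phi> w + \<Phi> v - 2 * \<Phi> (\<lambda>k. (w k + v k) / 2)" if w: "w \<in> wts 0" and v: "v \<in> wts 0" for w v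
    proof -
      let ?a = "\<lambda>x. comb w (\<lambda>n. f n x)" and ?b = "\<lambda>x. comb v (\<lambda>n. f n x)"
      have i: "integrable M (\<lambda>x. (?a x - ?b x)\<^sup>2)"
        by (intro integrable_square_diff sq(1)[OF w] sq(1)[OF v]) auto
      have "2 * \<Phi> (\<lambda>k. (w k + v k) / 2) = (\<integral>x. (?a x)\<^sup>2 + (?b x)\<^sup>2 - (1/2) * (?a x - ?b x)\<^sup>2 \<partial>M)"
        unfolding \<Phi>_def comb_mid[OF w v] integral_mult_right_zero[symmetric]
        by (intro Bochner_Integration.integral_cong refl) (simp add: power2_eq_square algebra_simps)
      also have "\<dots> = \<Phi> w + \<Phi> v - d w v"
        unfolding \<Phi>_def d_def using sq(1)[OF w] sq(1)[OF v] i by simp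
      finally show ?thesis by simp
    qed
    show "decseq (\<lambda>i. (1/2) * (1/16)^i :: real)"
      by (auto simp: decseq_def intro!: power_decreasing)
  qed auto
  then obtain C where C: "\<And>i. C i \<in> wts i" "\<And>i j. i \<le> j \<Longrightarrow> d (C i) (C j) \<le> (1/2) * (1/16)^i" by blast
  define h where "h i x = comb (C i) (\<lambda>n. f n x)" for i x
  have h [measurable]: "h i \<in> borel_measurable M" for i unfolding h_def by measurable
  have hint: "integrable M (\<lambda>x. (h i x)\<^sup>2)" "(\<integral>x. (h i x)\<^sup>2 \<partial>M) \<le> c" for i
    unfolding h_def by (rule sq[OF C(1)])+
  have h1: "integrable M (h i)" for i by (rule L1_le_L2(1)[OF h hint(1)])
  have dist: "(\<integral>x. \<bar>h i x - h j x\<bar> \<partial>M) \<le> (1/4)^i" if "i \<le> j" for i j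
  proof (rule L1_le_L2(2))
    show "integrable M (\<lambda>x. (h i x - h j x)\<^sup>2)" by (intro integrable_square_diff hint(1)) auto
    have "(\<integral>x. (h i x - h j x)\<^sup>2 \<partial>M) \<le> (1/16)^i"
      using C(2)[OF that] unfolding d_def h_def by simp
    also have "\<dots> = ((1/4)^i)\<^sup>2" by (simp add: power2_eq_square flip: power_mult_distrib)
    finally show "(\<integral>x. (h i x - h j x)\<^sup>2 \<partial>M) \<le> ((1/4)^i)\<^sup>2" .
  qed auto
  have "AE x in M. convergent (\<lambda>i. h i x)"
  proof (rule AE_convergent_of_integral[OF h1])
    fix i
    have "(\<integral>x. \<bar>h (Suc i) x - h i x\<bar> \<partial>M) \<le> (1/4)^i"
      using dist[of i "Suc i"] by (simp add: abs_minus_commute)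
    also have "\<dots> \<le> (1/2)^i" by (rule power_mono) auto
    finally show "(\<integral>x. \<bar>h (Suc i) x - h i x\<bar> \<partial>M) \<le> (1/2)^i" .
  qed
  define g where "g x = lim (\<lambda>i. h i x)" for x
  have g [measurable]: "g \<in> borel_measurable M" unfolding g_def by measurable
  have lim: "AE x in M. (\<lambda>i. h i x) \<longlonglongrightarrow> g x"
    using \<open>AE x in M. convergent (\<lambda>i. h i x)\<close> by eventually_elim (simp add: g_def convergent_LIMSEQ_iff)
  have nng: "(\<integral>\<^sup>+x. ennreal ((g x)\<^sup>2) \<partial>M) \<le> ennreal c"
  proof -
    have "(\<integral>\<^sup>+x. ennreal ((g x)\<^sup>2) \<partial>M) = (\<integral>\<^sup>+x. liminf (\<lambda>i. ennreal ((h i x)\<^sup>2)) \<partial>M)"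
    proof (rule nn_integral_cong_AE, use lim in eventually_elim)
      case (elim x)
      then have "(\<lambda>i. ennreal ((h i x)\<^sup>2)) \<longlonglongrightarrow> ennreal ((g x)\<^sup>2)" by (intro tendsto_intros)
      then show ?case by (rule lim_imp_Liminf[OF trivial_limit_sequentially, symmetric])
    qed
    also have "\<dots> \<le> liminf (\<lambda>i. \<integral>\<^sup>+x. ennreal ((h i x)\<^sup>2) \<partial>M)" by (rule nn_integral_liminf) auto
    also have "\<dots> \<le> ennreal c"
    proof (rule order_trans[OF Liminf_le_Limsup Limsup_bounded])
      show "\<forall>\<^sub>F i in sequentially. (\<integral>\<^sup>+x. ennreal ((h i x)\<^sup>2) \<partial>M) \<le> ennreal c"
        using hint by (intro always_eventually allI) (simp add: nn_integral_eq_integral ennreal_leI)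
    qed auto
    finally show ?thesis .
  qed
  have c: "0 \<le> c" using le[of 0] by (rule order_trans[rotated]) simp
  have ig: "integrable M (\<lambda>x. (g x)\<^sup>2)"
    by (rule integrableI_nonneg) (use nng in \<open>auto intro: le_less_trans\<close>)
  moreover have "(\<integral>x. (g x)\<^sup>2 \<partial>M) \<le> c"
    using nng ig c by (simp add: nn_integral_eq_integral)
  moreover have "(\<integral>x. \<bar>h i x - g x\<bar> \<partial>M) \<le> (1/4)^i" for i
  proof -
    have gi: "integrable M g" by (rule L1_le_L2(1)[OF g ig])
    have "(\<integral>\<^sup>+x. ennreal \<bar>h i x - g x\<bar> \<partial>M) = (\<integral>\<^sup>+x. liminf (\<lambda>j. ennreal \<bar>h i x - h j x\<bar>) \<partial>M)"
    proof (rule nn_integral_cong_AE, use lim in eventually_elim)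
      case (elim x)
      then have "(\<lambda>j. ennreal \<bar>h i x - h j x\<bar>) \<longlonglongrightarrow> ennreal \<bar>h i x - g x\<bar>" by (intro tendsto_intros)
      then show ?case by (rule lim_imp_Liminf[OF trivial_limit_sequentially, symmetric])
    qed
    also have "\<dots> \<le> liminf (\<lambda>j. \<integral>\<^sup>+x. ennreal \<bar>h i x - h j x\<bar> \<partial>M)" by (rule nn_integral_liminf) auto
    also have "\<dots> \<le> ennreal ((1/4)^i)"
    proof (rule order_trans[OF Liminf_le_Limsup Limsup_bounded])
      show "\<forall>\<^sub>F j in sequentially. (\<integral>\<^sup>+x. ennreal \<bar>h i x - h j x\<bar> \<partial>M) \<le> ennreal ((1/4)^i)"
        using eventually_ge_at_top[of i]
        by eventually_elim (use dist h1 in \<open>simp add: nn_integral_eq_integral ennreal_leI\<close>)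
    qed auto
    finally show ?thesis using gi h1[of i] by (simp add: nn_integral_eq_integral)
  qed
  ultimately show ?thesis using C(1) g unfolding h_def by blast
qed

text \<open>With \<open>u = exp (- f / 2)\<close> the midpoint defect of \<open>E[exp (- f)]\<close> is exactly \<open>E[(u - v)\<^sup>2]\<close>.\<close>

lemma nonneg_forward_convex:
  fixes f :: "nat \<Rightarrow> 'a \<Rightarrow> real"
  assumes f [measurable]: "\<And>n. f n \<in> borel_measurable M" and nn: "\<And>n x. x \<in> space M \<Longrightarrow> 0 \<le> f n x"
    and bdd: "\<And>\<epsilon>. 0 < \<epsilon> \<Longrightarrow> \<exists>\<delta>. \<forall>w\<in>wts 0. prob {x \<in> space M. \<delta> \<le> comb w (\<lambda>n. f n x)} \<le> \<epsilon>"
  shows "\<exists>C. (\<forall>i. C i \<in> wts i) \<and> (AE x in M. convergent (\<lambda>i. comb (C i) (\<lambda>n. f n x)))"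
proof -
  define u where "u w x = exp (- comb w (\<lambda>n. f n x) / 2)" for w x
  have u [measurable]: "u w \<in> borel_measurable M" for w unfolding u_def by measurable
  have u01: "0 < u w x \<and> u w x \<le> 1" if "w \<in> wts i" "x \<in> space M" for w x i
    unfolding u_def using comb_ge[OF that(1), of 0 "\<lambda>n. f n x"] nn[OF that(2)] by simp
  have iu: "integrable M (\<lambda>x. u w x * u v x)" if "w \<in> wts 0" "v \<in> wts 0" for w v
  proof (rule integrable_const_bound[of _ 1])
    show "AE x in M. norm (u w x * u v x) \<le> 1"
    proof (rule AE_I2)
      fix x assume "x \<in> space M"
      then show "norm (u w x * u v x) \<le> 1"
        using u01[OF that(1), of x] u01[OF that(2), of x] by (auto simp: abs_mult intro!: mult_le_one)
    qed
  qed auto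
  define \<Phi> where "\<Phi> w = (\<integral>x. u w x * u w x \<partial>M)" for w
  define d where "d w v = (\<integral>x. (u w x - u v x)\<^sup>2 \<partial>M)" for w v
  have "\<exists>C. (\<forall>i. C i \<in> wts i) \<and> (\<forall>i j. i \<le> j \<longrightarrow> d (C i) (C j) \<le> (1/4)^i)"
  proof (rule forward_minimizers[where \<Phi> = \<Phi> and c = 1])
    show "0 \<le> \<Phi> w" for w by (simp add: \<Phi>_def)
    show "\<Phi> w \<le> 1" if "w \<in> wts 0" for w
    proof -
      have "u w x * u w x \<le> 1" if "x \<in> space M" for x
        using u01[OF \<open>w \<in> wts 0\<close> that] by (auto intro!: mult_le_one)
      then have "\<Phi> w \<le> (\<integral>x. 1 \<partial>M)"
        unfolding \<Phi>_def by (intro integral_mono iu that) auto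
      then show ?thesis by (simp add: prob_space)
    qed
    show "d w v \<le> \<Phi> w + \<Phi> v - 2 * \<Phi> (\<lambda>k. (w k + v k) / 2)" if w: "w \<in> wts 0" and v: "v \<in> wts 0" for w v
    proof -
      have "\<Phi> (\<lambda>k. (w k + v k) / 2) = (\<integral>x. u w x * u v x \<partial>M)"
        unfolding \<Phi>_def u_def comb_mid[OF w v]
        by (intro Bochner_Integration.integral_cong refl) (simp flip: exp_add add: field_simps)
      moreover have "d w v = (\<integral>x. u w x * u w x + u v x * u v x - 2 * (u w x * u v x) \<partial>M)"
        unfolding d_def by (intro Bochner_Integration.integral_cong refl) (simp add: power2_eq_square algebra_simps)
      ultimately show ?thesis
        unfolding \<Phi>_def using iu[OF w w] iu[OF v v] iu[OF w v] by simp
    qed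
    show "decseq (\<lambda>i. (1/4)^i :: real)" by (auto simp: decseq_def intro!: power_decreasing)
  qed auto
  then obtain C where C: "\<And>i. C i \<in> wts i" "\<And>i j. i \<le> j \<Longrightarrow> d (C i) (C j) \<le> (1/4)^i" by blast
  have C0: "C i \<in> wts 0" for i using C(1) wts_antimono[of 0 i] by auto
  have iu1: "integrable M (u (C i))" for i
  proof (rule integrable_const_bound[of _ 1])
    show "AE x in M. norm (u (C i) x) \<le> 1"
      by (rule AE_I2) (use u01[OF C0] in \<open>force simp: less_imp_le\<close>)
  qed auto
  have "AE x in M. convergent (\<lambda>i. u (C i) x)"
  proof (rule AE_convergent_of_integral[OF iu1], rule L1_le_L2(2))
    fix i
    show "integrable M (\<lambda>x. (u (C (Suc i)) x - u (C i) x)\<^sup>2)"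
      by (rule integrable_square_diff) (use iu[OF C0 C0] in \<open>auto simp: power2_eq_square\<close>)
    have "(\<integral>x. (u (C (Suc i)) x - u (C i) x)\<^sup>2 \<partial>M) = d (C i) (C (Suc i))"
      unfolding d_def by (simp add: power2_commute)
    also have "\<dots> \<le> (1/4)^i" by (rule C(2)) simp
    also have "\<dots> = ((1/2)^i)\<^sup>2" by (simp add: power2_eq_square flip: power_mult_distrib)
    finally show "(\<integral>x. (u (C (Suc i)) x - u (C i) x)\<^sup>2 \<partial>M) \<le> ((1/2)^i)\<^sup>2" .
  qed auto
  \<comment> \<open>Convergence of \<open>u\<close> alone would allow the combinations to tend to
    infinity; boundedness in probability excludes this.\<close>
  moreover have "AE x in M. \<not> (\<lambda>i. u (C i) x) \<longlonglongrightarrow> 0"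
  proof -
    define Z where "Z = {x \<in> space M. (\<lambda>i. u (C i) x) \<longlonglongrightarrow> 0}"
    have Z [measurable]: "Z \<in> sets M" unfolding Z_def by measurable
    have Ze: "prob Z \<le> \<epsilon>" if eps: "0 < \<epsilon>" for \<epsilon>
    proof -
      obtain \<delta> where \<delta>: "\<And>w. w \<in> wts 0 \<Longrightarrow> prob {x \<in> space M. \<delta> \<le> comb w (\<lambda>n. f n x)} \<le> \<epsilon>"
        using bdd[OF eps] by blast
      define B where "B i = {x \<in> space M. \<delta> \<le> comb (C i) (\<lambda>n. f n x)}" for i
      \<comment> \<open>On \<open>A N\<close> all combinations from \<open>N\<close> on are at least
        \<open>\<delta>\<close>. Escape to infinity forces one of these events, and each is no more
        likely than \<open>B N\<close>.\<close>
      define A where "A N = (\<Inter>i\<in>{N..}. B i)" for N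
      have B [measurable]: "B i \<in> sets M" for i unfolding B_def by measurable
      have A [measurable]: "A N \<in> sets M" for N unfolding A_def by (intro sets.countable_INT') auto
      have "incseq A" unfolding A_def incseq_def by auto
      then have "(\<lambda>N. prob (A N)) \<longlonglongrightarrow> prob (\<Union>N. A N)"
        by (intro finite_Lim_measure_incseq) auto
      moreover have "prob (A N) \<le> \<epsilon>" for N
      proof -
        have "prob (A N) \<le> prob (B N)" by (rule finite_measure_mono) (auto simp: A_def)
        then show ?thesis using \<delta>[OF C0[of N]] unfolding B_def by linarith
      qed
      ultimately have "prob (\<Union>N. A N) \<le> \<epsilon>" by (intro LIMSEQ_le_const2) auto
      moreover have "Z \<subseteq> (\<Union>N. A N)"
      proof
        fix x assume x: "x \<in> Z"
        then have "eventually (\<lambda>i. u (C i) x < exp (- \<delta> / 2)) sequentially"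
          unfolding Z_def by (intro order_tendstoD(2)[of _ 0]) auto
        then have "eventually (\<lambda>i. x \<in> B i) sequentially"
          by eventually_elim (use x in \<open>auto simp: u_def B_def Z_def\<close>)
        then show "x \<in> (\<Union>N. A N)" by (auto simp: A_def eventually_sequentially)
      qed
      then have "prob Z \<le> prob (\<Union>N. A N)" by (intro finite_measure_mono) auto
      ultimately show ?thesis by linarith
    qed
    have "prob Z \<le> 0" by (rule field_le_epsilon) (use Ze in simp)
    then have "Z \<in> null_sets M" by (simp add: measure_le_0_iff emeasure_eq_measure null_sets_def)
    then show ?thesis by (rule AE_I') (auto simp: Z_def)
  qed
  ultimately have "AE x in M. convergent (\<lambda>i. comb (C i) (\<lambda>n. f n x))"
  proof (eventually_elim)
    case (elim x)
    then obtain l where l: "(\<lambda>i. u (C i) x) \<longlonglongrightarrow> l" "l \<noteq> 0" by (auto simp: convergent_def)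
    from tendsto_ln[OF this] have "(\<lambda>i. - comb (C i) (\<lambda>n. f n x) / 2) \<longlonglongrightarrow> ln l"
      by (simp add: u_def)
    from tendsto_mult_left[OF this, of "-2"] show ?case by (auto simp: convergent_def)
  qed
  then show ?thesis using C(1) by blast
qed

lemma L0_bound_of_integral:
  fixes f :: "nat \<Rightarrow> 'a \<Rightarrow> real"
  assumes int: "\<And>n. integrable M (f n)" and nn: "\<And>n x. x \<in> space M \<Longrightarrow> 0 \<le> f n x"
    and le: "\<And>n. (\<integral>x. f n x \<partial>M) \<le> c" and "0 < \<epsilon>"
  shows "\<exists>\<delta>. \<forall>w\<in>wts 0. prob {x \<in> space M. \<delta> \<le> comb w (\<lambda>n. f n x)} \<le> \<epsilon>"
proof (intro exI ballI)
  \<comment> \<open>Threshold for Markov's inequality; the added 1 keeps it positive when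
    \<open>c\<close> is zero.\<close>
  let ?\<delta> = "(\<bar>c\<bar> + 1) / \<epsilon>"
  fix w assume w: "w \<in> wts 0"
  have d: "0 < ?\<delta>" using assms(4) by simp
  have "prob {x \<in> space M. ?\<delta> \<le> comb w (\<lambda>n. f n x)} \<le> (\<integral>x. comb w (\<lambda>n. f n x) \<partial>M) / ?\<delta>"
    by (rule integral_Markov_inequality_measure[where A = "{}"])
       (use comb_integrable(1)[OF int] comb_ge[OF w] nn d in auto)
  also have "\<dots> \<le> (\<bar>c\<bar> + 1) / ?\<delta>"
  proof (rule divide_right_mono)
    have "comb w (\<lambda>n. \<integral>x. f n x \<partial>M) \<le> c" by (rule comb_le[OF w le])
    then show "(\<integral>x. comb w (\<lambda>n. f n x) \<partial>M) \<le> \<bar>c\<bar> + 1" unfolding comb_integrable(2)[OF int] by simp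
  qed (use d in auto)
  also have "\<dots> = \<epsilon>" using assms(4) by (simp add: field_simps)
  finally show "prob {x \<in> space M. ?\<delta> \<le> comb w (\<lambda>n. f n x)} \<le> \<epsilon>" .
qed

end


section \<open>Drift decompositions of bounded quasimartingales\<close>

lemma (in sigma_finite_subalgebra) real_cond_exp_abs_le:
  assumes f: "integrable M f"
  shows "AE x in M. \<bar>real_cond_exp M F f x\<bar> \<le> real_cond_exp M F (\<lambda>x. \<bar>f x\<bar>) x"
proof -
  have "AE x in M. real_cond_exp M F f x \<le> real_cond_exp M F (\<lambda>x. \<bar>f x\<bar>) x"
    "AE x in M. real_cond_exp M F (\<lambda>x. (-1) * f x) x \<le> real_cond_exp M F (\<lambda>x. \<bar>f x\<bar>) x"
    by (rule real_cond_exp_mono; use f in auto)+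
  moreover have "AE x in M. real_cond_exp M F (\<lambda>x. (-1) * f x) x = (-1) * real_cond_exp M F f x"
    by (rule real_cond_exp_cmult[OF f])
  ultimately show ?thesis by eventually_elim auto
qed

lemma (in sigma_finite_subalgebra) real_cond_exp_L1_contraction:
  assumes f: "integrable M f"
  shows "(\<integral>x. \<bar>real_cond_exp M F f x\<bar> \<partial>M) \<le> (\<integral>x. \<bar>f x\<bar> \<partial>M)"
proof -
  have "(\<integral>x. \<bar>real_cond_exp M F f x\<bar> \<partial>M) \<le> (\<integral>x. real_cond_exp M F (\<lambda>x. \<bar>f x\<bar>) x \<partial>M)"
    by (rule integral_mono_AE) (use f real_cond_exp_abs_le[OF f] in auto)
  also have "\<dots> = (\<integral>x. \<bar>f x\<bar> \<partial>M)" by (rule real_cond_exp_int(2)) (use f in auto)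
  finally show ?thesis .
qed

lemma (in sigma_finite_subalgebra) real_cond_exp_L1_dist:
  assumes f: "integrable M f" "integrable M g"
  shows "(\<integral>x. \<bar>real_cond_exp M F f x - real_cond_exp M F g x\<bar> \<partial>M) \<le> (\<integral>x. \<bar>f x - g x\<bar> \<partial>M)"
proof -
  have "(\<integral>x. \<bar>real_cond_exp M F f x - real_cond_exp M F g x\<bar> \<partial>M) = (\<integral>x. \<bar>real_cond_exp M F (\<lambda>x. f x - g x) x\<bar> \<partial>M)"
    by (rule integral_cong_AE) (use real_cond_exp_diff[OF f] in auto)
  also have "\<dots> \<le> (\<integral>x. \<bar>f x - g x\<bar> \<partial>M)" by (rule real_cond_exp_L1_contraction) (use f in auto)
  finally show ?thesis .
qed

lemma (in sigma_finite_subalgebra) real_cond_exp_comb: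
  fixes f :: "nat \<Rightarrow> 'a \<Rightarrow> real"
  assumes "\<And>n. integrable M (f n)"
  shows "AE x in M. real_cond_exp M F (\<lambda>x. comb w (\<lambda>n. f n x)) x = comb w (\<lambda>n. real_cond_exp M F (f n) x)"
proof (cases "finite {n. w n \<noteq> 0}")
  case True
  have "AE x in M. real_cond_exp M F (\<lambda>x. \<Sum>n | w n \<noteq> 0. w n * f n x) x =
      (\<Sum>n | w n \<noteq> 0. real_cond_exp M F (\<lambda>x. w n * f n x) x)"
    by (rule real_cond_exp_sum) (use assms in auto)
  moreover have "AE x in M. \<forall>n\<in>{n. w n \<noteq> 0}. real_cond_exp M F (\<lambda>x. w n * f n x) x = w n * real_cond_exp M F (f n) x"
    using True assms by (intro AE_finite_allI real_cond_exp_cmult) auto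
  ultimately show ?thesis
    by eventually_elim (simp add: comb_def)
next
  case False
  have "AE x in M. real_cond_exp M F (\<lambda>x. 0) x = 0"
    by (rule real_cond_exp_F_meas) auto
  then show ?thesis by (simp add: comb_def False)
qed

context prob_space
begin

lemma cond_exp_subalgebra: "subalgebra M G \<Longrightarrow> sigma_finite_subalgebra M G"
  by (intro finite_measure_subalgebra_is_sigma_finite) (simp add: finite_measure_subalgebra_def
      finite_measure_subalgebra_axioms_def finite_measure_axioms)

text \<open>Boundedness almost everywhere is the form that survives conditional expectation. The
  class is also stable under sums, differences and products, so every second moment in the drift
  estimate is finite.\<close>

definition ae_bounded :: "('a \<Rightarrow> real) \<Rightarrow> bool" where
  "ae_bounded f \<longleftrightarrow> f \<in> borel_measurable M \<and> (\<exists>c. AE x in M. \<bar>f x\<bar> \<le> c)"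

lemma ae_boundedI: "f \<in> borel_measurable M \<Longrightarrow> (AE x in M. \<bar>f x\<bar> \<le> c) \<Longrightarrow> ae_bounded f"
  by (auto simp: ae_bounded_def)

lemma ae_bounded_integrable: "ae_bounded f \<Longrightarrow> integrable M f"
  by (auto simp: ae_bounded_def intro!: integrable_const_bound)

lemma ae_bounded_mult:
  assumes "ae_bounded f" "ae_bounded g"
  shows "ae_bounded (\<lambda>x. f x * g x)"
proof -
  obtain a b where ab: "AE x in M. \<bar>f x\<bar> \<le> a" "AE x in M. \<bar>g x\<bar> \<le> b"
    using assms by (auto simp: ae_bounded_def)
  show ?thesis
  proof (rule ae_boundedI[of _ "a * b"])
    show "AE x in M. \<bar>f x * g x\<bar> \<le> a * b"
      using ab by eventually_elim (auto simp: abs_mult intro!: mult_mono)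
  qed (use assms in \<open>auto simp: ae_bounded_def\<close>)
qed

lemma ae_bounded_diff:
  assumes "ae_bounded f" "ae_bounded g"
  shows "ae_bounded (\<lambda>x. f x - g x)"
proof -
  obtain a b where ab: "AE x in M. \<bar>f x\<bar> \<le> a" "AE x in M. \<bar>g x\<bar> \<le> b"
    using assms by (auto simp: ae_bounded_def)
  show ?thesis
  proof (rule ae_boundedI[of _ "a + b"])
    show "AE x in M. \<bar>f x - g x\<bar> \<le> a + b"
      using ab by eventually_elim auto
  qed (use assms in \<open>auto simp: ae_bounded_def\<close>)
qed

lemma ae_bounded_sum:
  assumes "finite I" "\<And>i. i \<in> I \<Longrightarrow> ae_bounded (f i)"
  shows "ae_bounded (\<lambda>x. \<Sum>i\<in>I. f i x)"
  using assms
proof (induction I rule: finite_induct)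
  case empty
  show ?case by (rule ae_boundedI[of _ 0]) auto
next
  case (insert i I)
  have "ae_bounded (\<lambda>x. 0 - f i x)"
    by (rule ae_bounded_diff) (use insert in \<open>auto intro: ae_boundedI[of _ 0]\<close>)
  from ae_bounded_diff[OF insert.IH this] insert show ?case by (simp add: add.commute)
qed

lemma ae_bounded_cond_exp:
  assumes f: "ae_bounded f" and "subalgebra M G"
  shows "ae_bounded (real_cond_exp M G f)"
proof -
  interpret G: sigma_finite_subalgebra M G by (rule cond_exp_subalgebra[OF assms(2)])
  obtain c where c: "AE x in M. \<bar>f x\<bar> \<le> c" using f by (auto simp: ae_bounded_def)
  have "AE x in M. real_cond_exp M G f x \<le> c"
    by (rule G.real_cond_exp_le_c[OF ae_bounded_integrable[OF f]]) (use c in auto)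
  moreover have "AE x in M. real_cond_exp M G f x \<ge> - c"
    by (rule G.real_cond_exp_ge_c[OF ae_bounded_integrable[OF f]]) (use c in auto)
  ultimately show ?thesis by (intro ae_boundedI[of _ c]) (auto elim: eventually_elim2)
qed

end

section \<open>Discrete time: maximal inequality and Doob decomposition\<close>

locale discrete_filtration = prob_space M for M :: "'a measure" +
  fixes G :: "nat \<Rightarrow> 'a measure"
  assumes sub: "\<And>k. subalgebra M (G k)" and mono: "\<And>k. subalgebra (G (Suc k)) (G k)"
begin

sublocale G: sigma_finite_subalgebra M "G k" for k
  by (rule cond_exp_subalgebra[OF sub])

lemma mono_le: "k \<le> l \<Longrightarrow> subalgebra (G l) (G k)"
proof (induction l rule: dec_induct)
  case (step n)
  then show ?case using mono[of n] by (auto simp: subalgebra_def)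
qed (simp add: subalgebra_def)

lemma measurable_mono: "f \<in> borel_measurable (G k) \<Longrightarrow> k \<le> l \<Longrightarrow> f \<in> borel_measurable (G l)"
  using measurable_from_subalg[OF mono_le] by blast

lemma measurable_M: "f \<in> borel_measurable (G k) \<Longrightarrow> f \<in> borel_measurable M"
  by (rule measurable_from_subalg[OF sub])

text \<open>Doob's weak-type inequality for a closed martingale. The event is split by the first
  index beyond \<open>a\<close>; as \<open>S k\<close> lies in \<open>G k\<close>, the conditional
  expectation of \<open>\<bar>Y\<bar>\<close> may be replaced by \<open>\<bar>Y\<bar>\<close> on
  it.\<close>

lemma maximal_inequality:
  fixes Y :: "'a \<Rightarrow> real"
  assumes Y: "integrable M Y" and a: "0 < a"
  shows "prob {x \<in> space M. \<exists>k<n. a < \<bar>real_cond_exp M (G k) Y x\<bar>} \<le> (\<integral>x. \<bar>Y x\<bar> \<partial>M) / a"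
proof -
  define S where "S k = {x \<in> space M. (\<forall>i<k. \<bar>real_cond_exp M (G i) Y x\<bar> \<le> a) \<and> a < \<bar>real_cond_exp M (G k) Y x\<bar>}" for k
  have meas: "real_cond_exp M (G i) Y \<in> borel_measurable (G k)" if "i \<le> k" for i k
    by (rule measurable_mono[OF borel_measurable_cond_exp that])
  have sp: "space (G k) = space M" for k using sub[of k] by (simp add: subalgebra_def)
  have SG: "S k \<in> sets (G k)" for k
  proof -
    have [measurable]: "real_cond_exp M (G i) Y \<in> borel_measurable (G k)" if "i \<in> {..k}" for i
      using meas that by auto
    have "{x \<in> space (G k). (\<forall>i\<in>{..<k}. \<bar>real_cond_exp M (G i) Y x\<bar> \<le> a) \<and> a < \<bar>real_cond_exp M (G k) Y x\<bar>} \<in> sets (G k)"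
      by measurable
    moreover have "S k = {x \<in> space (G k). (\<forall>i\<in>{..<k}. \<bar>real_cond_exp M (G i) Y x\<bar> \<le> a) \<and> a < \<bar>real_cond_exp M (G k) Y x\<bar>}"
      by (auto simp: S_def sp)
    ultimately show ?thesis by simp
  qed
  have SM [measurable]: "S k \<in> sets M" for k using SG sub[of k] by (auto simp: subalgebra_def)
  have disj: "disjoint_family_on S {..<n}"
    unfolding disjoint_family_on_def
  proof (intro ballI impI)
    fix i j :: nat assume "i \<noteq> j"
    then consider "i < j" | "j < i" by linarith
    then show "S i \<inter> S j = {}" by cases (fastforce simp: S_def)+
  qed
  have un: "{x \<in> space M. \<exists>k<n. a < \<bar>real_cond_exp M (G k) Y x\<bar>} = (\<Union>k<n. S k)"
  proof (intro equalityI subsetI)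
    fix x assume x: "x \<in> {x \<in> space M. \<exists>k<n. a < \<bar>real_cond_exp M (G k) Y x\<bar>}"
    define k where "k = (LEAST k. a < \<bar>real_cond_exp M (G k) Y x\<bar>)"
    from x obtain j where j: "j < n" "a < \<bar>real_cond_exp M (G j) Y x\<bar>" "x \<in> space M" by auto
    have "a < \<bar>real_cond_exp M (G k) Y x\<bar>" unfolding k_def using LeastI[of "\<lambda>k. a < \<bar>real_cond_exp M (G k) Y x\<bar>" j] j(2) by simp
    moreover have "k < n" using Least_le[of "\<lambda>k. a < \<bar>real_cond_exp M (G k) Y x\<bar>" j] j by (simp add: k_def)
    moreover have "\<bar>real_cond_exp M (G i) Y x\<bar> \<le> a" if "i < k" for i
      using not_less_Least[of i "\<lambda>k. a < \<bar>real_cond_exp M (G k) Y x\<bar>"] that by (simp add: k_def not_less)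
    ultimately show "x \<in> (\<Union>k<n. S k)" using j(3) by (auto simp: S_def)
  qed (auto simp: S_def)
  have step: "a * prob (S k) \<le> (\<integral>x\<in>S k. \<bar>Y x\<bar> \<partial>M)" for k
  proof -
    have i1: "integrable M (\<lambda>x. indicator (S k) x *\<^sub>R real_cond_exp M (G k) (\<lambda>x. \<bar>Y x\<bar>) x)"
      by (intro integrable_mult_indicator) (use Y in auto)
    have i0: "integrable M (\<lambda>x. a * indicator (S k) x)"
      by (intro integrable_mult_right integrable_real_indicator) (auto simp: emeasure_eq_measure)
    have "a * prob (S k) = (\<integral>x. a * indicator (S k) x \<partial>M)" by simp
    also have "\<dots> \<le> (\<integral>x\<in>S k. real_cond_exp M (G k) (\<lambda>x. \<bar>Y x\<bar>) x \<partial>M)"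
      unfolding set_lebesgue_integral_def
    proof (rule integral_mono_AE)
      show "AE x in M. a * indicator (S k) x \<le> indicator (S k) x *\<^sub>R real_cond_exp M (G k) (\<lambda>x. \<bar>Y x\<bar>) x"
        using G.real_cond_exp_abs_le[OF Y, of k]
        by eventually_elim (auto simp: indicator_def S_def)
    qed (use i1 i0 in auto)
    also have "\<dots> = (\<integral>x\<in>S k. \<bar>Y x\<bar> \<partial>M)"
      by (rule G.real_cond_exp_intA[symmetric]) (use Y SG in auto)
    finally show ?thesis .
  qed
  have "a * prob (\<Union>k<n. S k) = (\<Sum>k<n. a * prob (S k))"
    by (subst finite_measure_finite_Union) (use disj in \<open>auto simp: sum_distrib_left\<close>)
  also have "\<dots> \<le> (\<Sum>k<n. \<integral>x\<in>S k. \<bar>Y x\<bar> \<partial>M)" by (intro sum_mono step)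
  also have "\<dots> = (\<integral>x. (\<Sum>k<n. indicator (S k) x *\<^sub>R \<bar>Y x\<bar>) \<partial>M)"
    unfolding set_lebesgue_integral_def
    by (rule Bochner_Integration.integral_sum[symmetric]) (use Y in \<open>auto intro!: integrable_real_mult_indicator simp: mult.commute\<close>)
  also have "\<dots> \<le> (\<integral>x. \<bar>Y x\<bar> \<partial>M)"
  proof (rule integral_mono)
    show "integrable M (\<lambda>x. \<Sum>k<n. indicator (S k) x *\<^sub>R \<bar>Y x\<bar>)"
      by (intro Bochner_Integration.integrable_sum integrable_mult_indicator) (use Y in auto)
    fix x assume "x \<in> space M"
    have "(\<Sum>k<n. indicator (S k) x *\<^sub>R \<bar>Y x\<bar>) = indicator (\<Union>k<n. S k) x * \<bar>Y x\<bar>"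
      unfolding indicator_UN_disjoint[OF finite_lessThan disj] by (simp add: sum_distrib_right)
    also have "\<dots> \<le> \<bar>Y x\<bar>" by (auto simp: indicator_def)
    finally show "(\<Sum>k<n. indicator (S k) x *\<^sub>R \<bar>Y x\<bar>) \<le> \<bar>Y x\<bar>" .
  qed (use Y in auto)
  finally show ?thesis unfolding un using a by (simp add: field_simps)
qed

text \<open>Doob decomposition of \<open>y\<close> with compensator increments
  \<open>\<delta>\<close>. Removing the compensator only lowers the second moment of an increment,
  so the martingale part is compared with the squared increments of \<open>y\<close>, which
  telescope up to the cross terms \<open>2 * y k * \<delta> k\<close>. Since \<open>y\<close> is
  bounded by \<open>L\<close>, these cost only the first moment of the drift.\<close>

lemma drift_decomposition:
  fixes y :: "nat \<Rightarrow> 'a \<Rightarrow> real"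
  assumes ym: "\<And>k. y k \<in> borel_measurable (G k)" and yL: "\<And>k x. x \<in> space M \<Longrightarrow> \<bar>y k x\<bar> \<le> L"
  defines "\<delta> \<equiv> \<lambda>k. real_cond_exp M (G k) (\<lambda>x. y (Suc k) x - y k x)"
  defines "U \<equiv> \<lambda>k x. y k x - (\<Sum>i<k. \<delta> i x)"
  shows "U p \<in> borel_measurable M" "integrable M (\<lambda>x. (U p x)\<^sup>2)"
    and "(\<integral>x. (U p x)\<^sup>2 \<partial>M) \<le> L\<^sup>2 + 2 * L * (\<Sum>k<p. \<integral>x. \<bar>\<delta> k x\<bar> \<partial>M)"
    and "k \<le> p \<Longrightarrow> AE x in M. real_cond_exp M (G k) (U p) x = U k x"
proof -
  have yM [measurable]: "y k \<in> borel_measurable M" for k by (rule measurable_M[OF ym])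
  have by_: "ae_bounded (y k)" for k using yL by (intro ae_boundedI[of _ L]) auto
  define e where "e k x = y (Suc k) x - y k x" for k x
  have be: "ae_bounded (e k)" for k unfolding e_def by (rule ae_bounded_diff[OF by_ by_])
  have \<delta>: "\<delta> k = real_cond_exp M (G k) (e k)" for k by (simp add: \<delta>_def e_def[abs_def])
  have b\<delta>: "ae_bounded (\<delta> k)" for k unfolding \<delta> by (rule ae_bounded_cond_exp[OF be sub])
  have bU: "ae_bounded (U k)" for k
    unfolding U_def by (intro ae_bounded_diff by_ ae_bounded_sum b\<delta>) auto
  have \<delta>G: "\<delta> k \<in> borel_measurable (G k)" for k unfolding \<delta> by simp
  have UG: "U k \<in> borel_measurable (G k)" for k
    unfolding U_def by (intro borel_measurable_diff ym borel_measurable_sum measurable_mono[OF \<delta>G]) auto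
  have USuc: "U (Suc k) x = U k x + (e k x - \<delta> k x)" for k x by (simp add: U_def e_def)
  note int = ae_bounded_integrable
  show "U p \<in> borel_measurable M" by (rule measurable_M[OF UG])
  show "integrable M (\<lambda>x. (U p x)\<^sup>2)"
    unfolding power2_eq_square by (rule int[OF ae_bounded_mult[OF bU bU]])
  \<comment> \<open>\<open>e k\<close> and \<open>\<delta> k\<close> have the same integral against
    anything bounded and known at time \<open>k\<close>; below this is applied to
    \<open>U k\<close>, \<open>\<delta> k\<close> and \<open>y k\<close>.\<close>
  have ortho: "(\<integral>x. f x * e k x \<partial>M) = (\<integral>x. f x * \<delta> k x \<partial>M)" if "ae_bounded f" "f \<in> borel_measurable (G k)" for f k
    unfolding \<delta> by (rule G.real_cond_exp_intg(2)[symmetric, OF int[OF ae_bounded_mult[OF that(1) be]] that(2)])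
      (use be in \<open>auto simp: ae_bounded_def\<close>)
  \<comment> \<open>The second moment of \<open>y p\<close> is kept on the right so that the
    induction telescopes; it is estimated by \<open>L\<^sup>2\<close> only afterwards.\<close>
  have "(\<integral>x. (U p x)\<^sup>2 \<partial>M) \<le> (\<integral>x. (y p x)\<^sup>2 \<partial>M) + 2 * L * (\<Sum>k<p. \<integral>x. \<bar>\<delta> k x\<bar> \<partial>M)"
  proof (induction p)
    case 0 then show ?case by (simp add: U_def)
  next
    case (Suc k)
    have bb [simp]: "integrable M (\<lambda>x. U k x * U k x)" "integrable M (\<lambda>x. U k x * e k x)" "integrable M (\<lambda>x. U k x * \<delta> k x)"
      "integrable M (\<lambda>x. e k x * e k x)" "integrable M (\<lambda>x. \<delta> k x * e k x)" "integrable M (\<lambda>x. \<delta> k x * \<delta> k x)"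
      "integrable M (\<lambda>x. y k x * e k x)" "integrable M (\<lambda>x. y k x * y k x)" "integrable M (\<lambda>x. y (Suc k) x * y (Suc k) x)"
      "integrable M (\<lambda>x. y k x * \<delta> k x)" "integrable M (\<delta> k)"
      by (intro int ae_bounded_mult bU be b\<delta> by_)+
    have 1: "(\<integral>x. (U (Suc k) x)\<^sup>2 \<partial>M) = (\<integral>x. U k x * U k x \<partial>M) + 2 * ((\<integral>x. U k x * e k x \<partial>M) - (\<integral>x. U k x * \<delta> k x \<partial>M))
        + ((\<integral>x. e k x * e k x \<partial>M) - 2 * (\<integral>x. \<delta> k x * e k x \<partial>M) + (\<integral>x. \<delta> k x * \<delta> k x \<partial>M))"
    proof -
      have "(\<integral>x. (U (Suc k) x)\<^sup>2 \<partial>M) = (\<integral>x. U k x * U k x + 2 * (U k x * e k x - U k x * \<delta> k x)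
        + (e k x * e k x - 2 * (\<delta> k x * e k x) + \<delta> k x * \<delta> k x) \<partial>M)"
        unfolding USuc by (intro Bochner_Integration.integral_cong refl) (simp add: power2_eq_square algebra_simps)
      then show ?thesis by simp
    qed
    have 2: "(\<integral>x. (y (Suc k) x)\<^sup>2 \<partial>M) = (\<integral>x. y k x * y k x \<partial>M) + 2 * (\<integral>x. y k x * e k x \<partial>M) + (\<integral>x. e k x * e k x \<partial>M)"
    proof -
      have "(\<integral>x. (y (Suc k) x)\<^sup>2 \<partial>M) = (\<integral>x. y k x * y k x + 2 * (y k x * e k x) + e k x * e k x \<partial>M)"
        by (intro Bochner_Integration.integral_cong refl) (simp add: e_def power2_eq_square algebra_simps)
      then show ?thesis by simp
    qed
    have 3: "- (\<integral>x. y k x * \<delta> k x \<partial>M) \<le> L * (\<integral>x. \<bar>\<delta> k x\<bar> \<partial>M)"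
    proof -
      have "- (\<integral>x. y k x * \<delta> k x \<partial>M) = (\<integral>x. - (y k x * \<delta> k x) \<partial>M)" by simp
      also have "\<dots> \<le> (\<integral>x. L * \<bar>\<delta> k x\<bar> \<partial>M)"
      proof (rule integral_mono)
        fix x assume x: "x \<in> space M"
        have "- (y k x * \<delta> k x) \<le> \<bar>y k x\<bar> * \<bar>\<delta> k x\<bar>" by (metis abs_ge_minus_self abs_mult)
        also have "\<dots> \<le> L * \<bar>\<delta> k x\<bar>" using yL[OF x] by (intro mult_right_mono) auto
        finally show "- (y k x * \<delta> k x) \<le> L * \<bar>\<delta> k x\<bar>" .
      qed auto
      finally show ?thesis by simp
    qed
    then have 4: "- 2 * (\<integral>x. y k x * \<delta> k x \<partial>M) \<le> 2 * L * (\<integral>x. \<bar>\<delta> k x\<bar> \<partial>M)" by simp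
    \<comment> \<open>Arithmetic of the step after \<open>ortho\<close>: the mixed terms with
      \<open>U k\<close> cancel, and \<open>d\<close> stands for the second moment of
      \<open>\<delta> k\<close>.\<close>
    have aux: "0 \<le> d \<Longrightarrow> a + 2 * (b - b) + (c - 2 * d + d) \<le> a + c" for a b c d :: real by simp
    have "0 \<le> (\<integral>x. \<delta> k x * \<delta> k x \<partial>M)" by (rule Bochner_Integration.integral_nonneg) simp
    then have "(\<integral>x. (U (Suc k) x)\<^sup>2 \<partial>M) \<le> (\<integral>x. U k x * U k x \<partial>M) + (\<integral>x. e k x * e k x \<partial>M)"
      unfolding 1 ortho[OF bU UG] ortho[OF b\<delta> \<delta>G] by (rule aux)
    also have "(\<integral>x. U k x * U k x \<partial>M) \<le> (\<integral>x. y k x * y k x \<partial>M) + 2 * L * (\<Sum>k<k. \<integral>x. \<bar>\<delta> k x\<bar> \<partial>M)"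
      using Suc by (simp only: power2_eq_square)
    also have "(\<integral>x. e k x * e k x \<partial>M) \<le> (\<integral>x. (y (Suc k) x)\<^sup>2 \<partial>M) - (\<integral>x. y k x * y k x \<partial>M) + 2 * L * (\<integral>x. \<bar>\<delta> k x\<bar> \<partial>M)"
      using 4 unfolding 2 ortho[OF by_ ym] by linarith
    finally show ?case unfolding sum.lessThan_Suc distrib_left by simp
  qed
  also have "(\<integral>x. (y p x)\<^sup>2 \<partial>M) \<le> L\<^sup>2"
  proof -
    have "(y p x)\<^sup>2 \<le> L\<^sup>2" if "x \<in> space M" for x using power_mono[OF yL[OF that, of p] abs_ge_zero, of 2] by simp
    then have "(\<integral>x. (y p x)\<^sup>2 \<partial>M) \<le> (\<integral>x. L\<^sup>2 \<partial>M)"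
      using int[OF ae_bounded_mult[OF by_ by_]] by (intro integral_mono) (auto simp: power2_eq_square)
    then show ?thesis by (simp add: prob_space)
  qed
  finally show "(\<integral>x. (U p x)\<^sup>2 \<partial>M) \<le> L\<^sup>2 + 2 * L * (\<Sum>k<p. \<integral>x. \<bar>\<delta> k x\<bar> \<partial>M)" by simp
  show "AE x in M. real_cond_exp M (G k) (U p) x = U k x" if "k \<le> p"
    using that
  proof (induction p rule: dec_induct)
    case base
    show ?case by (rule G.real_cond_exp_F_meas[OF int[OF bU] UG])
  next
    case (step p)
    have a: "AE x in M. real_cond_exp M (G p) (U (Suc p)) x = U p x"
    proof -
      have "AE x in M. real_cond_exp M (G p) (\<lambda>x. U p x + (e p x - \<delta> p x)) x
          = real_cond_exp M (G p) (U p) x + real_cond_exp M (G p) (\<lambda>x. e p x - \<delta> p x) x"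
        by (rule G.real_cond_exp_add) (use int bU be b\<delta> in auto)
      moreover have "AE x in M. real_cond_exp M (G p) (\<lambda>x. e p x - \<delta> p x) x = \<delta> p x - real_cond_exp M (G p) (\<delta> p) x"
        unfolding \<delta>[of p] by (rule G.real_cond_exp_diff) (use int be in auto)
      moreover have "AE x in M. real_cond_exp M (G p) (\<delta> p) x = \<delta> p x" "AE x in M. real_cond_exp M (G p) (U p) x = U p x"
        by (rule G.real_cond_exp_F_meas; use int bU b\<delta> UG \<delta>G in auto)+
      ultimately show ?thesis unfolding USuc by eventually_elim simp
    qed
    have "AE x in M. real_cond_exp M (G k) (real_cond_exp M (G p) (U (Suc p))) x = real_cond_exp M (G k) (U (Suc p)) x"
      by (rule G.real_cond_exp_nested_subalg[OF sub mono_le[OF step(1)] int[OF bU]])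
    moreover have "AE x in M. real_cond_exp M (G k) (real_cond_exp M (G p) (U (Suc p))) x = real_cond_exp M (G k) (U p) x"
      by (rule G.real_cond_exp_cong[OF a]) (use bU in \<open>auto simp: ae_bounded_def\<close>)
    ultimately show ?case using step.IH by eventually_elim simp
  qed
qed

end

section \<open>Dyadic time grids\<close>

definition dy :: "nat \<Rightarrow> nat \<Rightarrow> real" where "dy m k = real k / 2 ^ m"

definition dyadics :: "nat \<Rightarrow> real set" where "dyadics K = (\<Union>m. dy m ` {..K * 2 ^ m})"

lemma dy_nonneg [simp]: "0 \<le> dy m k" by (simp add: dy_def)

lemma dy_mono: "k \<le> l \<Longrightarrow> dy m k \<le> dy m l" by (simp add: dy_def divide_right_mono)

lemma dy_refine: "dy (j + n) (k * 2 ^ n) = dy j k" by (simp add: dy_def power_add)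

lemma dy_double: "dy (Suc j) (2 * k) = dy j k" by (simp add: dy_def)

lemma countable_dyadics: "countable (dyadics K)" by (simp add: dyadics_def)

lemma dyadicsI: "k \<le> K * 2 ^ m \<Longrightarrow> dy m k \<in> dyadics K" by (auto simp: dyadics_def)

lemma dyadics_range: "t \<in> dyadics K \<Longrightarrow> 0 \<le> t \<and> t \<le> real K"
proof -
  assume "t \<in> dyadics K"
  then obtain m k where t: "t = dy m k" "k \<le> K * 2 ^ m" by (auto simp: dyadics_def)
  have "real k \<le> real (K * 2 ^ m)" using t(2) by (simp only: of_nat_le_iff)
  then show ?thesis by (simp add: t(1) dy_def field_simps)
qed

lemma zero_in_dyadics: "0 \<in> dyadics K" and K_in_dyadics: "real K \<in> dyadics K"
  using dyadicsI[of 0 K 0] dyadicsI[of K K 0] by (auto simp: dy_def)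

lemma dyadics_dense:
  assumes "0 \<le> t" "t < real K" "0 < e"
  shows "\<exists>s\<in>dyadics K. t < s \<and> s < t + e"
proof -
  define d where "d = min e (real K - t)"
  have d: "0 < d" "d \<le> e" "t + d \<le> real K" using assms by (auto simp: d_def)
  obtain m where m: "inverse d < 2 ^ m" using real_arch_pow[of 2] by auto
  have m': "1 < d * 2 ^ m" using m d(1) by (simp add: field_simps)
  \<comment> \<open>First point of grid \<open>m\<close> strictly to the right of \<open>t\<close>;
    the \<open>+ 1\<close> makes it strict even when \<open>t\<close> is itself a grid
    point.\<close>
  define k where "k = nat \<lfloor>t * 2 ^ m\<rfloor> + 1"
  have k: "real k = of_int \<lfloor>t * 2 ^ m\<rfloor> + 1" using assms(1) by (simp add: k_def)
  have "t * 2 ^ m < real k" "real k \<le> t * 2 ^ m + 1" unfolding k by linarith+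
  then have "t < dy m k" "dy m k < t + d"
    using m' by (simp_all add: dy_def field_simps)
  moreover from this d have "dy m k < real K" by linarith
  then have "real k < real (K * 2 ^ m)" by (simp add: dy_def field_simps)
  then have "k \<le> K * 2 ^ m" by linarith
  ultimately show ?thesis using d(2) dyadicsI[of k K m] by (intro bexI[of _ "dy m k"]) auto
qed

lemma sum_double: "(\<Sum>k<2 * n. f k) = (\<Sum>k<n. f (2 * k) + f (Suc (2 * k)) :: real)"
  by (induction n) auto

section \<open>Conditional expectations along a filtration in real time\<close>

locale filtered_prob_space = prob_space M for M :: "'a measure" +
  fixes F :: "real \<Rightarrow> 'a measure"
  assumes subF: "\<And>t. 0 \<le> t \<Longrightarrow> subalgebra M (F t)"
    and monoF: "\<And>s t. 0 \<le> s \<Longrightarrow> s \<le> t \<Longrightarrow> sets (F s) \<subseteq> sets (F t)"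
begin

lemma dyadic_filtration: "discrete_filtration M (\<lambda>k. F (dy m k))"
proof
  show "subalgebra M (F (dy m k))" for k by (rule subF) simp
  show "subalgebra (F (dy m (Suc k))) (F (dy m k))" for k
    using subF[of "dy m k"] subF[of "dy m (Suc k)"] monoF[of "dy m k" "dy m (Suc k)"] dy_mono[of k "Suc k" m]
    by (simp add: subalgebra_def)
qed

abbreviation cexp :: "real \<Rightarrow> ('a \<Rightarrow> real) \<Rightarrow> 'a \<Rightarrow> real" where
  "cexp t \<equiv> real_cond_exp M (F t)"

lemma cexp_subalgebra: "0 \<le> t \<Longrightarrow> sigma_finite_subalgebra M (F t)"
  by (rule cond_exp_subalgebra[OF subF])

text \<open>The discrete bound is the same on every grid, and the grid events increase with
  \<open>m\<close> since level \<open>m\<close> points reappear at level \<open>Suc m\<close>;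
  continuity from below covers all dyadic times.\<close>

lemma cexp_maximal:
  assumes Y: "integrable M Y" and a: "0 < a"
  shows "prob {x \<in> space M. \<exists>t\<in>dyadics K. a < \<bar>cexp t Y x\<bar>} \<le> (\<integral>x. \<bar>Y x\<bar> \<partial>M) / a"
proof -
  define A where "A m = {x \<in> space M. \<exists>k<Suc (K * 2 ^ m). a < \<bar>cexp (dy m k) Y x\<bar>}" for m
  have [measurable]: "A m \<in> sets M" for m unfolding A_def by measurable
  have "A m \<subseteq> A (Suc m)" for m
  proof
    fix x assume "x \<in> A m"
    then obtain k where k: "x \<in> space M" "k < Suc (K * 2 ^ m)" "a < \<bar>cexp (dy m k) Y x\<bar>" by (auto simp: A_def)
    then show "x \<in> A (Suc m)" unfolding A_def by (intro CollectI conjI exI[of _ "2 * k"]) (auto simp: dy_double)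
  qed
  then have "incseq A" by (rule incseq_SucI)
  then have "(\<lambda>m. prob (A m)) \<longlonglongrightarrow> prob (\<Union>m. A m)" by (intro finite_Lim_measure_incseq) auto
  moreover have "prob (A m) \<le> (\<integral>x. \<bar>Y x\<bar> \<partial>M) / a" for m
  proof -
    interpret discrete_filtration M "\<lambda>k. F (dy m k)" by (rule dyadic_filtration)
    show ?thesis unfolding A_def by (rule maximal_inequality[OF Y a])
  qed
  ultimately have "prob (\<Union>m. A m) \<le> (\<integral>x. \<bar>Y x\<bar> \<partial>M) / a" by (intro LIMSEQ_le_const2) auto
  also have "(\<Union>m. A m) = {x \<in> space M. \<exists>t\<in>dyadics K. a < \<bar>cexp t Y x\<bar>}"
    by (auto simp: A_def dyadics_def less_Suc_eq_le)
  finally show ?thesis .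
qed

text \<open>Borel-Cantelli: with mean error \<open>(1/4)^i\<close>, the maximal inequality bounds
  the probability of an error above \<open>(1/2)^i\<close> somewhere on the dyadics by
  \<open>(1/2)^i\<close>, which is summable.\<close>

lemma cexp_comb_uniform:
  fixes f :: "nat \<Rightarrow> 'a \<Rightarrow> real"
  assumes f: "\<And>n. integrable M (f n)" and g: "integrable M g"
    and le: "\<And>i. (\<integral>x. \<bar>comb (C i) (\<lambda>n. f n x) - g x\<bar> \<partial>M) \<le> (1/4)^i"
  shows "AE x in M. \<forall>e>0. \<exists>i0. \<forall>i\<ge>i0. \<forall>t\<in>dyadics K. \<bar>comb (C i) (\<lambda>n. cexp t (f n) x) - cexp t g x\<bar> \<le> e"
proof -
  let ?h = "\<lambda>i x. comb (C i) (\<lambda>n. f n x)"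
  have h: "integrable M (?h i)" for i by (rule comb_integrable[OF f])
  define A where "A i = {x \<in> space M. \<exists>t\<in>dyadics K. (1/2)^i < \<bar>cexp t (\<lambda>x. ?h i x - g x) x\<bar>}" for i
  have A [measurable]: "A i \<in> sets M" for i
    unfolding A_def using countable_dyadics by measurable
  have "prob (A i) \<le> (1/2)^i" for i
  proof -
    have "prob (A i) \<le> (\<integral>x. \<bar>?h i x - g x\<bar> \<partial>M) / (1/2)^i"
      unfolding A_def by (rule cexp_maximal) (use h g in auto)
    also have "\<dots> \<le> (1/4)^i / (1/2)^i" by (rule divide_right_mono[OF le]) simp
    also have "\<dots> = (1/2)^i" by (simp flip: power_divide)
    finally show ?thesis .
  qed
  then have "AE x in M. summable (\<lambda>i. \<bar>indicat_real (A i) x\<bar>)"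
    by (intro AE_summable_of_integral integrable_real_indicator) (auto simp: emeasure_eq_measure)
  then have 1: "AE x in M. eventually (\<lambda>i. x \<notin> A i) sequentially"
  proof eventually_elim
    case (elim x)
    then have "(\<lambda>i. \<bar>indicat_real (A i) x\<bar>) \<longlonglongrightarrow> 0" by (rule summable_LIMSEQ_zero)
    then have "eventually (\<lambda>i. \<bar>indicat_real (A i) x\<bar> < 1) sequentially" by (rule order_tendstoD) simp
    then show ?case by eventually_elim (auto simp: indicator_def split: if_splits)
  qed
  \<comment> \<open>Linearity of conditional expectation holds off a null set depending on
    \<open>t\<close> and \<open>i\<close>; both range over countable sets.\<close>
  have 2: "AE x in M. \<forall>t\<in>dyadics K. \<forall>i. cexp t (\<lambda>x. ?h i x - g x) x = comb (C i) (\<lambda>n. cexp t (f n) x) - cexp t g x"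
    unfolding AE_ball_countable[OF countable_dyadics] AE_all_countable
  proof (intro ballI allI)
    fix t i assume "t \<in> dyadics K"
    then interpret t: sigma_finite_subalgebra M "F t" using dyadics_range by (intro cexp_subalgebra) auto
    show "AE x in M. cexp t (\<lambda>x. ?h i x - g x) x = comb (C i) (\<lambda>n. cexp t (f n) x) - cexp t g x"
      using t.real_cond_exp_diff[OF h[of i] g] t.real_cond_exp_comb[OF f, of "C i"] by eventually_elim simp
  qed
  show ?thesis using 1 2 AE_space
  proof eventually_elim
    case (elim x)
    show ?case
    proof (intro allI impI)
      fix e :: real assume "0 < e"
      have "(\<lambda>i. (1/2)^i :: real) \<longlonglongrightarrow> 0" by (rule LIMSEQ_power_zero) simp
      then have "eventually (\<lambda>i. (1/2)^i < e) sequentially" by (rule order_tendstoD) fact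
      with elim(1) have "eventually (\<lambda>i. x \<notin> A i \<and> (1/2)^i < e) sequentially" by eventually_elim auto
      then obtain i0 where i0: "\<And>i. i \<ge> i0 \<Longrightarrow> x \<notin> A i \<and> (1/2)^i < e" by (auto simp: eventually_sequentially)
      have "\<bar>comb (C i) (\<lambda>n. cexp t (f n) x) - cexp t g x\<bar> \<le> e" if i: "i \<ge> i0" and t: "t \<in> dyadics K" for i t
      proof -
        have "\<bar>cexp t (\<lambda>x. ?h i x - g x) x\<bar> \<le> (1/2)^i" using i0[OF i] t elim(3) by (auto simp: A_def not_less)
        then show ?thesis using i0[OF i] elim(2) t by auto
      qed
      then show "\<exists>i0. \<forall>i\<ge>i0. \<forall>t\<in>dyadics K. \<bar>comb (C i) (\<lambda>n. cexp t (f n) x) - cexp t g x\<bar> \<le> e" by blast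
    qed
  qed
qed

section \<open>Mean variation along refining grids\<close>

definition mean_var :: "nat \<Rightarrow> nat \<Rightarrow> (real \<Rightarrow> 'a \<Rightarrow> real) \<Rightarrow> real" where
  "mean_var K m b = (\<Sum>k<K * 2 ^ m. \<integral>x. \<bar>b (dy m (Suc k)) x - b (dy m k) x\<bar> \<partial>M)"

lemma mean_var_mono:
  assumes b: "\<And>t. 0 \<le> t \<Longrightarrow> integrable M (b t)" and "j \<le> m"
  shows "mean_var K j b \<le> mean_var K m b"
  using \<open>j \<le> m\<close>
proof (induction m rule: dec_induct)
  case (step m)
  let ?d = "\<lambda>k. \<integral>x. \<bar>b (dy (Suc m) (Suc k)) x - b (dy (Suc m) k) x\<bar> \<partial>M"
  have "mean_var K m b \<le> (\<Sum>k<K * 2 ^ m. ?d (2 * k) + ?d (Suc (2 * k)))"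
    unfolding mean_var_def
  proof (rule sum_mono)
    fix k
    have "(\<integral>x. \<bar>b (dy m (Suc k)) x - b (dy m k) x\<bar> \<partial>M)
        \<le> (\<integral>x. \<bar>b (dy (Suc m) (Suc (2 * k))) x - b (dy (Suc m) (2 * k)) x\<bar>
             + \<bar>b (dy (Suc m) (Suc (Suc (2 * k)))) x - b (dy (Suc m) (Suc (2 * k))) x\<bar> \<partial>M)"
      unfolding dy_double[of m k, symmetric] dy_double[of m "Suc k", symmetric]
      by (rule integral_mono)
        ((intro integrable_abs Bochner_Integration.integrable_diff Bochner_Integration.integrable_add b dy_nonneg)+, auto)
    also have "\<dots> = ?d (2 * k) + ?d (Suc (2 * k))"
      by (rule Bochner_Integration.integral_add)
        (intro integrable_abs Bochner_Integration.integrable_diff b dy_nonneg)+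
    finally show "(\<integral>x. \<bar>b (dy m (Suc k)) x - b (dy m k) x\<bar> \<partial>M) \<le> ?d (2 * k) + ?d (Suc (2 * k))" .
  qed
  also have "\<dots> = mean_var K (Suc m) b"
    unfolding mean_var_def using sum_double[of ?d "K * 2 ^ m"] by (simp add: mult.left_commute)
  finally show ?case using step.IH by simp
qed simp

text \<open>The drift decompositions along finer and finer grids have \<open>L\<^sup>2\<close>-bounded martingale parts; forward
  convex combinations of these converge, which replaces a Doob--Meyer decomposition.\<close>

lemma bounded_variation_decomposition:
  fixes x :: "real \<Rightarrow> 'a \<Rightarrow> real"
  assumes xm: "\<And>t. 0 \<le> t \<Longrightarrow> x t \<in> borel_measurable (F t)"
    and xL: "\<And>t w. 0 \<le> t \<Longrightarrow> w \<in> space M \<Longrightarrow> \<bar>x t w\<bar> \<le> L"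
    and qm: "\<And>m. m0 \<le> m \<Longrightarrow>
       (\<Sum>k<K * 2 ^ m. \<integral>w. \<bar>cexp (dy m k) (\<lambda>w. x (dy m (Suc k)) w - x (dy m k) w) w\<bar> \<partial>M) \<le> c"
  shows "\<exists>U. U \<in> borel_measurable M \<and> integrable M (\<lambda>w. (U w)\<^sup>2) \<and> (\<integral>w. (U w)\<^sup>2 \<partial>M) \<le> L\<^sup>2 + 2 * L * c \<and>
    (\<forall>m. mean_var K m (\<lambda>t w. x t w - cexp t U w) \<le> c) \<and> (AE w in M. x 0 w - cexp 0 U w = 0)"
proof -
  define \<delta> where "\<delta> m k = cexp (dy m k) (\<lambda>w. x (dy m (Suc k)) w - x (dy m k) w)" for m k
  \<comment> \<open>Terminal value at time \<open>K\<close> of the martingale part on grid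
    \<open>m0 + n\<close>; conditioning it recovers that part at all earlier grid times.\<close>
  define f where "f n w = x (dy (m0 + n) (K * 2 ^ (m0 + n))) w - (\<Sum>i<K * 2 ^ (m0 + n). \<delta> (m0 + n) i w)" for n w
  have xM [measurable]: "x t \<in> borel_measurable M" if "0 \<le> t" for t
    by (rule measurable_from_subalg[OF subF xm]) (use that in auto)
  have xi: "integrable M (x t)" if "0 \<le> t" for t
    by (rule integrable_const_bound[of _ L]) (use that xL in auto)
  have L0: "0 \<le> L" using not_empty xL[of 0] by (auto intro: order_trans[OF abs_ge_zero])
  have f: "f n \<in> borel_measurable M" "integrable M (\<lambda>w. (f n w)\<^sup>2)" "(\<integral>w. (f n w)\<^sup>2 \<partial>M) \<le> L\<^sup>2 + 2 * L * c"
    "k \<le> K * 2 ^ (m0 + n) \<Longrightarrow> AE w in M. cexp (dy (m0 + n) k) (f n) w = x (dy (m0 + n) k) w - (\<Sum>i<k. \<delta> (m0 + n) i w)" for n k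
  proof -
    interpret D: discrete_filtration M "\<lambda>k. F (dy (m0 + n) k)" by (rule dyadic_filtration)
    have p1: "x (dy (m0 + n) k) \<in> borel_measurable (F (dy (m0 + n) k))" for k by (rule xm) simp
    have p2: "\<bar>x (dy (m0 + n) k) w\<bar> \<le> L" if "w \<in> space M" for k w by (rule xL) (use that in auto)
    note dd = D.drift_decomposition[of "\<lambda>k. x (dy (m0 + n) k)" L, OF p1 p2]
    show "f n \<in> borel_measurable M"
      unfolding f_def \<delta>_def by (rule dd(1))
    show "integrable M (\<lambda>w. (f n w)\<^sup>2)"
      unfolding f_def \<delta>_def by (rule dd(2))
    show "k \<le> K * 2 ^ (m0 + n) \<Longrightarrow> AE w in M. cexp (dy (m0 + n) k) (f n) w = x (dy (m0 + n) k) w - (\<Sum>i<k. \<delta> (m0 + n) i w)"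
      unfolding f_def[abs_def] \<delta>_def by (rule dd(4))
    have "(\<integral>w. (f n w)\<^sup>2 \<partial>M) \<le> L\<^sup>2 + 2 * L * (\<Sum>k<K * 2 ^ (m0 + n). \<integral>w. \<bar>\<delta> (m0 + n) k w\<bar> \<partial>M)"
      unfolding f_def \<delta>_def by (rule dd(3))
    also have "\<dots> \<le> L\<^sup>2 + 2 * L * c"
      using qm[of "m0 + n"] L0 unfolding \<delta>_def by (intro add_left_mono mult_left_mono) auto
    finally show "(\<integral>w. (f n w)\<^sup>2 \<partial>M) \<le> L\<^sup>2 + 2 * L * c" .
  qed
  have fi: "integrable M (f n)" for n by (rule L1_le_L2(1)[OF f(1,2)])
  define bb where "bb n t w = x t w - cexp t (f n) w" for n t w
  have ci: "integrable M (cexp t Y)" if "0 \<le> t" "integrable M Y" for t Y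
  proof -
    interpret t: sigma_finite_subalgebra M "F t" by (rule cexp_subalgebra[OF that(1)])
    show ?thesis by (rule t.real_cond_exp_int(1)[OF that(2)])
  qed
  have bbi: "integrable M (bb n t)" if "0 \<le> t" for n t
    unfolding bb_def using xi ci fi that by auto
  \<comment> \<open>On its own grid the increments of \<open>bb n\<close> are exactly the drifts, so
    \<open>qm\<close> bounds its mean variation; coarser grids follow by the triangle
    inequality.\<close>
  have bbv: "mean_var K j (bb n) \<le> c" if "j \<le> m0 + n" for j n
  proof -
    have "mean_var K (m0 + n) (bb n) = (\<Sum>k<K * 2 ^ (m0 + n). \<integral>w. \<bar>\<delta> (m0 + n) k w\<bar> \<partial>M)"
      unfolding mean_var_def
    proof (intro sum.cong refl integral_cong_AE)
      fix k assume k: "k \<in> {..<K * 2 ^ (m0 + n)}"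
      have "AE w in M. cexp (dy (m0 + n) k) (f n) w = x (dy (m0 + n) k) w - (\<Sum>i<k. \<delta> (m0 + n) i w)"
        "AE w in M. cexp (dy (m0 + n) (Suc k)) (f n) w = x (dy (m0 + n) (Suc k)) w - (\<Sum>i<Suc k. \<delta> (m0 + n) i w)"
        using k by (auto intro!: f(4) simp del: sum.lessThan_Suc)
      then show "AE w in M. \<bar>bb n (dy (m0 + n) (Suc k)) w - bb n (dy (m0 + n) k) w\<bar> = \<bar>\<delta> (m0 + n) k w\<bar>"
        by eventually_elim (simp add: bb_def)
    qed (use bbi in \<open>auto simp: \<delta>_def intro!: borel_measurable_abs borel_measurable_diff borel_measurable_integrable\<close>)
    also have "\<dots> \<le> c" unfolding \<delta>_def by (rule qm) simp
    finally show ?thesis using mean_var_mono[of "bb n", OF bbi that] by (meson order_trans)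
  qed
  obtain C U where C: "\<And>i. C i \<in> wts i" and U: "U \<in> borel_measurable M" "integrable M (\<lambda>w. (U w)\<^sup>2)"
    "(\<integral>w. (U w)\<^sup>2 \<partial>M) \<le> L\<^sup>2 + 2 * L * c" and CU: "\<And>i. (\<integral>w. \<bar>comb (C i) (\<lambda>n. f n w) - U w\<bar> \<partial>M) \<le> (1/4)^i"
    using L2_forward_convex[of f, OF f(1-3)] by blast
  have Ui: "integrable M U" by (rule L1_le_L2(1)[OF U(1,2)])
  define h where "h i w = comb (C i) (\<lambda>n. f n w)" for i w
  have hi: "integrable M (h i)" for i unfolding h_def by (rule comb_integrable[OF fi])
  define b where "b t w = x t w - cexp t U w" for t w
  have bi: "integrable M (b t)" if "0 \<le> t" for t
    unfolding b_def using xi ci Ui that by auto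
  have close: "(\<integral>w. \<bar>comb (C i) (\<lambda>n. bb n t w) - b t w\<bar> \<partial>M) \<le> (1/4)^i" if t: "0 \<le> t" for i t
  proof -
    interpret t: sigma_finite_subalgebra M "F t" by (rule cexp_subalgebra[OF t])
    have "AE w in M. \<bar>comb (C i) (\<lambda>n. bb n t w) - b t w\<bar> = \<bar>cexp t (h i) w - cexp t U w\<bar>"
      using t.real_cond_exp_comb[of f "C i", OF fi]
      by eventually_elim (simp add: bb_def b_def comb_diff comb_const[OF C] h_def[abs_def] abs_minus_commute)
    then have "(\<integral>w. \<bar>comb (C i) (\<lambda>n. bb n t w) - b t w\<bar> \<partial>M) = (\<integral>w. \<bar>cexp t (h i) w - cexp t U w\<bar> \<partial>M)"
      by (intro integral_cong_AE) (use bbi[OF t] bi[OF t] in auto)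
    also have "\<dots> \<le> (1/4)^i"
      using t.real_cond_exp_L1_dist[OF hi[of i] Ui] CU[of i] by (simp add: h_def)
    finally show ?thesis .
  qed
  have "mean_var K j b \<le> c" for j
  proof -
    \<comment> \<open>Replacing \<open>b\<close> by the combination costs \<open>(1/4)^i\<close> at
      either end of each of the \<open>K * 2 ^ j\<close> cells; the level \<open>j\<close> stays
      fixed while \<open>i\<close> tends to infinity.\<close>
    have le: "mean_var K j b \<le> c + real (K * 2 ^ j) * (2 * (1/4)^i)" if "j \<le> i" for i
    proof -
      let ?g = "\<lambda>t w. comb (C i) (\<lambda>n. bb n t w)"
      have gi: "integrable M (?g t)" if "0 \<le> t" for t by (rule comb_integrable[OF bbi[OF that]])
      have "(\<integral>w. \<bar>b (dy j (Suc k)) w - b (dy j k) w\<bar> \<partial>M)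
          \<le> comb (C i) (\<lambda>n. \<integral>w. \<bar>bb n (dy j (Suc k)) w - bb n (dy j k) w\<bar> \<partial>M) + 2 * (1/4)^i" for k
      proof -
        let ?s = "dy j k" and ?t = "dy j (Suc k)"
        have di: "integrable M (\<lambda>w. \<bar>bb n ?t w - bb n ?s w\<bar>)" for n
          by (intro integrable_abs Bochner_Integration.integrable_diff bbi dy_nonneg)
        have "(\<integral>w. \<bar>b ?t w - b ?s w\<bar> \<partial>M) \<le> (\<integral>w. comb (C i) (\<lambda>n. \<bar>bb n ?t w - bb n ?s w\<bar>) + \<bar>?g ?t w - b ?t w\<bar> + \<bar>?g ?s w - b ?s w\<bar> \<partial>M)"
        proof (rule integral_mono)
          fix w
          have "\<bar>?g ?t w - ?g ?s w\<bar> \<le> comb (C i) (\<lambda>n. \<bar>bb n ?t w - bb n ?s w\<bar>)"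
            unfolding comb_diff[symmetric] using norm_comb_le[OF C[of i], of "\<lambda>n. bb n ?t w - bb n ?s w"] by simp
          then show "\<bar>b ?t w - b ?s w\<bar> \<le> comb (C i) (\<lambda>n. \<bar>bb n ?t w - bb n ?s w\<bar>) + \<bar>?g ?t w - b ?t w\<bar> + \<bar>?g ?s w - b ?s w\<bar>"
            by linarith
        qed ((intro integrable_abs Bochner_Integration.integrable_diff Bochner_Integration.integrable_add
            bi gi dy_nonneg comb_integrable(1)[OF di])+)
        also have "\<dots> = comb (C i) (\<lambda>n. \<integral>w. \<bar>bb n ?t w - bb n ?s w\<bar> \<partial>M) + (\<integral>w. \<bar>?g ?t w - b ?t w\<bar> \<partial>M) + (\<integral>w. \<bar>?g ?s w - b ?s w\<bar> \<partial>M)"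
          unfolding comb_integrable(2)[OF di, symmetric]
          by (subst Bochner_Integration.integral_add, (intro integrable_abs Bochner_Integration.integrable_diff
            Bochner_Integration.integrable_add bi gi dy_nonneg comb_integrable(1)[OF di])+,
            subst Bochner_Integration.integral_add, (intro integrable_abs Bochner_Integration.integrable_diff
            bi gi dy_nonneg comb_integrable(1)[OF di])+, rule refl)
        finally show ?thesis using close[of ?t i] close[of ?s i] by simp
      qed
      then have "mean_var K j b \<le> (\<Sum>k<K * 2 ^ j. comb (C i) (\<lambda>n. \<integral>w. \<bar>bb n (dy j (Suc k)) w - bb n (dy j k) w\<bar> \<partial>M) + 2 * (1/4)^i)"
        unfolding mean_var_def by (rule sum_mono)
      also have "\<dots> = comb (C i) (\<lambda>n. mean_var K j (bb n)) + real (K * 2 ^ j) * (2 * (1/4)^i)"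
      proof -
        have "(\<Sum>k<K * 2 ^ j. comb (C i) (\<lambda>n. \<integral>w. \<bar>bb n (dy j (Suc k)) w - bb n (dy j k) w\<bar> \<partial>M)) = comb (C i) (\<lambda>n. mean_var K j (bb n))"
          unfolding comb_def mean_var_def scaleR_sum_right by (rule sum.swap)
        then show ?thesis by (simp add: sum.distrib)
      qed
      also have "comb (C i) (\<lambda>n. mean_var K j (bb n)) \<le> c"
        by (rule comb_le[OF C]) (use that in \<open>auto intro: bbv\<close>)
      finally show ?thesis by simp
    qed
    have "(\<lambda>i. c + real (K * 2 ^ j) * (2 * (1/4)^i)) \<longlonglongrightarrow> c + real (K * 2 ^ j) * (2 * 0)"
      by (intro tendsto_intros LIMSEQ_power_zero) simp
    from LIMSEQ_le_const[OF this] le show ?thesis by auto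
  qed
  moreover have "AE w in M. b 0 w = 0"
  proof -
    \<comment> \<open>At time 0 the drift sum is empty, so the finite variation part on every grid
      starts at zero.\<close>
    have 0: "AE w in M. bb n 0 w = 0" for n
    proof -
      have "AE w in M. cexp 0 (f n) w = x 0 w" using f(4)[of 0 n] by (simp add: dy_def)
      then show ?thesis by eventually_elim (simp add: bb_def)
    qed
    have "AE w in M. \<forall>n. bb n 0 w = 0" unfolding AE_all_countable using 0 by blast
    then have *: "AE w in M. comb (C i) (\<lambda>n. bb n 0 w) = 0" for i
      by eventually_elim (simp add: comb_def)
    have "(\<integral>w. \<bar>b 0 w\<bar> \<partial>M) \<le> (1/4)^i" for i
    proof -
      have "(\<integral>w. \<bar>b 0 w\<bar> \<partial>M) = (\<integral>w. \<bar>comb (C i) (\<lambda>n. bb n 0 w) - b 0 w\<bar> \<partial>M)"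
        using *[of i] by (intro integral_cong_AE) (use bbi[of 0] bi[of 0] in auto)
      then show ?thesis using close[of 0 i] by simp
    qed
    moreover have "(\<lambda>i. (1/4)^i :: real) \<longlonglongrightarrow> 0" by (rule LIMSEQ_power_zero) simp
    ultimately have "(\<integral>w. \<bar>b 0 w\<bar> \<partial>M) \<le> 0" by (intro LIMSEQ_le_const) auto
    then have "(\<integral>w. \<bar>b 0 w\<bar> \<partial>M) = 0" by (intro antisym) auto
    then show ?thesis using bi[of 0] by (subst (asm) integral_nonneg_eq_0_iff_AE) auto
  qed
  ultimately show ?thesis using U unfolding b_def by blast
qed

end


section \<open>Increasing processes\<close>

text \<open>Only complete grid cells up to \<open>t\<close> are counted. At a point of grid
  \<open>m\<close> this is the variation along that grid up to the point, with nothing left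
  over.\<close>

definition var_upto :: "(real \<Rightarrow> real) \<Rightarrow> nat \<Rightarrow> real \<Rightarrow> real" where
  "var_upto b m t = (\<Sum>k<nat \<lfloor>t * 2 ^ m\<rfloor>. \<bar>b (dy m (Suc k)) - b (dy m k)\<bar>)"

lemma var_upto_dy: "var_upto b m (dy m j) = (\<Sum>k<j. \<bar>b (dy m (Suc k)) - b (dy m k)\<bar>)"
  by (simp add: var_upto_def dy_def)

lemma var_upto_nonneg: "0 \<le> var_upto b m t"
  unfolding var_upto_def by (rule sum_nonneg) simp

lemma var_upto_mono: "s \<le> t \<Longrightarrow> var_upto b m s \<le> var_upto b m t"
  unfolding var_upto_def
  by (intro sum_mono2) (auto intro!: nat_mono floor_mono mult_right_mono elim!: order_less_le_trans)

lemma incseq_var_upto: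
  assumes "0 \<le> t"
  shows "incseq (\<lambda>m. var_upto b m t)"
proof (rule incseq_SucI)
  fix m
  let ?d = "\<lambda>k. \<bar>b (dy (Suc m) (Suc k)) - b (dy (Suc m) k)\<bar>"
  have "2 * \<lfloor>t * 2 ^ m\<rfloor> \<le> \<lfloor>t * 2 ^ Suc m\<rfloor>"
    by (simp add: le_floor_iff)
  then have n: "2 * nat \<lfloor>t * 2 ^ m\<rfloor> \<le> nat \<lfloor>t * 2 ^ Suc m\<rfloor>" by linarith
  have "var_upto b m t \<le> (\<Sum>k<nat \<lfloor>t * 2 ^ m\<rfloor>. ?d (2 * k) + ?d (Suc (2 * k)))"
    unfolding var_upto_def
  proof (rule sum_mono)
    fix k
    have "b (dy m (Suc k)) = b (dy (Suc m) (Suc (Suc (2 * k))))" "b (dy m k) = b (dy (Suc m) (2 * k))"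
      using dy_double[of m "Suc k"] dy_double[of m k] by simp_all
    then show "\<bar>b (dy m (Suc k)) - b (dy m k)\<bar> \<le> ?d (2 * k) + ?d (Suc (2 * k))" by linarith
  qed
  also have "\<dots> = sum ?d {..<2 * nat \<lfloor>t * 2 ^ m\<rfloor>}" by (rule sum_double[symmetric])
  also have "\<dots> \<le> var_upto b (Suc m) t"
    unfolding var_upto_def by (rule sum_mono2) (use n in auto)
  finally show "var_upto b m t \<le> var_upto b (Suc m) t" .
qed

lemma var_upto_increment:
  assumes "s \<in> dyadics K" "t \<in> dyadics K" "s \<le> t"
  shows "\<exists>m0. \<forall>m\<ge>m0. \<bar>b t - b s\<bar> \<le> var_upto b m t - var_upto b m s"
proof -
  obtain m1 k1 where s: "s = dy m1 k1" using assms(1) by (auto simp: dyadics_def)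
  obtain m2 k2 where t: "t = dy m2 k2" using assms(2) by (auto simp: dyadics_def)
  have "\<bar>b t - b s\<bar> \<le> var_upto b m t - var_upto b m s" if m: "m \<ge> max m1 m2" for m
  proof -
    define i where "i = k1 * 2 ^ (m - m1)"
    define j where "j = k2 * 2 ^ (m - m2)"
    have si: "s = dy m i" and tj: "t = dy m j"
      using dy_refine[of m1 "m - m1" k1] dy_refine[of m2 "m - m2" k2] m by (simp_all add: s t i_def j_def)
    have ij: "i \<le> j" using assms(3) by (simp add: si tj dy_def divide_le_cancel)
    have "\<bar>b t - b s\<bar> \<le> (\<Sum>k=i..<j. \<bar>b (dy m (Suc k)) - b (dy m k)\<bar>)"
    proof -
      have "b t - b s = (\<Sum>k=i..<j. b (dy m (Suc k)) - b (dy m k))"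
        unfolding si tj using sum_Suc_diff'[OF ij, of "\<lambda>k. b (dy m k)"] by simp
      then show ?thesis by simp
    qed
    also have "\<dots> = var_upto b m t - var_upto b m s"
      unfolding si tj var_upto_dy lessThan_atLeast0
      using sum.atLeastLessThan_concat[of 0 i j "\<lambda>k. \<bar>b (dy m (Suc k)) - b (dy m k)\<bar>"] ij by simp
    finally show ?thesis .
  qed
  then show ?thesis by blast
qed

definition tot_var :: "(real \<Rightarrow> real) \<Rightarrow> real \<Rightarrow> real" where
  "tot_var b t = lim (\<lambda>m. var_upto b m t)"

text \<open>The grid variations increase with \<open>m\<close> and are dominated by those at
  \<open>K\<close>. The third claim is the Jordan decomposition in disguise: it makes
  \<open>tot_var b\<close> and \<open>tot_var b - b\<close> both increasing on the dyadics.\<close>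

lemma tot_var_dyadics:
  assumes conv: "convergent (\<lambda>m. var_upto b m (real K))"
  shows "t \<in> dyadics K \<Longrightarrow> (\<lambda>m. var_upto b m t) \<longlonglongrightarrow> tot_var b t"
    and "t \<in> dyadics K \<Longrightarrow> 0 \<le> tot_var b t"
    and "s \<in> dyadics K \<Longrightarrow> t \<in> dyadics K \<Longrightarrow> s \<le> t \<Longrightarrow> \<bar>b t - b s\<bar> \<le> tot_var b t - tot_var b s"
proof -
  obtain c where c: "\<And>m. var_upto b m (real K) \<le> c"
    using convergent_imp_Bseq[OF conv] by (auto simp: Bseq_def intro: order_trans[OF abs_ge_self])
  show lim: "(\<lambda>m. var_upto b m t) \<longlonglongrightarrow> tot_var b t" if t: "t \<in> dyadics K" for t
  proof -
    have "var_upto b m t \<le> c" for m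
      using var_upto_mono[of t "real K" b m] dyadics_range[OF t] c[of m] by linarith
    then obtain l where "(\<lambda>m. var_upto b m t) \<longlonglongrightarrow> l"
      using incseq_convergent[OF incseq_var_upto] dyadics_range[OF t] by metis
    then show ?thesis unfolding tot_var_def by (simp add: limI)
  qed
  show "0 \<le> tot_var b t" if t: "t \<in> dyadics K" for t
    using lim[OF t] by (rule LIMSEQ_le_const) (use var_upto_nonneg in auto)
  show "\<bar>b t - b s\<bar> \<le> tot_var b t - tot_var b s" if "s \<in> dyadics K" "t \<in> dyadics K" "s \<le> t" for s t
    using tendsto_diff[OF lim[OF that(2)] lim[OF that(1)]]
    by (rule LIMSEQ_le_const) (use var_upto_increment[OF that, of b] in blast)
qed

lemma L1_bounded_incseq:
  fixes f :: "nat \<Rightarrow> 'a \<Rightarrow> real"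
  assumes int: "\<And>m. integrable M (f m)" and nn: "\<And>m x. 0 \<le> f m x" and inc: "\<And>x. incseq (\<lambda>m. f m x)"
    and le: "\<And>m. (\<integral>x. f m x \<partial>M) \<le> c"
  shows "AE x in M. convergent (\<lambda>m. f m x)"
    and "integrable M (\<lambda>x. lim (\<lambda>m. f m x))" and "(\<integral>x. lim (\<lambda>m. f m x) \<partial>M) \<le> c"
proof -
  have [measurable]: "f m \<in> borel_measurable M" for m using int by auto
  have nnle: "(\<integral>\<^sup>+x. ennreal (f m x) \<partial>M) \<le> ennreal c" for m
    using le[of m] nn int[of m] by (simp add: nn_integral_eq_integral ennreal_leI)
  have "0 \<le> (\<integral>x. f 0 x \<partial>M)" by (rule Bochner_Integration.integral_nonneg) (rule nn)
  then have c: "0 \<le> c" using le[of 0] by (rule order_trans)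
  have "(\<integral>\<^sup>+x. (SUP m. ennreal (f m x)) \<partial>M) = (SUP m. \<integral>\<^sup>+x. ennreal (f m x) \<partial>M)"
    by (rule nn_integral_monotone_convergence_SUP) (use inc in \<open>auto simp: incseq_def le_fun_def intro!: ennreal_leI\<close>)
  also have "\<dots> \<le> ennreal c" by (rule SUP_least[OF nnle])
  finally have sup: "(\<integral>\<^sup>+x. (SUP m. ennreal (f m x)) \<partial>M) \<le> ennreal c" .
  then have "AE x in M. (SUP m. ennreal (f m x)) \<noteq> \<infinity>"
    by (intro nn_integral_PInf_AE) (auto simp: top_unique)
  then show conv: "AE x in M. convergent (\<lambda>m. f m x)"
  proof eventually_elim
    case (elim x)
    then obtain b where b: "0 \<le> b" "(SUP m. ennreal (f m x)) = ennreal b"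
      by (cases "SUP m. ennreal (f m x)") auto
    have "f m x \<le> b" for m
      using SUP_upper[of m UNIV "\<lambda>m. ennreal (f m x)"] b by simp
    then show ?case using incseq_convergent[OF inc] by (metis convergent_def)
  qed
  have nnlim: "(\<integral>\<^sup>+x. ennreal (lim (\<lambda>m. f m x)) \<partial>M) \<le> ennreal c"
  proof -
    have "(\<integral>\<^sup>+x. ennreal (lim (\<lambda>m. f m x)) \<partial>M) \<le> (\<integral>\<^sup>+x. (SUP m. ennreal (f m x)) \<partial>M)"
    proof (rule nn_integral_mono_AE, use conv in eventually_elim)
      case (elim x)
      then have "(\<lambda>m. ennreal (f m x)) \<longlonglongrightarrow> ennreal (lim (\<lambda>m. f m x))"
        by (intro tendsto_ennrealI) (simp add: convergent_LIMSEQ_iff)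
      then show ?case by (rule LIMSEQ_le_const2) (auto intro!: SUP_upper)
    qed
    then show ?thesis using sup by (rule order_trans)
  qed
  have limnn: "AE x in M. 0 \<le> lim (\<lambda>m. f m x)"
    using conv by eventually_elim (auto simp: convergent_LIMSEQ_iff intro!: LIMSEQ_le_const nn)
  show il: "integrable M (\<lambda>x. lim (\<lambda>m. f m x))"
    by (rule integrableI_nonneg) (use nnlim limnn in \<open>auto intro: le_less_trans\<close>)
  show "(\<integral>x. lim (\<lambda>m. f m x) \<partial>M) \<le> c"
    using nnlim limnn c il by (simp add: nn_integral_eq_integral)
qed

text \<open>For increasing \<open>b\<close> and \<open>t < real K\<close> this is the right limit at
  \<open>t\<close> along the dyadics. The default \<open>b (real K)\<close> is the largest value and
  leaves the infimum unchanged; it keeps the index set independent of \<open>t\<close>, so that a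
  random time can be inserted without losing measurability.\<close>

definition right_inf :: "nat \<Rightarrow> (real \<Rightarrow> real) \<Rightarrow> real \<Rightarrow> real" where
  "right_inf K b t = (INF s\<in>dyadics K. if t < s then b s else b (real K))"

lemma right_filter_nontrivial:
  assumes "0 \<le> t" "t < real K"
  shows "at t within (dyadics K \<inter> {t<..}) \<noteq> bot"
proof -
  have "t islimpt (dyadics K \<inter> {t<..})"
    unfolding islimpt_approachable
  proof (intro allI impI)
    fix e :: real assume "0 < e"
    from dyadics_dense[OF assms this] obtain s where "s \<in> dyadics K" "t < s" "s < t + e" by blast
    then show "\<exists>x'\<in>dyadics K \<inter> {t<..}. x' \<noteq> t \<and> dist x' t < e"
      by (intro bexI[of _ s]) (auto simp: dist_real_def)
  qed
  then show ?thesis using trivial_limit_within by blast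
qed

lemma right_inf_tendsto:
  assumes mono: "\<And>s u. s \<in> dyadics K \<Longrightarrow> u \<in> dyadics K \<Longrightarrow> s \<le> u \<Longrightarrow> b s \<le> b u"
    and lb: "\<And>s. s \<in> dyadics K \<Longrightarrow> c \<le> b s" and t: "t < real K"
  shows "(b \<longlongrightarrow> right_inf K b t) (at t within (dyadics K \<inter> {t<..}))"
proof (rule order_tendstoI)
  have bdd: "bdd_below ((\<lambda>s. if t < s then b s else b (real K)) ` dyadics K)"
    by (rule bdd_belowI[of _ c]) (use lb K_in_dyadics in auto)
  have ev: "eventually (\<lambda>s. s \<in> dyadics K \<and> t < s) (at t within (dyadics K \<inter> {t<..}))"
    by (auto simp: eventually_at_filter)
  fix a
  show "eventually (\<lambda>s. a < b s) (at t within (dyadics K \<inter> {t<..}))" if "a < right_inf K b t"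
    using ev
  proof eventually_elim
    case (elim s)
    have "right_inf K b t \<le> b s"
      unfolding right_inf_def using cINF_lower[OF bdd, of s] elim by simp
    then show ?case using that by simp
  qed
  show "eventually (\<lambda>s. b s < a) (at t within (dyadics K \<inter> {t<..}))" if "right_inf K b t < a"
  proof -
    have ne: "dyadics K \<noteq> {}" using K_in_dyadics by blast
    have "\<exists>s\<in>dyadics K. (if t < s then b s else b (real K)) < a"
      using that unfolding right_inf_def cINF_less_iff[OF ne bdd] .
    then obtain s0 where s0: "s0 \<in> dyadics K" "(if t < s0 then b s0 else b (real K)) < a" by blast
    \<comment> \<open>A point not beyond \<open>t\<close> contributes only the default value, so it
      may be replaced by \<open>K\<close>, which is beyond \<open>t\<close>.\<close>
    define s1 where "s1 = (if t < s0 then s0 else real K)"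
    have s1: "s1 \<in> dyadics K" "t < s1" "b s1 < a" using s0 t K_in_dyadics by (auto simp: s1_def split: if_splits)
    have "eventually (\<lambda>s. s < s1) (at t within (dyadics K \<inter> {t<..}))"
      by (rule order_tendstoD(2)[OF tendsto_ident_at s1(2)])
    with ev show ?thesis
    proof eventually_elim
      case (elim s)
      then show ?case using mono[of s s1] s1 by force
    qed
  qed
qed

text \<open>An infimum is not linear in general, but for increasing functions it is a right limit,
  and limits commute with finite combinations.\<close>

lemma right_inf_comb:
  assumes mono: "\<And>n s u. s \<in> dyadics K \<Longrightarrow> u \<in> dyadics K \<Longrightarrow> s \<le> u \<Longrightarrow> b n s \<le> b n u"
    and lb: "\<And>n s. s \<in> dyadics K \<Longrightarrow> c \<le> b n s" and t: "0 \<le> t" "t < real K" and w: "w \<in> wts i"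
  shows "right_inf K (\<lambda>s. comb w (\<lambda>n. b n s)) t = comb w (\<lambda>n. right_inf K (b n) t)"
proof (rule tendsto_unique[OF right_filter_nontrivial[OF t]])
  show "((\<lambda>s. comb w (\<lambda>n. b n s)) \<longlongrightarrow> right_inf K (\<lambda>s. comb w (\<lambda>n. b n s)) t) (at t within (dyadics K \<inter> {t<..}))"
    by (rule right_inf_tendsto[of _ _ c], rule comb_mono[OF w], rule mono, assumption+,
        rule comb_ge[OF w], rule lb, assumption, rule t)
  show "((\<lambda>s. comb w (\<lambda>n. b n s)) \<longlongrightarrow> comb w (\<lambda>n. right_inf K (b n) t)) (at t within (dyadics K \<inter> {t<..}))"
    by (intro comb_tendsto_filter right_inf_tendsto[of _ _ c] mono lb t)
qed

text \<open>A jump of the limit function straddles a rational level \<open>r\<close>, so it is the first time above \<open>r\<close>.\<close>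

lemma right_limits_converge:
  fixes v :: "nat \<Rightarrow> real \<Rightarrow> real"
  assumes mono: "\<And>i s u. s \<in> dyadics K \<Longrightarrow> u \<in> dyadics K \<Longrightarrow> s \<le> u \<Longrightarrow> v i s \<le> v i u"
    and nn: "\<And>i s. s \<in> dyadics K \<Longrightarrow> 0 \<le> v i s"
    and lim: "\<And>s. s \<in> dyadics K \<Longrightarrow> (\<lambda>i. v i s) \<longlonglongrightarrow> l s"
    and jump: "\<And>r. r \<in> \<rat> \<Longrightarrow> convergent (\<lambda>i. right_inf K (v i) (INF s\<in>dyadics K. if r < l s then s else real K))"
    and t: "0 \<le> t" "t < real K"
  shows "convergent (\<lambda>i. right_inf K (v i) t)"
proof -
  let ?\<tau> = "\<lambda>r. INF s\<in>dyadics K. if r < l s then s else real K"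
  have ne: "dyadics K \<noteq> {}" using zero_in_dyadics by blast
  have bddt: "bdd_below ((\<lambda>s. if r < l s then s else real K) ` dyadics K)" for r
    by (rule bdd_belowI[of _ 0]) (use dyadics_range in auto)
  have lmono: "l s \<le> l u" if "s \<in> dyadics K" "u \<in> dyadics K" "s \<le> u" for s u
    by (rule LIMSEQ_le[OF lim[OF that(1)] lim[OF that(2)]]) (use mono that in auto)
  have lnn: "0 \<le> l s" if "s \<in> dyadics K" for s
    by (rule LIMSEQ_le_const[OF lim[OF that]]) (use nn that in auto)
  have first: "?\<tau> r = t" if low: "\<And>s. s \<in> dyadics K \<Longrightarrow> s < t \<Longrightarrow> l s \<le> r" and high: "\<And>s. s \<in> dyadics K \<Longrightarrow> t < s \<Longrightarrow> r < l s" for r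
  proof (rule antisym)
    show "t \<le> ?\<tau> r"
      by (rule cINF_greatest[OF ne]) (use low t in \<open>force split: if_splits\<close>)
    show "?\<tau> r \<le> t"
    proof (rule field_le_epsilon)
      fix e :: real assume "0 < e"
      from dyadics_dense[OF t this] obtain s where s: "s \<in> dyadics K" "t < s" "s < t + e" by blast
      have "?\<tau> r \<le> (if r < l s then s else real K)" by (rule cINF_lower[OF bddt s(1)])
      then show "?\<tau> r \<le> t + e" using high[OF s(1,2)] s(3) by simp
    qed
  qed
  show ?thesis
  proof (cases "t = 0")
    case True
    \<comment> \<open>The limit is nonnegative, so the level \<open>-1\<close> is exceeded from the
      outset; this settles \<open>t = 0\<close>, which has no dyadic point to its left.\<close>
    have "?\<tau> (-1) = t" by (rule first) (use True lnn dyadics_range in force)+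
    then show ?thesis using jump[of "-1"] by simp
  next
    case False
    then have t0: "0 < t" using t by simp
    \<comment> \<open>Left and right limits of \<open>l\<close> at \<open>t\<close> along the
      dyadics.\<close>
    define a where "a = Sup (l ` {s \<in> dyadics K. s < t})"
    define b where "b = Inf (l ` {s \<in> dyadics K. t < s})"
    have low_ne: "{s \<in> dyadics K. s < t} \<noteq> {}" using zero_in_dyadics t0 by blast
    have high_ne: "{s \<in> dyadics K. t < s} \<noteq> {}" using K_in_dyadics t by blast
    have low_bdd: "bdd_above (l ` {s \<in> dyadics K. s < t})"
      by (rule bdd_aboveI[of _ "l (real K)"]) (use lmono K_in_dyadics dyadics_range in auto)
    have high_bdd: "bdd_below (l ` {s \<in> dyadics K. t < s})"
      by (rule bdd_belowI[of _ 0]) (use lnn in auto)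
    have low: "l s \<le> a" if "s \<in> dyadics K" "s < t" for s
      unfolding a_def by (rule cSup_upper[OF _ low_bdd]) (use that in auto)
    have high: "b \<le> l s" if "s \<in> dyadics K" "t < s" for s
      unfolding b_def by (rule cInf_lower[OF _ high_bdd]) (use that in auto)
    show ?thesis
    proof (cases "a < b")
      case True
      then obtain r where r: "r \<in> \<rat>" "a < r" "r < b" using Rats_dense_in_real by blast
      have "?\<tau> r = t" by (rule first) (use low high r in force)+
      then show ?thesis using jump[OF r(1)] by simp
    next
      case False
      \<comment> \<open>There is no gap between the one-sided limits of \<open>l\<close>: dyadic
        points on either side of \<open>t\<close> sandwich the right limits of \<open>v i\<close>,
        and \<open>b \<le> a\<close> makes the two bounds meet.\<close>
      have "(\<lambda>i. right_inf K (v i) t) \<longlonglongrightarrow> a"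
      proof (rule order_tendstoI)
        have up: "right_inf K (v i) t \<le> v i s" if s: "s \<in> dyadics K" "t < s" for i s
        proof -
          have "bdd_below ((\<lambda>s. if t < s then v i s else v i (real K)) ` dyadics K)"
            by (rule bdd_belowI[of _ 0]) (use nn K_in_dyadics in auto)
          from cINF_lower[OF this s(1)] s(2) show ?thesis by (simp add: right_inf_def)
        qed
        have dn: "v i s \<le> right_inf K (v i) t" if s: "s \<in> dyadics K" "s < t" for i s
          unfolding right_inf_def
          by (rule cINF_greatest[OF ne]) (use s mono t K_in_dyadics in auto)
        fix e
        show "eventually (\<lambda>i. e < right_inf K (v i) t) sequentially" if "e < a"
        proof -
          have "l ` {s \<in> dyadics K. s < t} \<noteq> {}" using low_ne by blast
          from iffD1[OF less_cSup_iff[OF this low_bdd] that[unfolded a_def]]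
          obtain s where s: "s \<in> dyadics K" "s < t" "e < l s" by blast
          have "eventually (\<lambda>i. e < v i s) sequentially" by (rule order_tendstoD(1)[OF lim[OF s(1)] s(3)])
          then show ?thesis by eventually_elim (rule less_le_trans[OF _ dn[OF s(1,2)]])
        qed
        show "eventually (\<lambda>i. right_inf K (v i) t < e) sequentially" if "a < e"
        proof -
          have "b < e" using that False by simp
          have "l ` {s \<in> dyadics K. t < s} \<noteq> {}" using high_ne by blast
          from iffD1[OF cInf_less_iff[OF this high_bdd] \<open>b < e\<close>[unfolded b_def]]
          obtain s where s: "s \<in> dyadics K" "t < s" "l s < e" by blast
          have "eventually (\<lambda>i. v i s < e) sequentially" by (rule order_tendstoD(2)[OF lim[OF s(1)] s(3)])
          then show ?thesis by eventually_elim (rule le_less_trans[OF up[OF s(1,2)]])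
        qed
      qed
      then show ?thesis by (auto simp: convergent_def)
    qed
  qed
qed

lemma comp_wts_convergent:
  fixes a :: "nat \<Rightarrow> 'b::real_normed_vector"
  assumes "convergent (\<lambda>i. comb (W i) a)" and W: "\<And>i. W i \<in> wts i" and C: "\<And>i. C i \<in> wts i"
    and V: "\<And>i. i0 \<le> i \<Longrightarrow> V i = comp_wts (C i) W"
  shows "convergent (\<lambda>i. comb (V i) a)"
proof -
  have "convergent (\<lambda>i. comb (C i) (\<lambda>j. comb (W j) a))"
    by (rule comb_convergent[OF assms(1), of 0]) (rule C)
  moreover have ev: "eventually (\<lambda>i. comb (C i) (\<lambda>j. comb (W j) a) = comb (V i) a) sequentially"
    using eventually_ge_at_top[of i0] by eventually_elim (simp add: V comp_wts(2)[OF C W])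
  ultimately show ?thesis using convergent_cong[OF ev] by simp
qed

section \<open>Convex combinations of increasing processes\<close>

context prob_space
begin

text \<open>Each requirement is solved by the lemma for nonnegative variables, with boundedness in
  probability supplied by Markov's inequality. Combinations inherit the bound \<open>c\<close>, so
  the diagonal scheme applies.\<close>

lemma countable_forward_convex:
  fixes f :: "nat \<Rightarrow> nat \<Rightarrow> 'a \<Rightarrow> real"
  assumes int: "\<And>j n. integrable M (f j n)" and nn: "\<And>j n x. x \<in> space M \<Longrightarrow> 0 \<le> f j n x"
    and le: "\<And>j n. (\<integral>x. f j n x \<partial>M) \<le> c"
  shows "\<exists>C. (\<forall>i. C i \<in> wts i) \<and> (\<forall>j. AE x in M. convergent (\<lambda>i. comb (C i) (\<lambda>n. f j n x)))"
proof (rule diagonal_wts)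
  fix j W assume W: "\<And>i. W i \<in> wts i"
  let ?g = "\<lambda>n x. comb (W n) (\<lambda>n. f j n x)"
  have gi: "integrable M (?g n)" for n by (rule comb_integrable[OF int])
  have gnn: "0 \<le> ?g n x" if "x \<in> space M" for n x by (rule comb_ge[OF W]) (rule nn[OF that])
  have gle: "(\<integral>x. ?g n x \<partial>M) \<le> c" for n
    unfolding comb_integrable(2)[OF int] by (rule comb_le[OF W le])
  have "\<exists>C. (\<forall>i. C i \<in> wts i) \<and> (AE x in M. convergent (\<lambda>i. comb (C i) (\<lambda>n. ?g n x)))"
  proof (rule nonneg_forward_convex)
    show "?g n \<in> borel_measurable M" for n using gi by auto
    show "\<exists>\<delta>. \<forall>w\<in>wts 0. prob {x \<in> space M. \<delta> \<le> comb w (\<lambda>n. ?g n x)} \<le> \<epsilon>" if "0 < \<epsilon>" for \<epsilon>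
      by (rule L0_bound_of_integral[of ?g, OF gi gnn gle that])
  qed (rule gnn)
  then obtain C where C: "\<And>i. C i \<in> wts i" "AE x in M. convergent (\<lambda>i. comb (C i) (\<lambda>n. ?g n x))"
    by blast
  then show "\<exists>C. (\<forall>i. C i \<in> wts i) \<and> (AE x in M. convergent (\<lambda>i. comb (comp_wts (C i) W) (\<lambda>n. f j n x)))"
    by (intro exI[of _ C]) (simp add: comp_wts(2)[OF C(1) W])
next
  fix j W C V and i0 :: nat
  assume W: "\<And>i. W i \<in> wts i" and ae: "AE x in M. convergent (\<lambda>i. comb (W i) (\<lambda>n. f j n x))"
    and C: "\<And>i. C i \<in> wts i" and V: "\<And>i. i0 \<le> i \<Longrightarrow> V i = comp_wts (C i) W"
  from ae show "AE x in M. convergent (\<lambda>i. comb (V i) (\<lambda>n. f j n x))"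
    by eventually_elim (rule comp_wts_convergent[OF _ W C V])
qed

text \<open>Two passages, in this order: the first produces the limit \<open>l\<close> at dyadic
  times, and only \<open>l\<close> determines the random times \<open>\<tau> r\<close> among which
  its jumps are found. The second enforces convergence at these times and does not disturb the
  first.\<close>

lemma increasing_forward_convex:
  fixes v :: "nat \<Rightarrow> real \<Rightarrow> 'a \<Rightarrow> real"
  assumes vm: "\<And>n s. s \<in> dyadics K \<Longrightarrow> v n s \<in> borel_measurable M"
    and nn: "\<And>n s x. s \<in> dyadics K \<Longrightarrow> x \<in> space M \<Longrightarrow> 0 \<le> v n s x"
    and mono: "\<And>n s t x. s \<in> dyadics K \<Longrightarrow> t \<in> dyadics K \<Longrightarrow> s \<le> t \<Longrightarrow> x \<in> space M \<Longrightarrow> v n s x \<le> v n t x"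
    and int: "\<And>n. integrable M (v n (real K))" and le: "\<And>n. (\<integral>x. v n (real K) x \<partial>M) \<le> c"
  shows "\<exists>C. (\<forall>i. C i \<in> wts i) \<and>
    (AE x in M. \<forall>t. 0 \<le> t \<and> t < real K \<longrightarrow> convergent (\<lambda>i. comb (C i) (\<lambda>n. right_inf K (\<lambda>s. v n s x) t)))"
proof -
  let ?D = "dyadics K"
  have ne: "?D \<noteq> {}" using zero_in_dyadics by blast
  have leK: "v n s x \<le> v n (real K) x" if "s \<in> ?D" "x \<in> space M" for n s x
    using that mono K_in_dyadics dyadics_range by blast
  \<comment> \<open>Everything that occurs lies between 0 and the value at \<open>K\<close>, which
    supplies integrability and the bound \<open>c\<close>.\<close>
  have dom: "integrable M g \<and> (\<integral>x. g x \<partial>M) \<le> c"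
    if [measurable]: "g \<in> borel_measurable M" and "\<And>x. x \<in> space M \<Longrightarrow> 0 \<le> g x \<and> g x \<le> v n (real K) x" for g n
  proof -
    have gi: "integrable M g"
      by (rule Bochner_Integration.integrable_bound[OF int[of n]]) (use that(2) in \<open>auto intro!: AE_I2 intro: order_trans[OF _ abs_ge_self] simp: abs_of_nonneg\<close>)
    have "(\<integral>x. g x \<partial>M) \<le> (\<integral>x. v n (real K) x \<partial>M)"
      by (rule integral_mono[OF gi int]) (use that(2) in auto)
    then show ?thesis using gi le[of n] by simp
  qed
  define q where "q = from_nat_into ?D"
  have q: "q j \<in> ?D" for j unfolding q_def by (rule from_nat_into[OF ne])
  have d1: "integrable M (v n (q j)) \<and> (\<integral>x. v n (q j) x \<partial>M) \<le> c" for j n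
    by (rule dom[of _ n]) (use vm q nn leK in auto)
  obtain W where W: "\<And>i. W i \<in> wts i" and Wc: "\<And>j. AE x in M. convergent (\<lambda>i. comb (W i) (\<lambda>n. v n (q j) x))"
    using countable_forward_convex[of "\<lambda>j n. v n (q j)" c] d1 nn q by blast
  have Wconv: "AE x in M. \<forall>s\<in>?D. convergent (\<lambda>i. comb (W i) (\<lambda>n. v n s x))"
    unfolding AE_ball_countable[OF countable_dyadics]
  proof
    fix s assume "s \<in> ?D"
    then obtain j where "s = q j" unfolding q_def using from_nat_into_surj[OF countable_dyadics] by metis
    then show "AE x in M. convergent (\<lambda>i. comb (W i) (\<lambda>n. v n s x))" using Wc by simp
  qed
  define l where "l s x = lim (\<lambda>i. comb (W i) (\<lambda>n. v n s x))" for s x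
  have lm [measurable]: "l s \<in> borel_measurable M" if "s \<in> ?D" for s
    unfolding l_def[abs_def] using vm[OF that] by measurable
  \<comment> \<open>First time at which the limit exceeds \<open>r\<close>; the value
    \<open>K\<close> means that this does not happen before \<open>K\<close>.\<close>
  define \<tau> where "\<tau> r x = (INF s\<in>?D. if r < l s x then s else real K)" for r x
  have \<tau>m [measurable]: "\<tau> r \<in> borel_measurable M" for r
    unfolding \<tau>_def[abs_def]
  proof (rule borel_measurable_cINF)
    show "(\<lambda>x. if r < l s x then s else real K) \<in> borel_measurable M" if "s \<in> ?D" for s
      using lm[OF that] by measurable
    show "bdd_below ((\<lambda>s. if r < l s x then s else real K) ` ?D)" for x
      by (rule bdd_belowI[of _ 0]) (use dyadics_range in auto)
  qed (rule countable_dyadics)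
  define f where "f r n x = right_inf K (\<lambda>s. v n s x) (\<tau> r x)" for r n x
  have bddv: "bdd_below ((\<lambda>s. if t < s then v n s x else v n (real K) x) ` ?D)" if "x \<in> space M" for t n x
    by (rule bdd_belowI[of _ 0]) (use nn that K_in_dyadics in auto)
  have fm: "f r n \<in> borel_measurable M" for r n
    unfolding f_def[abs_def] right_inf_def
  proof (rule borel_measurable_cINF)
    show "(\<lambda>x. if \<tau> r x < s then v n s x else v n (real K) x) \<in> borel_measurable M" if "s \<in> ?D" for s
      using vm[OF that] vm[OF K_in_dyadics] by measurable
  qed (use bddv countable_dyadics in auto)
  have fb: "0 \<le> f r n x \<and> f r n x \<le> v n (real K) x" if x: "x \<in> space M" for r n x
  proof
    show "0 \<le> f r n x" unfolding f_def right_inf_def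
      by (rule cINF_greatest[OF ne]) (use nn x K_in_dyadics in auto)
    show "f r n x \<le> v n (real K) x" unfolding f_def right_inf_def
      by (rule order_trans[OF cINF_lower[OF bddv[OF x] K_in_dyadics]]) simp
  qed
  have fd: "integrable M (f r n)" "(\<integral>x. f r n x \<partial>M) \<le> c" for r n
    using dom[OF fm, of r n n] fb by auto
  define \<rho> :: "nat \<Rightarrow> real" where "\<rho> = from_nat_into \<rat>"
  let ?g = "\<lambda>j n x. comb (W n) (\<lambda>n. f (\<rho> j) n x)"
  have g1: "integrable M (?g j n)" for j n by (rule comb_integrable[OF fd(1)])
  have g2: "0 \<le> ?g j n x" if "x \<in> space M" for j n x by (rule comb_ge[OF W]) (use fb that in auto)
  have g3: "(\<integral>x. ?g j n x \<partial>M) \<le> c" for j n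
    unfolding comb_integrable(2)[OF fd(1)] by (rule comb_le[OF W fd(2)])
  obtain C where C: "\<And>i. C i \<in> wts i" and Cc: "\<And>j. AE x in M. convergent (\<lambda>i. comb (C i) (\<lambda>n. ?g j n x))"
    using countable_forward_convex[of ?g c, OF g1 g2 g3] by blast
  have "AE x in M. \<forall>t. 0 \<le> t \<and> t < real K \<longrightarrow>
      convergent (\<lambda>i. comb (comp_wts (C i) W) (\<lambda>n. right_inf K (\<lambda>s. v n s x) t))"
  proof -
    have "AE x in M. \<forall>j. convergent (\<lambda>i. comb (C i) (\<lambda>n. ?g j n x))"
      unfolding AE_all_countable using Cc by blast
    then show ?thesis using Wconv AE_space
    proof eventually_elim
      case (elim x)
      let ?V = "\<lambda>i. comp_wts (C i) W"
      have V: "?V i \<in> wts i" for i by (rule comp_wts(1)[OF C W])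
      let ?v = "\<lambda>i s. comb (?V i) (\<lambda>n. v n s x)"
      note m = mono[OF _ _ _ elim(3)] and p = nn[OF _ elim(3)]
      have ri: "right_inf K (?v i) t = comb (?V i) (\<lambda>n. right_inf K (\<lambda>s. v n s x) t)" if "0 \<le> t" "t < real K" for i t
        by (rule right_inf_comb[of K _ 0, OF _ _ that V]) (use m p in auto)
      have tau0: "0 \<le> \<tau> r x" for r
        unfolding \<tau>_def by (rule cINF_greatest[OF ne]) (use dyadics_range in auto)
      show ?case
      proof (intro allI impI)
        fix t assume t: "0 \<le> t \<and> t < real K"
        have "convergent (\<lambda>i. right_inf K (?v i) t)"
        proof (rule right_limits_converge[where l = "\<lambda>s. l s x"])
          show "?v i s \<le> ?v i u" if "s \<in> ?D" "u \<in> ?D" "s \<le> u" for i s u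
            by (rule comb_mono[OF V]) (use m that in auto)
          show "0 \<le> ?v i s" if "s \<in> ?D" for i s by (rule comb_ge[OF V]) (use p that in auto)
          show "(\<lambda>i. ?v i s) \<longlonglongrightarrow> l s x" if "s \<in> ?D" for s
          proof -
            have "(\<lambda>i. comb (W i) (\<lambda>n. v n s x)) \<longlonglongrightarrow> l s x"
              using elim(2) that unfolding l_def by (simp add: convergent_LIMSEQ_iff)
            then have "(\<lambda>i. comb (C i) (\<lambda>j. comb (W j) (\<lambda>n. v n s x))) \<longlonglongrightarrow> l s x"
              by (rule comb_tendsto[of _ _ 0]) (rule C)
            then show ?thesis by (simp add: comp_wts(2)[OF C W])
          qed
          show "convergent (\<lambda>i. right_inf K (?v i) (INF s\<in>?D. if r < l s x then s else real K))" if r: "r \<in> \<rat>" for r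
          proof (cases "\<tau> r x < real K")
            case True
            obtain j where "r = \<rho> j" unfolding \<rho>_def using from_nat_into_surj[OF countable_rat r] by metis
            then have "convergent (\<lambda>i. comb (?V i) (\<lambda>n. f r n x))"
              using elim(1) by (simp add: comp_wts(2)[OF C W])
            then show ?thesis using ri[OF tau0 True] by (simp add: f_def \<tau>_def)
          next
            case False
            \<comment> \<open>No dyadic point lies beyond \<open>K\<close>, so
              \<open>right_inf\<close> falls back to its default, the value at \<open>K\<close>,
              where convergence is already known.\<close>
            then have big: "\<not> \<tau> r x < s" if "s \<in> ?D" for s using dyadics_range[OF that] by linarith
            have "right_inf K (?v i) (\<tau> r x) = ?v i (real K)" for i
            proof -
              have "right_inf K (?v i) (\<tau> r x) = (INF s\<in>?D. ?v i (real K))"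
                unfolding right_inf_def by (rule INF_cong) (use big in auto)
              then show ?thesis using ne by simp
            qed
            moreover have "convergent (\<lambda>i. ?v i (real K))"
            proof -
              have "convergent (\<lambda>i. comb (W i) (\<lambda>n. v n (real K) x))" using elim(2) K_in_dyadics by blast
              then have "convergent (\<lambda>i. comb (C i) (\<lambda>j. comb (W j) (\<lambda>n. v n (real K) x)))"
                by (rule comb_convergent[of _ 0]) (rule C)
              then show ?thesis by (simp only: comp_wts(2)[OF C W])
            qed
            ultimately show ?thesis by (simp add: \<tau>_def)
          qed
        qed (use t in auto)
        then show "convergent (\<lambda>i. comb (?V i) (\<lambda>n. right_inf K (\<lambda>s. v n s x) t))"
          using ri t by simp
      qed
    qed
  qed
  then show ?thesis using comp_wts(1)[OF C W] by (intro exI[of _ "\<lambda>i. comp_wts (C i) W"] conjI allI)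
qed

end

text \<open>The parts \<open>A i\<close> themselves are never passed to a right limit. They enter
  only through \<open>A i - A j\<close>, which is uniformly small on \<open>D\<close> and equals the
  difference of the \<open>X - P + Q\<close>; hence the right limits of the latter form a Cauchy
  sequence, and \<open>Pr\<close> and \<open>Qr\<close> are put back.\<close>

lemma right_limits_of_decomposition:
  fixes X P Q A :: "nat \<Rightarrow> 'a \<Rightarrow> real"
  assumes G: "G \<noteq> bot" and D: "eventually (\<lambda>s. s \<in> D) G"
    and X: "\<And>i s. s \<in> D \<Longrightarrow> X i s = A i s + P i s - Q i s"
    and unif: "\<And>e. 0 < e \<Longrightarrow> \<exists>i0. \<forall>i\<ge>i0. \<forall>s\<in>D. \<bar>A i s - a s\<bar> \<le> e"
    and lims: "\<And>i. (X i \<longlongrightarrow> Xr i) G" "\<And>i. (P i \<longlongrightarrow> Pr i) G" "\<And>i. (Q i \<longlongrightarrow> Qr i) G"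
    and conv: "convergent Pr" "convergent Qr"
  shows "convergent Xr"
proof -
  have "Cauchy (\<lambda>i. Xr i - Pr i + Qr i)"
  proof (rule metric_CauchyI)
    fix e :: real assume "0 < e"
    then obtain i0 where i0: "\<And>i s. i \<ge> i0 \<Longrightarrow> s \<in> D \<Longrightarrow> \<bar>A i s - a s\<bar> \<le> e / 3"
      using unif[of "e / 3"] by auto
    have "dist (Xr i - Pr i + Qr i) (Xr j - Pr j + Qr j) < e" if ij: "i \<ge> i0" "j \<ge> i0" for i j
    proof -
      have "((\<lambda>s. \<bar>(X i s - P i s + Q i s) - (X j s - P j s + Q j s)\<bar>)
          \<longlongrightarrow> \<bar>(Xr i - Pr i + Qr i) - (Xr j - Pr j + Qr j)\<bar>) G"
        by (intro tendsto_intros lims)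
      moreover have "eventually (\<lambda>s. \<bar>(X i s - P i s + Q i s) - (X j s - P j s + Q j s)\<bar> \<le> 2 * e / 3) G"
        using D
      proof eventually_elim
        case (elim s)
        show ?case using X[OF elim, of i] X[OF elim, of j] i0[OF ij(1) elim] i0[OF ij(2) elim] by linarith
      qed
      ultimately have "\<bar>(Xr i - Pr i + Qr i) - (Xr j - Pr j + Qr j)\<bar> \<le> 2 * e / 3"
        by (rule tendsto_upperbound[OF _ _ G])
      then show ?thesis using \<open>0 < e\<close> by (simp add: dist_real_def)
    qed
    then show "\<exists>i0. \<forall>i\<ge>i0. \<forall>j\<ge>i0. dist (Xr i - Pr i + Qr i) (Xr j - Pr j + Qr j) < e" by blast
  qed
  then have "convergent (\<lambda>i. Xr i - Pr i + Qr i)" by (rule Cauchy_convergent)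
  from convergent_diff[OF convergent_add[OF this conv(1)] conv(2)] show ?thesis by simp
qed

lemma (in prob_space) increasing_forward_convex_sub:
  fixes v :: "nat \<Rightarrow> real \<Rightarrow> 'a \<Rightarrow> real"
  assumes vm: "\<And>n s. s \<in> dyadics K \<Longrightarrow> v n s \<in> borel_measurable M"
    and nn: "\<And>n s x. s \<in> dyadics K \<Longrightarrow> x \<in> space M \<Longrightarrow> 0 \<le> v n s x"
    and mono: "\<And>n s t x. s \<in> dyadics K \<Longrightarrow> t \<in> dyadics K \<Longrightarrow> s \<le> t \<Longrightarrow> x \<in> space M \<Longrightarrow> v n s x \<le> v n t x"
    and int: "\<And>n. integrable M (v n (real K))" and le: "\<And>n. (\<integral>x. v n (real K) x \<partial>M) \<le> c"
    and W: "\<And>i. W i \<in> wts i"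
  shows "\<exists>C. (\<forall>i. C i \<in> wts i) \<and>
    (AE x in M. \<forall>t. 0 \<le> t \<and> t < real K \<longrightarrow>
       convergent (\<lambda>i. comb (comp_wts (C i) W) (\<lambda>n. right_inf K (\<lambda>s. v n s x) t)))"
proof -
  let ?u = "\<lambda>n s x. comb (W n) (\<lambda>n. v n s x)"
  have "\<exists>C. (\<forall>i. C i \<in> wts i) \<and>
    (AE x in M. \<forall>t. 0 \<le> t \<and> t < real K \<longrightarrow> convergent (\<lambda>i. comb (C i) (\<lambda>n. right_inf K (\<lambda>s. ?u n s x) t)))"
  proof (rule increasing_forward_convex)
    show "?u n s \<in> borel_measurable M" if "s \<in> dyadics K" for n s
      by (rule comb_measurable) (rule vm[OF that])
    show "0 \<le> ?u n s x" if "s \<in> dyadics K" "x \<in> space M" for n s x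
      by (rule comb_ge[OF W]) (rule nn[OF that])
    show "?u n s x \<le> ?u n t x" if "s \<in> dyadics K" "t \<in> dyadics K" "s \<le> t" "x \<in> space M" for n s t x
      by (rule comb_mono[OF W]) (rule mono[OF that])
    show "integrable M (?u n (real K))" for n by (rule comb_integrable[OF int])
    show "(\<integral>x. ?u n (real K) x \<partial>M) \<le> c" for n
      unfolding comb_integrable(2)[OF int] by (rule comb_le[OF W le])
  qed
  then obtain C where C: "\<And>i. C i \<in> wts i" and ae: "AE x in M. \<forall>t. 0 \<le> t \<and> t < real K \<longrightarrow>
      convergent (\<lambda>i. comb (C i) (\<lambda>n. right_inf K (\<lambda>s. ?u n s x) t))" by blast
  have "AE x in M. \<forall>t. 0 \<le> t \<and> t < real K \<longrightarrow>
       convergent (\<lambda>i. comb (comp_wts (C i) W) (\<lambda>n. right_inf K (\<lambda>s. v n s x) t))"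
    using ae AE_space
  proof eventually_elim
    case (elim x)
    have "right_inf K (\<lambda>s. ?u n s x) t = comb (W n) (\<lambda>n. right_inf K (\<lambda>s. v n s x) t)" if "0 \<le> t" "t < real K" for n t
      by (rule right_inf_comb[of K _ 0, OF _ _ that W]) (use mono nn elim(2) in auto)
    then show ?case using elim(1) by (simp add: comp_wts(2)[OF C W])
  qed
  then show ?thesis using C by blast
qed

section \<open>Bounded quasimartingales\<close>

context filtered_prob_space
begin

text \<open>On the dyadics \<open>x n\<close> is a conditional expectation of \<open>U n\<close>,
  plus \<open>V n\<close>, minus \<open>W n\<close>; the last two are increasing with mean at
  \<open>K\<close> bounded in \<open>n\<close>. Weights are found successively for \<open>U\<close>,
  \<open>V\<close> and \<open>W\<close>, and right-continuity of \<open>x n\<close> then reaches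
  every \<open>t < real K\<close>.\<close>

lemma quasimartingales_forward_convex:
  fixes x :: "nat \<Rightarrow> real \<Rightarrow> 'a \<Rightarrow> real"
  assumes xm: "\<And>n t. 0 \<le> t \<Longrightarrow> x n t \<in> borel_measurable (F t)"
    and xL: "\<And>n t w. 0 \<le> t \<Longrightarrow> w \<in> space M \<Longrightarrow> \<bar>x n t w\<bar> \<le> L"
    and rc: "\<And>n t w. 0 \<le> t \<Longrightarrow> w \<in> space M \<Longrightarrow> ((\<lambda>s. x n s w) \<longlongrightarrow> x n t w) (at_right t)"
    and qm: "\<And>n. \<exists>m0. \<forall>m\<ge>m0.
       (\<Sum>k<K * 2 ^ m. \<integral>w. \<bar>cexp (dy m k) (\<lambda>w. x n (dy m (Suc k)) w - x n (dy m k) w) w\<bar> \<partial>M) \<le> c"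
  shows "\<exists>C. (\<forall>i. C i \<in> wts i) \<and>
    (AE w in M. \<forall>t. 0 \<le> t \<and> t < real K \<longrightarrow> convergent (\<lambda>i. comb (C i) (\<lambda>n. x n t w)))"
proof -
  let ?D = "dyadics K"
  have D0: "0 \<le> s" if "s \<in> ?D" for s using dyadics_range[OF that] by simp
  define Q where "Q n U \<longleftrightarrow> U \<in> borel_measurable M \<and> integrable M (\<lambda>w. (U w)\<^sup>2) \<and> (\<integral>w. (U w)\<^sup>2 \<partial>M) \<le> L\<^sup>2 + 2 * L * c \<and>
    (\<forall>m. mean_var K m (\<lambda>t w. x n t w - cexp t U w) \<le> c) \<and> (AE w in M. x n 0 w - cexp 0 U w = 0)" for n U
  have "\<exists>U. Q n U" for n
  proof -
    obtain m0 where m0: "\<And>m. m0 \<le> m \<Longrightarrow>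
       (\<Sum>k<K * 2 ^ m. \<integral>w. \<bar>cexp (dy m k) (\<lambda>w. x n (dy m (Suc k)) w - x n (dy m k) w) w\<bar> \<partial>M) \<le> c"
      using qm[of n] by blast
    show ?thesis unfolding Q_def by (rule bounded_variation_decomposition[OF xm xL m0])
  qed
  then have "\<forall>n. \<exists>U. Q n U" by blast
  from choice[OF this] obtain U where "\<And>n. Q n (U n)" by blast
  then have U: "\<And>n. U n \<in> borel_measurable M" "\<And>n. integrable M (\<lambda>w. (U n w)\<^sup>2)" "\<And>n. (\<integral>w. (U n w)\<^sup>2 \<partial>M) \<le> L\<^sup>2 + 2 * L * c"
    and Uv: "\<And>n m. mean_var K m (\<lambda>t w. x n t w - cexp t (U n) w) \<le> c" and U0: "\<And>n. AE w in M. x n 0 w - cexp 0 (U n) w = 0"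
    unfolding Q_def by blast+
  have Ui: "integrable M (U n)" for n by (rule L1_le_L2(1)[OF U(1,2)])
  have xM: "x n t \<in> borel_measurable M" if "0 \<le> t" for n t
    by (rule measurable_from_subalg[OF subF xm]) (use that in auto)
  define b where "b n t w = x n t w - cexp t (U n) w" for n t w
  have bi: "integrable M (b n t)" if "0 \<le> t" for n t
  proof -
    interpret t: sigma_finite_subalgebra M "F t" by (rule cexp_subalgebra[OF that])
    have "integrable M (x n t)" by (rule integrable_const_bound[of _ L]) (use xM xL that in auto)
    then show ?thesis unfolding b_def[abs_def] using t.real_cond_exp_int(1)[OF Ui] by simp
  qed
  let ?S = "\<lambda>n m t w. var_upto (\<lambda>s. b n s w) m t"
  have Sint: "integrable M (?S n m t)" for n m t
    unfolding var_upto_def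
    by (intro Bochner_Integration.integrable_sum integrable_abs Bochner_Integration.integrable_diff bi dy_nonneg)
  have Sle: "(\<integral>w. ?S n m (real K) w \<partial>M) \<le> c" for n m
  proof -
    have "nat \<lfloor>real K * 2 ^ m\<rfloor> = K * 2 ^ m"
      by (metis floor_of_nat nat_int of_nat_mult of_nat_numeral of_nat_power)
    then have "(\<integral>w. ?S n m (real K) w \<partial>M) = mean_var K m (b n)"
      unfolding var_upto_def mean_var_def
      by (simp, intro Bochner_Integration.integral_sum integrable_abs Bochner_Integration.integrable_diff bi dy_nonneg)
    then show ?thesis using Uv by (simp add: b_def[abs_def])
  qed
  have tvm: "(\<lambda>w. tot_var (\<lambda>s. b n s w) t) \<in> borel_measurable M" for n t
  proof -
    have [measurable]: "?S n m t \<in> borel_measurable M" for m using Sint by auto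
    show ?thesis unfolding tot_var_def by measurable
  qed
  note L1 = L1_bounded_incseq[of M "\<lambda>m. ?S n m (real K)" c for n, OF Sint var_upto_nonneg incseq_var_upto[OF of_nat_0_le_iff] Sle]
  have "AE w in M. \<forall>n. convergent (\<lambda>m. ?S n m (real K) w) \<and> b n 0 w = 0"
    unfolding AE_all_countable
  proof
    fix n
    show "AE w in M. convergent (\<lambda>m. ?S n m (real K) w) \<and> b n 0 w = 0"
      using L1(1)[of n] U0[of n] by eventually_elim (simp add: b_def)
  qed
  then obtain N where N: "N \<in> null_sets M" "{w \<in> space M. \<not> (\<forall>n. convergent (\<lambda>m. ?S n m (real K) w) \<and> b n 0 w = 0)} \<subseteq> N"
    by (auto elim!: AE_E intro: that simp: null_sets_def)
  \<comment> \<open>Off \<open>S\<close> the grid variations may diverge. There \<open>V\<close> and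
    \<open>W\<close> are set to zero, so that on the dyadics they are nonnegative and increasing for
    every \<open>w\<close> without exception.\<close>
  define S where "S = space M - N"
  have S [measurable]: "S \<in> sets M" using N(1) unfolding S_def by auto
  have SAE: "AE w in M. w \<in> S" using AE_not_in[OF N(1)] AE_space by eventually_elim (simp add: S_def)
  have SC: "convergent (\<lambda>m. ?S n m (real K) w)" "b n 0 w = 0" if "w \<in> S" for n w
    using that N(2) unfolding S_def by blast+
  define V where "V n s w = (if w \<in> S then tot_var (\<lambda>s. b n s w) s else 0)" for n s w
  define W where "W n s w = (if w \<in> S then tot_var (\<lambda>s. b n s w) s - b n s w else 0)" for n s w
  have Vm: "V n s \<in> borel_measurable M" for n s
    unfolding V_def[abs_def] using tvm S by measurable
  have Wm: "W n s \<in> borel_measurable M" if "s \<in> ?D" for n s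
  proof -
    have [measurable]: "b n s \<in> borel_measurable M" using bi[OF D0[OF that]] by auto
    show ?thesis unfolding W_def[abs_def] using tvm S by measurable
  qed
  have Vnn: "0 \<le> V n s w" if "s \<in> ?D" for n s w
    unfolding V_def using tot_var_dyadics(2)[OF SC(1) that] by simp
  have Vmono: "V n s w \<le> V n t w" if "s \<in> ?D" "t \<in> ?D" "s \<le> t" for n s t w
    unfolding V_def using tot_var_dyadics(3)[OF SC(1) that, of w n] by auto
  \<comment> \<open>As \<open>b\<close> starts at zero it is dominated by its variation; hence on
    \<open>S\<close> the process \<open>W = V - b\<close> lies between 0 and
    \<open>2 * V\<close>.\<close>
  have bV: "\<bar>b n s w\<bar> \<le> V n s w" if "s \<in> ?D" "w \<in> S" for n s w
    using tot_var_dyadics(3)[OF SC(1) zero_in_dyadics that(1) D0[OF that(1)], OF that(2), of n]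
      tot_var_dyadics(2)[OF SC(1)[OF that(2)] zero_in_dyadics, of n] SC(2)[OF that(2), of n] that(2)
    by (simp add: V_def)
  have Wnn: "0 \<le> W n s w" if "s \<in> ?D" for n s w
    using bV[OF that, of w n] by (auto simp: W_def V_def)
  have Wmono: "W n s w \<le> W n t w" if "s \<in> ?D" "t \<in> ?D" "s \<le> t" for n s t w
    unfolding W_def using tot_var_dyadics(3)[OF SC(1) that, of w n] by auto
  have VK: "AE w in M. lim (\<lambda>m. ?S n m (real K) w) = V n (real K) w" for n
    using SAE by eventually_elim (simp add: V_def tot_var_def)
  have Vi: "integrable M (V n (real K))" for n
    using L1(2)[of n] by (rule integrable_cong_AE_imp) (use VK[of n] Vm in auto)
  have Vle: "(\<integral>w. V n (real K) w \<partial>M) \<le> c" for n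
  proof -
    have "(\<integral>w. V n (real K) w \<partial>M) = (\<integral>w. lim (\<lambda>m. ?S n m (real K) w) \<partial>M)"
      by (rule integral_cong_AE) (use VK[of n] Vm L1(2)[of n] in auto)
    then show ?thesis using L1(3)[of n] by simp
  qed
  have W2V: "AE w in M. W n (real K) w \<le> 2 * V n (real K) w" for n
    using SAE
  proof eventually_elim
    case (elim w)
    then show ?case using bV[OF K_in_dyadics elim, of n] by (simp add: V_def W_def)
  qed
  have Wi: "integrable M (W n (real K))" for n
  proof (rule Bochner_Integration.integrable_bound)
    show "integrable M (\<lambda>w. 2 * V n (real K) w)" using Vi by simp
    show "AE w in M. norm (W n (real K) w) \<le> norm (2 * V n (real K) w)"
      using W2V[of n] by eventually_elim (use Wnn[OF K_in_dyadics, of n] Vnn[OF K_in_dyadics, of n] in simp)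
  qed (rule Wm[OF K_in_dyadics])
  have Wle: "(\<integral>w. W n (real K) w \<partial>M) \<le> 2 * c" for n
  proof -
    have "(\<integral>w. W n (real K) w \<partial>M) \<le> (\<integral>w. 2 * V n (real K) w \<partial>M)"
      by (rule integral_mono_AE[OF Wi _ W2V]) (use Vi in simp)
    then show ?thesis using Vle[of n] by simp
  qed
  obtain C1 g where C1: "\<And>i. C1 i \<in> wts i" and g: "g \<in> borel_measurable M" "integrable M (\<lambda>w. (g w)\<^sup>2)"
    and C1g: "\<And>i. (\<integral>w. \<bar>comb (C1 i) (\<lambda>n. U n w) - g w\<bar> \<partial>M) \<le> (1/4)^i"
    using L2_forward_convex[of U, OF U] by blast
  have gi: "integrable M g" by (rule L1_le_L2(1)[OF g])
  obtain C2 where C2: "\<And>i. C2 i \<in> wts i" and V2: "AE w in M. \<forall>t. 0 \<le> t \<and> t < real K \<longrightarrow>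
      convergent (\<lambda>i. comb (comp_wts (C2 i) C1) (\<lambda>n. right_inf K (\<lambda>s. V n s w) t))"
    using increasing_forward_convex_sub[of K V c C1, OF Vm Vnn Vmono Vi Vle C1] by blast
  define W1 where "W1 i = comp_wts (C2 i) C1" for i
  have W1: "W1 i \<in> wts i" for i unfolding W1_def by (rule comp_wts(1)[OF C2 C1])
  obtain C3 where C3: "\<And>i. C3 i \<in> wts i" and W3: "AE w in M. \<forall>t. 0 \<le> t \<and> t < real K \<longrightarrow>
      convergent (\<lambda>i. comb (comp_wts (C3 i) W1) (\<lambda>n. right_inf K (\<lambda>s. W n s w) t))"
    using increasing_forward_convex_sub[of K W "2 * c" W1, OF Wm Wnn Wmono Wi Wle W1] by blast
  define E where "E i = comp_wts (C3 i) W1" for i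
  have E: "E i \<in> wts i" for i unfolding E_def by (rule comp_wts(1)[OF C3 W1])
  \<comment> \<open>\<open>E\<close> is read in two ways: as \<open>C3\<close> after
    \<open>W1\<close> for the increasing parts, and as \<open>C\<close> after \<open>C1\<close> for
    the conditional expectations, where the uniform error bound of \<open>C1\<close> is inherited by
    convexity.\<close>
  define C where "C i = comp_wts (C3 i) C2" for i
  have C: "C i \<in> wts i" for i unfolding C_def by (rule comp_wts(1)[OF C3 C2])
  have EC: "E i = comp_wts (C i) C1" for i
    unfolding E_def C_def W1_def[abs_def] by (rule comp_wts_assoc[OF C3 C2, symmetric])
  have "AE w in M. \<forall>t. 0 \<le> t \<and> t < real K \<longrightarrow> convergent (\<lambda>i. comb (E i) (\<lambda>n. x n t w))"
    using cexp_comb_uniform[of U g C1 K, OF Ui gi C1g] V2 W3 SAE AE_space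
  proof eventually_elim
    case (elim w)
    show ?case
    proof (intro allI impI)
      fix t assume t: "0 \<le> t \<and> t < real K"
      let ?G = "at t within (?D \<inter> {t<..})"
      have G: "?G \<noteq> bot" using t by (intro right_filter_nontrivial) auto
      show "convergent (\<lambda>i. comb (E i) (\<lambda>n. x n t w))"
      proof (rule right_limits_of_decomposition[OF G])
        show "eventually (\<lambda>s. s \<in> ?D) ?G" by (auto simp: eventually_at_filter)
        show "comb (E i) (\<lambda>n. x n s w) = comb (E i) (\<lambda>n. cexp s (U n) w) + comb (E i) (\<lambda>n. V n s w) - comb (E i) (\<lambda>n. W n s w)"
          if "s \<in> ?D" for i s
          unfolding comb_add[symmetric] comb_diff[symmetric] using elim(4) by (simp add: V_def W_def b_def)
        show "((\<lambda>s. comb (E i) (\<lambda>n. x n s w)) \<longlongrightarrow> comb (E i) (\<lambda>n. x n t w)) ?G" for i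
          by (intro comb_tendsto_filter tendsto_within_subset[OF rc]) (use t elim(5) in auto)
        show "((\<lambda>s. comb (E i) (\<lambda>n. V n s w)) \<longlongrightarrow> comb (E i) (\<lambda>n. right_inf K (\<lambda>s. V n s w) t)) ?G" for i
          by (intro comb_tendsto_filter right_inf_tendsto[of _ _ 0] Vmono Vnn) (use t in auto)
        show "((\<lambda>s. comb (E i) (\<lambda>n. W n s w)) \<longlongrightarrow> comb (E i) (\<lambda>n. right_inf K (\<lambda>s. W n s w) t)) ?G" for i
          by (intro comb_tendsto_filter right_inf_tendsto[of _ _ 0] Wmono Wnn) (use t in auto)
        have "convergent (\<lambda>i. comb (W1 i) (\<lambda>n. right_inf K (\<lambda>s. V n s w) t))"
          using elim(2) t by (simp add: W1_def)
        then show "convergent (\<lambda>i. comb (E i) (\<lambda>n. right_inf K (\<lambda>s. V n s w) t))"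
          unfolding E_def comp_wts(2)[OF C3 W1] by (rule comb_convergent[of _ 0]) (rule C3)
        show "convergent (\<lambda>i. comb (E i) (\<lambda>n. right_inf K (\<lambda>s. W n s w) t))"
          using elim(3) t by (simp add: E_def)
        fix e :: real assume "0 < e"
        then obtain i0 where i0: "\<And>i s. i \<ge> i0 \<Longrightarrow> s \<in> ?D \<Longrightarrow> \<bar>comb (C1 i) (\<lambda>n. cexp s (U n) w) - cexp s g w\<bar> \<le> e"
          using elim(1) by blast
        have "\<bar>comb (E i) (\<lambda>n. cexp s (U n) w) - cexp s g w\<bar> \<le> e" if "i \<ge> i0" "s \<in> ?D" for i s
        proof -
          have "comb (E i) (\<lambda>n. cexp s (U n) w) - cexp s g w = comb (C i) (\<lambda>j. comb (C1 j) (\<lambda>n. cexp s (U n) w) - cexp s g w)"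
            unfolding EC comp_wts(2)[OF C C1] comb_diff comb_const[OF C] ..
          then show ?thesis
            using norm_comb_bound[OF C[of i], of "\<lambda>j. comb (C1 j) (\<lambda>n. cexp s (U n) w) - cexp s g w" e] i0 that by simp
        qed
        then show "\<exists>i0. \<forall>i\<ge>i0. \<forall>s\<in>?D. \<bar>comb (E i) (\<lambda>n. cexp s (U n) w) - cexp s g w\<bar> \<le> e" by blast
      qed
    qed
  qed
  then show ?thesis using E by blast
qed

end


section \<open>Stopped martingales\<close>

lemma dyadic_cell_iff:
  assumes "0 < t"
  shows "dy m k < t \<and> t \<le> dy m (Suc k) \<longleftrightarrow> nat \<lceil>t * 2 ^ m\<rceil> = Suc k"
proof -
  have "dy m k < t \<and> t \<le> dy m (Suc k) \<longleftrightarrow> real k < t * 2 ^ m \<and> t * 2 ^ m \<le> real k + 1"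
    by (simp add: dy_def field_simps)
  also have "\<dots> \<longleftrightarrow> \<lceil>t * 2 ^ m\<rceil> = int k + 1"
    by (subst ceiling_eq_iff) auto
  also have "\<dots> \<longleftrightarrow> nat \<lceil>t * 2 ^ m\<rceil> = Suc k"
    by auto
  finally show ?thesis .
qed

lemma dyadic_ceiling_tendsto:
  assumes "0 < t"
  shows "(\<lambda>m. dy m (nat \<lceil>t * 2 ^ m\<rceil>)) \<longlonglongrightarrow> t" and "t \<le> dy m (nat \<lceil>t * 2 ^ m\<rceil>)"
proof -
  have n: "real (nat \<lceil>t * 2 ^ m\<rceil>) = of_int \<lceil>t * 2 ^ m\<rceil>" for m
    using assms by (simp add: of_nat_nat)
  have lo: "t \<le> dy m (nat \<lceil>t * 2 ^ m\<rceil>)" for m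
    unfolding dy_def n using le_of_int_ceiling[of "t * 2 ^ m"] by (simp only: pos_le_divide_eq zero_less_power zero_less_numeral)
  have up: "dy m (nat \<lceil>t * 2 ^ m\<rceil>) \<le> t + (1/2) ^ m" for m
  proof -
    have "of_int \<lceil>t * 2 ^ m\<rceil> \<le> t * 2 ^ m + 1" by linarith
    then have "of_int \<lceil>t * 2 ^ m\<rceil> / 2 ^ m \<le> (t * 2 ^ m + 1) / (2 ^ m :: real)" by (rule divide_right_mono) simp
    also have "\<dots> = t + (1/2) ^ m" unfolding add_divide_distrib power_one_over by simp
    finally show ?thesis unfolding dy_def n .
  qed
  have "(\<lambda>m. t + (1/2) ^ m) \<longlonglongrightarrow> t + 0" by (rule tendsto_add[OF tendsto_const LIMSEQ_power_zero]) simp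
  then have lim: "(\<lambda>m. t + (1/2) ^ m) \<longlonglongrightarrow> t" by simp
  show "(\<lambda>m. dy m (nat \<lceil>t * 2 ^ m\<rceil>)) \<longlonglongrightarrow> t"
    by (rule tendsto_sandwich[OF always_eventually[OF allI[OF lo]] always_eventually[OF allI[OF up]] tendsto_const lim])
  show "t \<le> dy m (nat \<lceil>t * 2 ^ m\<rceil>)" by (rule lo)
qed

context filtered_prob_space
begin

text \<open>For \<open>s \<le> t\<close> the increment of \<open>x\<close> is
  \<open>X t - X s\<close> on \<open>s < T\<close>, minus \<open>X t\<close> on
  \<open>s < T \<le> t\<close>. The first part has conditional mean zero, so the drift sum is at
  most the mean of \<open>\<bar>X\<bar>\<close> at \<open>T\<close> rounded up to the grid. On fine
  grids this is controlled by the value at \<open>T\<close> itself, hence by \<open>J\<close>; the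
  added 1 absorbs what remains at a finite stage. Where \<open>T = 0\<close> the process
  \<open>x\<close> vanishes and contributes nothing.\<close>

lemma stopped_martingale_drift:
  fixes X :: "real \<Rightarrow> 'a \<Rightarrow> real" and T :: "'a \<Rightarrow> ennreal"
  assumes Xm: "\<And>t. 0 \<le> t \<Longrightarrow> X t \<in> borel_measurable (F t)"
    and Xi: "\<And>t. 0 \<le> t \<Longrightarrow> integrable M (X t)"
    and mart: "\<And>s t. 0 \<le> s \<Longrightarrow> s \<le> t \<Longrightarrow> AE w in M. cexp s (X t) w = X s w"
    and rc: "\<And>t w. 0 \<le> t \<Longrightarrow> w \<in> space M \<Longrightarrow> ((\<lambda>s. X s w) \<longlongrightarrow> X t w) (at_right t)"
    and T: "\<And>t. 0 \<le> t \<Longrightarrow> {w \<in> space M. T w \<le> ennreal t} \<in> sets (F t)"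
    and J: "integrable M J" "\<And>w. 0 \<le> J w" "(\<integral>w. J w \<partial>M) \<le> c"
    and XJ: "\<And>w. w \<in> space M \<Longrightarrow> 0 < T w \<Longrightarrow> T w < \<infinity> \<Longrightarrow> \<bar>X (enn2real (T w)) w\<bar> \<le> J w"
  defines "x \<equiv> \<lambda>t w. if ennreal t < T w then X t w else 0"
  shows "\<exists>m0. \<forall>m\<ge>m0.
    (\<Sum>k<K * 2 ^ m. \<integral>w. \<bar>cexp (dy m k) (\<lambda>w. x (dy m (Suc k)) w - x (dy m k) w) w\<bar> \<partial>M) \<le> c + 1"
proof -
  have sp: "space (F t) = space M" if "0 \<le> t" for t using subF[OF that] by (simp add: subalgebra_def)
  have XM [measurable]: "X t \<in> borel_measurable M" if "0 \<le> t" for t using Xi[OF that] by auto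
  define A where "A m k = {w \<in> space M. ennreal (dy m k) < T w \<and> T w \<le> ennreal (dy m (Suc k))}" for m k
  have gtF: "{w \<in> space M. ennreal s < T w} \<in> sets (F t)" if "0 \<le> s" "s \<le> t" for s t
  proof -
    have "{w \<in> space M. ennreal s < T w} = space (F s) - {w \<in> space M. T w \<le> ennreal s}"
      using that by (auto simp: sp not_le)
    also have "\<dots> \<in> sets (F s)" using T[OF that(1)] by auto
    finally show ?thesis using monoF[OF that] by blast
  qed
  have AF: "A m k \<in> sets (F (dy m (Suc k)))" for m k
  proof -
    have "A m k = {w \<in> space M. ennreal (dy m k) < T w} \<inter> {w \<in> space M. T w \<le> ennreal (dy m (Suc k))}"
      by (auto simp: A_def)
    then show ?thesis using gtF[of "dy m k" "dy m (Suc k)"] T[of "dy m (Suc k)"] dy_mono[of k "Suc k" m] by auto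
  qed
  have FM: "B \<in> sets M" if "B \<in> sets (F t)" "0 \<le> t" for B t using that subF by (auto simp: subalgebra_def)
  have AM [measurable]: "A m k \<in> sets M" for m k by (rule FM[OF AF]) simp
  \<comment> \<open>\<open>Z m\<close> evaluates \<open>\<bar>X\<bar>\<close> at the first grid
    point at or after \<open>T\<close>, and \<open>Y\<close> at \<open>T\<close> itself. Rounding
    upwards keeps the cells observable at their right end points and lets right-continuity identify
    the limit.\<close>
  define Z where "Z m w = (if 0 < T w \<and> T w \<le> ennreal (real K)
      then \<bar>X (dy m (nat \<lceil>enn2real (T w) * 2 ^ m\<rceil>)) w\<bar> else 0)" for m w
  define Y where "Y w = (if 0 < T w \<and> T w \<le> ennreal (real K) then \<bar>X (enn2real (T w)) w\<bar> else 0)" for w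
  have Acell: "w \<in> A m k \<and> k < K * 2 ^ m \<longleftrightarrow>
      0 < T w \<and> T w \<le> ennreal (real K) \<and> nat \<lceil>enn2real (T w) * 2 ^ m\<rceil> = Suc k" if w: "w \<in> space M" for w m k
  proof (cases "0 < T w \<and> T w < \<infinity>")
    case False
    then have "w \<notin> A m k" by (auto simp: A_def top_unique less_top[symmetric])
    moreover have "\<not> (0 < T w \<and> T w \<le> ennreal (real K))"
      using False by (auto simp: top_unique less_top[symmetric])
    ultimately show ?thesis by blast
  next
    case True
    define t where "t = enn2real (T w)"
    have Tt: "T w = ennreal t" and t0: "0 < t" using True by (auto simp: t_def ennreal_enn2real_if enn2real_positive_iff)
    have wA: "w \<in> A m k \<longleftrightarrow> nat \<lceil>t * 2 ^ m\<rceil> = Suc k"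
      unfolding dyadic_cell_iff[OF t0, symmetric] using w t0 by (auto simp: A_def Tt ennreal_less_iff)
    have "nat \<lceil>t * 2 ^ m\<rceil> \<le> K * 2 ^ m \<longleftrightarrow> t * 2 ^ m \<le> real (K * 2 ^ m)"
      by (simp add: nat_le_iff ceiling_le_iff)
    also have "\<dots> \<longleftrightarrow> t \<le> real K" by simp
    finally have le: "nat \<lceil>t * 2 ^ m\<rceil> \<le> K * 2 ^ m \<longleftrightarrow> t \<le> real K" .
    have TK: "0 < T w \<and> T w \<le> ennreal (real K) \<longleftrightarrow> t \<le> real K" using t0 by (simp add: Tt)
    show ?thesis
    proof (cases "nat \<lceil>t * 2 ^ m\<rceil> = Suc k")
      case True
      then show ?thesis using wA TK le unfolding t_def[symmetric] by (simp only: Suc_le_eq) blast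
    next
      case False
      then show ?thesis using wA by (simp add: t_def)
    qed
  qed
  have none: "w \<notin> A m k" if "w \<in> space M" "\<not> (0 < T w \<and> T w \<le> ennreal (real K))" "k < K * 2 ^ m" for w m k
    using Acell[OF that(1), of m k] that(2,3) by blast
  \<comment> \<open>The cells are open on the left and closed on the right, so exactly one of them
    contains \<open>T w\<close>.\<close>
  have some: "\<exists>k. k < K * 2 ^ m \<and> w \<in> A m k \<and> Z m w = \<bar>X (dy m (Suc k)) w\<bar> \<and> (\<forall>j<K * 2 ^ m. w \<in> A m j \<longrightarrow> j = k)"
    if w: "w \<in> space M" and Tw: "0 < T w \<and> T w \<le> ennreal (real K)" for w m
  proof -
    have "T w < \<infinity>" using Tw by (auto simp: le_less_trans)
    then have "0 < enn2real (T w)" using Tw by (simp add: enn2real_positive_iff)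
    then have "0 < nat \<lceil>enn2real (T w) * 2 ^ m\<rceil>" by simp
    then obtain k where k: "nat \<lceil>enn2real (T w) * 2 ^ m\<rceil> = Suc k" using gr0_implies_Suc by blast
    have "w \<in> A m k \<and> k < K * 2 ^ m" using Acell[OF w, of m k] Tw k by blast
    moreover have "j = k" if "j < K * 2 ^ m" "w \<in> A m j" for j
      using Acell[OF w, of m j] that k by simp
    moreover have "Z m w = \<bar>X (dy m (Suc k)) w\<bar>" using Tw by (simp add: Z_def k)
    ultimately show ?thesis by blast
  qed
  have Zsum: "Z m w = (\<Sum>k<K * 2 ^ m. indicator (A m k) w * \<bar>X (dy m (Suc k)) w\<bar>)" if w: "w \<in> space M" for m w
  proof (cases "0 < T w \<and> T w \<le> ennreal (real K)")
    case False
    have "(\<Sum>k<K * 2 ^ m. indicator (A m k) w * \<bar>X (dy m (Suc k)) w\<bar>) = 0"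
      by (rule sum.neutral) (use none[OF w False] in simp)
    then show ?thesis using False by (simp only: Z_def if_False)
  next
    case True
    from some[OF w True, of m] obtain k where k: "k < K * 2 ^ m" "w \<in> A m k" "Z m w = \<bar>X (dy m (Suc k)) w\<bar>"
      and uniq: "\<forall>j<K * 2 ^ m. w \<in> A m j \<longrightarrow> j = k" by (elim exE conjE)
    have ind: "indicator (A m j) w * \<bar>X (dy m (Suc j)) w\<bar> = (if j = k then \<bar>X (dy m (Suc k)) w\<bar> else 0)"
      if "j < K * 2 ^ m" for j
    proof (cases "j = k")
      case True
      then show ?thesis using k(2) by simp
    next
      case False
      then have "w \<notin> A m j" using uniq that by blast
      then show ?thesis using False by simp
    qed
    have "(\<Sum>j<K * 2 ^ m. indicator (A m j) w * \<bar>X (dy m (Suc j)) w\<bar>) = (\<Sum>j<K * 2 ^ m. if j = k then \<bar>X (dy m (Suc k)) w\<bar> else 0)"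
      by (intro sum.cong refl) (simp add: ind)
    then show ?thesis using k(1,3) by simp
  qed
  have AX: "integrable M (\<lambda>w. indicator (A m k) w * \<bar>X (dy m (Suc k)) w\<bar>)" for m k
    using integrable_mult_indicator[OF AM integrable_abs[OF Xi[OF dy_nonneg]]] by simp
  have Zi: "integrable M (Z m)" for m
    by (subst Bochner_Integration.integrable_cong[OF refl Zsum], assumption) (intro Bochner_Integration.integrable_sum AX)
  have Zm [measurable]: "Z m \<in> borel_measurable M" for m using Zi by auto
  have Z0: "0 \<le> Z m w" for m w by (simp add: Z_def)
  have Zlim: "(\<lambda>m. Z m w) \<longlonglongrightarrow> Y w" if w: "w \<in> space M" for w
  proof (cases "0 < T w \<and> T w \<le> ennreal (real K)")
    case False
    show ?thesis unfolding Z_def Y_def if_not_P[OF False] by (rule tendsto_const)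
  next
    case True
    define t where "t = enn2real (T w)"
    have t0: "0 < t" using True by (auto simp: t_def enn2real_positive_iff top_unique less_top[symmetric])
    \<comment> \<open>The half-line includes \<open>t\<close> itself because a dyadic
      \<open>T w\<close> is eventually its own rounding.\<close>
    have "((\<lambda>s. X s w) \<longlongrightarrow> X t w) (at t within {t..})"
      using rc[OF less_imp_le[OF t0] w] by (simp add: at_within_Ici_at_right)
    then have "(\<lambda>m. X (dy m (nat \<lceil>t * 2 ^ m\<rceil>)) w) \<longlonglongrightarrow> X t w"
      using dyadic_ceiling_tendsto[OF t0]
      by (intro continuous_within_tendsto_compose'[of t "{t..}" "\<lambda>s. X s w"]) (auto simp: continuous_within)
    from tendsto_rabs[OF this] show ?thesis unfolding Z_def Y_def if_P[OF True] t_def .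
  qed
  have Ym [measurable]: "Y \<in> borel_measurable M"
    by (rule borel_measurable_LIMSEQ_real[OF Zlim Zm])
  have Y0: "0 \<le> Y w" for w by (simp add: Y_def)
  have YJ: "Y w \<le> J w" if "w \<in> space M" for w
  proof (cases "0 < T w \<and> T w \<le> ennreal (real K)")
    case True
    then have "T w < \<infinity>" by (auto intro: le_less_trans)
    then show ?thesis unfolding Y_def if_P[OF True] using XJ[OF that] True by blast
  next
    case False
    show ?thesis unfolding Y_def if_not_P[OF False] by (rule J(2))
  qed
  have Yi: "integrable M Y"
    by (rule Bochner_Integration.integrable_bound[OF J(1) Ym]) (use YJ Y0 J(2) in auto)
  let ?XK = "\<lambda>w. \<bar>X (real K) w\<bar>"
  have XK: "integrable M ?XK" by (intro integrable_abs Xi) simp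
  have drift: "(\<Sum>k<K * 2 ^ m. \<integral>w. \<bar>cexp (dy m k) (\<lambda>w. x (dy m (Suc k)) w - x (dy m k) w) w\<bar> \<partial>M) \<le> (\<integral>w. Z m w \<partial>M)" for m
  proof -
    have one: "(\<integral>w. \<bar>cexp (dy m k) (\<lambda>w. x (dy m (Suc k)) w - x (dy m k) w) w\<bar> \<partial>M)
        \<le> (\<integral>w. indicator (A m k) w * \<bar>X (dy m (Suc k)) w\<bar> \<partial>M)" for k
    proof -
      let ?s = "dy m k" and ?t = "dy m (Suc k)"
      have st: "?s \<le> ?t" by (rule dy_mono) simp
      interpret s: sigma_finite_subalgebra M "F ?s" by (rule cexp_subalgebra) simp
      define B where "B = {w \<in> space M. ennreal ?s < T w}"
      have B: "B \<in> sets (F ?s)" unfolding B_def by (rule gtF) auto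
      have BM [measurable]: "B \<in> sets M" by (rule FM[OF B]) simp
      define f where "f w = X ?t w - X ?s w" for w
      define h where "h w = indicator (A m k) w * X ?t w" for w
      have fi: "integrable M f" unfolding f_def[abs_def] by (intro Bochner_Integration.integrable_diff Xi dy_nonneg)
      have Bf: "integrable M (\<lambda>w. indicator B w * f w)" using integrable_mult_indicator[OF BM fi] by simp
      have hi: "integrable M h" unfolding h_def[abs_def] using integrable_mult_indicator[OF AM Xi[OF dy_nonneg]] by simp
      have eq: "x ?t w - x ?s w = indicator B w * f w - h w" if "w \<in> space M" for w
      proof -
        have "ennreal ?s < T w" if "ennreal ?t < T w" using that st by (meson ennreal_leI le_less_trans)
        then show ?thesis using that by (auto simp: x_def B_def f_def h_def A_def indicator_def not_less)
      qed
      have "AE w in M. cexp ?s f w = 0"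
        unfolding f_def[abs_def]
        using s.real_cond_exp_diff[OF Xi[of ?t] Xi[of ?s]] mart[OF dy_nonneg st] mart[OF dy_nonneg order_refl, of m k]
        by auto
      moreover have "AE w in M. cexp ?s (\<lambda>w. indicator B w * f w) w = indicator B w * cexp ?s f w"
        by (rule s.real_cond_exp_mult) (use B Bf fi in auto)
      moreover have "AE w in M. cexp ?s (\<lambda>w. indicator B w * f w - h w) w = cexp ?s (\<lambda>w. indicator B w * f w) w - cexp ?s h w"
        by (rule s.real_cond_exp_diff[OF Bf hi])
      moreover have "AE w in M. cexp ?s (\<lambda>w. x ?t w - x ?s w) w = cexp ?s (\<lambda>w. indicator B w * f w - h w) w"
      proof (rule s.real_cond_exp_cong)
        show "(\<lambda>w. indicator B w * f w - h w) \<in> borel_measurable M" using Bf hi by auto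
        then show "(\<lambda>w. x ?t w - x ?s w) \<in> borel_measurable M" by (subst measurable_cong[OF eq])
      qed (use eq in auto)
      ultimately have "AE w in M. \<bar>cexp ?s (\<lambda>w. x ?t w - x ?s w) w\<bar> = \<bar>cexp ?s h w\<bar>"
        by eventually_elim simp
      then have "(\<integral>w. \<bar>cexp ?s (\<lambda>w. x ?t w - x ?s w) w\<bar> \<partial>M) = (\<integral>w. \<bar>cexp ?s h w\<bar> \<partial>M)"
        by (intro integral_cong_AE) auto
      also have "\<dots> \<le> (\<integral>w. \<bar>h w\<bar> \<partial>M)" by (rule s.real_cond_exp_L1_contraction[OF hi])
      also have "(\<lambda>w. \<bar>h w\<bar>) = (\<lambda>w. indicator (A m k) w * \<bar>X ?t w\<bar>)" by (auto simp: h_def abs_mult)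
      finally show ?thesis .
    qed
    have "(\<integral>w. Z m w \<partial>M) = (\<integral>w. (\<Sum>k<K * 2 ^ m. indicator (A m k) w * \<bar>X (dy m (Suc k)) w\<bar>) \<partial>M)"
      by (rule Bochner_Integration.integral_cong[OF refl Zsum])
    also have "\<dots> = (\<Sum>k<K * 2 ^ m. \<integral>w. indicator (A m k) w * \<bar>X (dy m (Suc k)) w\<bar> \<partial>M)"
      by (rule Bochner_Integration.integral_sum) (rule AX)
    finally show ?thesis using one by (simp add: sum_mono)
  qed
  text \<open>The variables \<open>Z m\<close> are uniformly integrable, being controlled by the terminal value \<open>X K\<close>.\<close>
  have trunc: "(\<integral>w. Z m w \<partial>M) \<le> (\<integral>w. min (Z m w) a + ?XK w * min 1 (Z m w / a) \<partial>M)" if a: "0 < a" for m a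
  proof -
    \<comment> \<open>At a grid time up to \<open>K\<close>, \<open>\<bar>X\<bar>\<close> is at most
      the conditional expectation of its terminal value, hence dominated by it in mean on every
      event known then.\<close>
    have one: "(\<integral>w\<in>B. \<bar>X (dy m (Suc k)) w\<bar> \<partial>M) \<le> (\<integral>w\<in>B. ?XK w \<partial>M)"
      if k: "k < K * 2 ^ m" and B: "B \<in> sets (F (dy m (Suc k)))" for k B
    proof -
      let ?t = "dy m (Suc k)"
      interpret t: sigma_finite_subalgebra M "F ?t" by (rule cexp_subalgebra) simp
      have BM [measurable]: "B \<in> sets M" by (rule FM[OF B]) simp
      have tK: "?t \<le> real K" using dyadics_range[OF dyadicsI[of "Suc k" K m]] k by simp
      have "(\<integral>w\<in>B. \<bar>X ?t w\<bar> \<partial>M) \<le> (\<integral>w\<in>B. cexp ?t ?XK w \<partial>M)"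
        unfolding set_lebesgue_integral_def
      proof (rule integral_mono_AE)
        show "integrable M (\<lambda>w. indicator B w *\<^sub>R \<bar>X ?t w\<bar>)" by (intro integrable_mult_indicator BM integrable_abs Xi) simp
        show "integrable M (\<lambda>w. indicator B w *\<^sub>R cexp ?t ?XK w)"
          by (intro integrable_mult_indicator BM t.real_cond_exp_int(1) XK)
        show "AE w in M. indicator B w *\<^sub>R \<bar>X ?t w\<bar> \<le> indicator B w *\<^sub>R cexp ?t ?XK w"
          using t.real_cond_exp_abs_le[OF Xi[of "real K"]] mart[OF dy_nonneg tK]
          by (auto simp: indicator_def)
      qed
      also have "\<dots> = (\<integral>w\<in>B. ?XK w \<partial>M)" by (rule t.real_cond_exp_intA[OF XK B, symmetric])
      finally show ?thesis .
    qed
    define B where "B k = {w \<in> A m k. a < \<bar>X (dy m (Suc k)) w\<bar>}" for k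
    have BF: "B k \<in> sets (F (dy m (Suc k)))" for k
    proof -
      have [measurable]: "X (dy m (Suc k)) \<in> borel_measurable (F (dy m (Suc k)))" "A m k \<in> sets (F (dy m (Suc k)))"
        using Xm AF by auto
      show ?thesis unfolding B_def by measurable
    qed
    have BM [measurable]: "B k \<in> sets M" for k by (rule FM[OF BF]) simp
    have ind: "indicator {w \<in> space M. a < Z m w} w = (\<Sum>k<K * 2 ^ m. indicator (B k) w :: real)"
      and indX: "indicator {w \<in> space M. a < Z m w} w * Z m w = (\<Sum>k<K * 2 ^ m. indicator (B k) w * \<bar>X (dy m (Suc k)) w\<bar>)"
      if w: "w \<in> space M" for w
    proof -
      have "indicator {w \<in> space M. a < Z m w} w = (\<Sum>k<K * 2 ^ m. indicator (B k) w :: real) \<and>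
        indicator {w \<in> space M. a < Z m w} w * Z m w = (\<Sum>k<K * 2 ^ m. indicator (B k) w * \<bar>X (dy m (Suc k)) w\<bar>)"
      proof (cases "0 < T w \<and> T w \<le> ennreal (real K)")
        case False
        have "w \<notin> B k" if "k < K * 2 ^ m" for k using none[OF w False that] by (simp add: B_def)
        moreover have "Z m w = 0" using False by (simp only: Z_def if_False)
        ultimately show ?thesis using a by simp
      next
        case True
        from some[OF w True, of m] obtain k where kA: "k < K * 2 ^ m" "w \<in> A m k" and Zk: "Z m w = \<bar>X (dy m (Suc k)) w\<bar>"
          and uniq: "\<forall>j<K * 2 ^ m. w \<in> A m j \<longrightarrow> j = k" by (elim exE conjE)
        have other: "indicator (B j) w = (if j = k then indicator {w \<in> space M. a < Z m w} w else 0 :: real)" if "j < K * 2 ^ m" for j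
        proof (cases "j = k")
          case True
          then show ?thesis using kA(2) w by (simp add: indicator_def B_def Zk)
        next
          case False
          then have "w \<notin> B j" using uniq that unfolding B_def by blast
          then show ?thesis using False by simp
        qed
        have "(\<Sum>j<K * 2 ^ m. indicator (B j) w * q j) = indicator {w \<in> space M. a < Z m w} w * q k" for q :: "nat \<Rightarrow> real"
        proof -
          have "(\<Sum>j<K * 2 ^ m. indicator (B j) w * q j) = (\<Sum>j<K * 2 ^ m. if j = k then indicator {w \<in> space M. a < Z m w} w * q k else 0)"
            by (intro sum.cong refl) (auto simp: other)
          then show ?thesis using kA(1) by simp
        qed
        from this[of "\<lambda>_. 1"] this[of "\<lambda>j. \<bar>X (dy m (Suc j)) w\<bar>"] show ?thesis by (simp add: Zk)
      qed
      then show "indicator {w \<in> space M. a < Z m w} w = (\<Sum>k<K * 2 ^ m. indicator (B k) w :: real)"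
        "indicator {w \<in> space M. a < Z m w} w * Z m w = (\<Sum>k<K * 2 ^ m. indicator (B k) w * \<bar>X (dy m (Suc k)) w\<bar>)" by blast+
    qed
    have BX: "integrable M (\<lambda>w. indicator (B k) w * \<bar>X (dy m (Suc k)) w\<bar>)" "integrable M (\<lambda>w. indicator (B k) w * ?XK w)" for k
      using integrable_mult_indicator[OF BM integrable_abs[OF Xi[OF dy_nonneg]]] integrable_mult_indicator[OF BM XK] by simp_all
    let ?I = "indicator {w \<in> space M. a < Z m w} :: 'a \<Rightarrow> real"
    have tail: "(\<integral>w. ?I w * Z m w \<partial>M) \<le> (\<integral>w. ?I w * ?XK w \<partial>M)"
    proof -
      have "(\<integral>w. ?I w * Z m w \<partial>M) = (\<integral>w. (\<Sum>k<K * 2 ^ m. indicator (B k) w * \<bar>X (dy m (Suc k)) w\<bar>) \<partial>M)"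
        by (rule Bochner_Integration.integral_cong[OF refl indX])
      also have "\<dots> = (\<Sum>k<K * 2 ^ m. \<integral>w. indicator (B k) w * \<bar>X (dy m (Suc k)) w\<bar> \<partial>M)"
        by (rule Bochner_Integration.integral_sum) (rule BX)
      also have "\<dots> \<le> (\<Sum>k<K * 2 ^ m. \<integral>w. indicator (B k) w * ?XK w \<partial>M)"
        using one[OF _ BF] by (intro sum_mono) (simp add: set_lebesgue_integral_def)
      also have "\<dots> = (\<integral>w. (\<Sum>k<K * 2 ^ m. indicator (B k) w * ?XK w) \<partial>M)"
        by (rule Bochner_Integration.integral_sum[symmetric]) (rule BX)
      also have "\<dots> = (\<integral>w. ?I w * ?XK w \<partial>M)"
        by (rule Bochner_Integration.integral_cong[OF refl]) (simp add: ind sum_distrib_right)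
      finally show ?thesis .
    qed
    have iZ: "integrable M (\<lambda>w. ?I w * Z m w)" "integrable M (\<lambda>w. ?I w * ?XK w)"
      using integrable_mult_indicator[OF _ Zi[of m], of "{w \<in> space M. a < Z m w}"]
        integrable_mult_indicator[OF _ XK, of "{w \<in> space M. a < Z m w}"] by simp_all
    have imin: "integrable M (\<lambda>w. min (Z m w) a)" by (intro integrable_min Zi) simp
    have iXm: "integrable M (\<lambda>w. ?XK w * min 1 (Z m w / a))"
      by (rule Bochner_Integration.integrable_bound[OF XK]) (use Z0 a in \<open>auto simp: abs_mult intro!: mult_left_le\<close>)
    have "(\<integral>w. Z m w \<partial>M) \<le> (\<integral>w. min (Z m w) a + ?I w * Z m w \<partial>M)"
      by (rule integral_mono) (use Zi imin iZ a in \<open>auto simp: indicator_def\<close>)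
    also have "\<dots> = (\<integral>w. min (Z m w) a \<partial>M) + (\<integral>w. ?I w * Z m w \<partial>M)" using imin iZ by simp
    also have "\<dots> \<le> (\<integral>w. min (Z m w) a \<partial>M) + (\<integral>w. ?I w * ?XK w \<partial>M)" using tail by simp
    also have "\<dots> = (\<integral>w. min (Z m w) a + ?I w * ?XK w \<partial>M)" using imin iZ by simp
    \<comment> \<open>The indicator of \<open>a < Z m w\<close> is at most
      \<open>min 1 (Z m w / a)\<close>; this majorant depends continuously on \<open>Z m w\<close>
      and so passes to the limit in \<open>m\<close> under the domination by
      \<open>a + ?XK w\<close>.\<close>
    also have "\<dots> \<le> (\<integral>w. min (Z m w) a + ?XK w * min 1 (Z m w / a) \<partial>M)"
      by (rule integral_mono) (use imin iZ iXm a Z0 in \<open>auto simp: indicator_def min_def divide_simps\<close>)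
    finally show ?thesis .
  qed
  \<comment> \<open>\<open>X K\<close> is integrable and \<open>Y w / real (Suc n)\<close> tends to
    0 pointwise, so there is a truncation level at which the tail term costs less than
    \<open>1/2\<close>.\<close>
  have "(\<lambda>n. \<integral>w. ?XK w * min 1 (Y w / real (Suc n)) \<partial>M) \<longlonglongrightarrow> (\<integral>w. 0 \<partial>M)"
  proof (rule integral_dominated_convergence[where w = ?XK])
    show "AE w in M. (\<lambda>n. ?XK w * min 1 (Y w / real (Suc n))) \<longlonglongrightarrow> 0"
    proof (rule AE_I2)
      fix w
      have "(\<lambda>n. Y w * inverse (real (Suc n))) \<longlonglongrightarrow> Y w * 0" by (intro tendsto_intros LIMSEQ_inverse_real_of_nat)
      then have "(\<lambda>n. ?XK w * min 1 (Y w / real (Suc n))) \<longlonglongrightarrow> ?XK w * min 1 0"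
        by (intro tendsto_intros) (simp add: divide_inverse)
      then show "(\<lambda>n. ?XK w * min 1 (Y w / real (Suc n))) \<longlonglongrightarrow> 0" by simp
    qed
    show "AE w in M. norm (?XK w * min 1 (Y w / real (Suc n))) \<le> ?XK w" for n
      using Y0 by (auto simp: abs_mult intro!: mult_left_le)
  qed (use XK in auto)
  then have "eventually (\<lambda>n. (\<integral>w. ?XK w * min 1 (Y w / real (Suc n)) \<partial>M) < 1/2) sequentially"
    by (rule order_tendstoD) simp
  then obtain n where n: "(\<integral>w. ?XK w * min 1 (Y w / real (Suc n)) \<partial>M) < 1/2"
    by (auto simp: eventually_sequentially)
  define a where "a = real (Suc n)"
  have a: "0 < a" by (simp add: a_def)
  have "(\<lambda>m. \<integral>w. min (Z m w) a + ?XK w * min 1 (Z m w / a) \<partial>M) \<longlonglongrightarrow> (\<integral>w. min (Y w) a + ?XK w * min 1 (Y w / a) \<partial>M)"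
  proof (rule integral_dominated_convergence[where w = "\<lambda>w. a + ?XK w"])
    show "AE w in M. (\<lambda>m. min (Z m w) a + ?XK w * min 1 (Z m w / a)) \<longlonglongrightarrow> min (Y w) a + ?XK w * min 1 (Y w / a)"
      by (rule AE_I2) (intro tendsto_intros Zlim, use a in auto)
    show "AE w in M. norm (min (Z m w) a + ?XK w * min 1 (Z m w / a)) \<le> a + ?XK w" for m
    proof (rule AE_I2)
      fix w
      have "0 \<le> ?XK w * min 1 (Z m w / a)" "?XK w * min 1 (Z m w / a) \<le> ?XK w" "0 \<le> min (Z m w) a" "min (Z m w) a \<le> a"
        using Z0[of m w] a by (auto intro!: mult_left_le)
      then show "norm (min (Z m w) a + ?XK w * min 1 (Z m w / a)) \<le> a + ?XK w" by simp
    qed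
  qed (use XK in auto)
  moreover have "(\<integral>w. min (Y w) a + ?XK w * min 1 (Y w / a) \<partial>M) < c + 1"
  proof -
    have i1: "integrable M (\<lambda>w. min (Y w) a)" by (intro integrable_min Yi) simp
    have i2: "integrable M (\<lambda>w. ?XK w * min 1 (Y w / a))"
      by (rule Bochner_Integration.integrable_bound[OF XK]) (use Y0 a in \<open>auto simp: abs_mult intro!: mult_left_le\<close>)
    have "(\<integral>w. min (Y w) a \<partial>M) \<le> (\<integral>w. J w \<partial>M)"
      by (rule integral_mono[OF i1 J(1)]) (use YJ in \<open>auto simp: min_le_iff_disj\<close>)
    then show ?thesis using n i1 i2 J(3) by (simp add: a_def)
  qed
  ultimately have "eventually (\<lambda>m. (\<integral>w. min (Z m w) a + ?XK w * min 1 (Z m w / a) \<partial>M) < c + 1) sequentially"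
    by (rule order_tendstoD)
  then obtain m0 where m0: "\<And>m. m \<ge> m0 \<Longrightarrow> (\<integral>w. min (Z m w) a + ?XK w * min 1 (Z m w / a) \<partial>M) < c + 1"
    by (auto simp: eventually_sequentially)
  show ?thesis
  proof (intro exI[of _ m0] allI impI)
    fix m assume "m0 \<le> m"
    from drift[of m] trunc[OF a, of m] m0[OF this] show
      "(\<Sum>k<K * 2 ^ m. \<integral>w. \<bar>cexp (dy m k) (\<lambda>w. x (dy m (Suc k)) w - x (dy m k) w) w\<bar> \<partial>M) \<le> c + 1"
      by linarith
  qed
qed

end


section \<open>Weak convergence in reflexive spaces\<close>

definition sublinear :: "('a::real_vector \<Rightarrow> real) \<Rightarrow> bool" where
  "sublinear p \<longleftrightarrow> (\<forall>x y. p (x + y) \<le> p x + p y) \<and> (\<forall>t x. 0 \<le> t \<longrightarrow> p (t *\<^sub>R x) = t * p x)"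

lemma sublinear_zero: "sublinear p \<Longrightarrow> p 0 = 0"
  unfolding sublinear_def by (metis mult_zero_left order_refl scaleR_zero_left)

lemma sublinear_minus: "sublinear p \<Longrightarrow> - p (- x) \<le> p x"
  using sublinear_zero[of p] unfolding sublinear_def by (metis add.commute add.right_inverse diff_0 diff_le_eq)

lemma sublinearI:
  assumes add: "\<And>x y. p (x + y) \<le> p x + p y" and zero: "p 0 = 0"
    and scale: "\<And>t x. 0 < t \<Longrightarrow> p (t *\<^sub>R x) \<le> t * p x"
  shows "sublinear p"
  unfolding sublinear_def
proof (intro conjI allI impI add)
  fix t x assume "0 \<le> (t::real)"
  show "p (t *\<^sub>R x) = t * p x"
  proof (cases "t = 0")
    case True
    then show ?thesis by (simp add: zero)
  next
    case False
    then have t: "0 < t" using \<open>0 \<le> t\<close> by simp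
    have "p (inverse t *\<^sub>R t *\<^sub>R x) \<le> inverse t * p (t *\<^sub>R x)" by (rule scale) (use t in simp)
    then have "t * p x \<le> p (t *\<^sub>R x)" using t by (simp add: field_simps)
    then show ?thesis using scale[OF t, of x] by simp
  qed
qed

text \<open>A minimal sublinear functional is not changed by cutting along any \<open>y\<close>; evaluating the cut at
  \<open>t = 1\<close> then makes it superadditive.\<close>

definition sublinear_cut :: "('a::real_vector \<Rightarrow> real) \<Rightarrow> 'a \<Rightarrow> 'a \<Rightarrow> real" where
  "sublinear_cut p y x = (INF t\<in>{0..}. p (x + t *\<^sub>R y) - t * p y)"

lemma sublinear_cut:
  assumes p: "sublinear p"
  shows "sublinear (sublinear_cut p y)" and "0 \<le> t \<Longrightarrow> sublinear_cut p y x \<le> p (x + t *\<^sub>R y) - t * p y"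
proof -
  have padd: "p (x + z) \<le> p x + p z" and psc: "0 \<le> t \<Longrightarrow> p (t *\<^sub>R x) = t * p x" for x z t
    using p by (auto simp: sublinear_def)
  have lb: "- p (- x) \<le> p (x + t *\<^sub>R y) - t * p y" if "0 \<le> t" for x t
    using padd[of "x + t *\<^sub>R y" "- x"] psc[OF that, of y] by simp
  have bdd: "bdd_below ((\<lambda>t. p (x + t *\<^sub>R y) - t * p y) ` {0..})" for x
    by (rule bdd_belowI[of _ "- p (- x)"]) (use lb in auto)
  show le: "sublinear_cut p y x \<le> p (x + t *\<^sub>R y) - t * p y" if "0 \<le> t" for x t
    unfolding sublinear_cut_def by (rule cINF_lower[OF bdd]) (use that in simp)
  have ge: "e \<le> sublinear_cut p y x" if "\<And>t. 0 \<le> t \<Longrightarrow> e \<le> p (x + t *\<^sub>R y) - t * p y" for e x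
    unfolding sublinear_cut_def by (rule cINF_greatest) (use that in auto)
  show "sublinear (sublinear_cut p y)"
  proof (rule sublinearI)
    fix x z
    have "sublinear_cut p y (x + z) - (p (z + s *\<^sub>R y) - s * p y) \<le> sublinear_cut p y x" if s: "0 \<le> s" for s
    proof (rule ge)
      fix t :: real assume t: "0 \<le> t"
      have "p (x + z + (t + s) *\<^sub>R y) \<le> p (x + t *\<^sub>R y) + p (z + s *\<^sub>R y)"
        using padd[of "x + t *\<^sub>R y" "z + s *\<^sub>R y"] by (simp add: algebra_simps)
      then show "sublinear_cut p y (x + z) - (p (z + s *\<^sub>R y) - s * p y) \<le> p (x + t *\<^sub>R y) - t * p y"
        using le[of "t + s" "x + z"] s t by (simp add: algebra_simps)
    qed
    then have "sublinear_cut p y (x + z) - sublinear_cut p y x \<le> sublinear_cut p y z"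
      by (intro ge) (simp add: algebra_simps)
    then show "sublinear_cut p y (x + z) \<le> sublinear_cut p y x + sublinear_cut p y z" by simp
  next
    have "0 \<le> sublinear_cut p y 0" by (rule ge) (simp add: psc)
    then show "sublinear_cut p y 0 = 0" using le[of 0 0] sublinear_zero[OF p] by simp
  next
    fix t :: real and x assume t: "0 < t"
    have "sublinear_cut p y (t *\<^sub>R x) / t \<le> sublinear_cut p y x"
    proof (rule ge)
      fix s :: real assume s: "0 \<le> s"
      have "p (t *\<^sub>R x + (t * s) *\<^sub>R y) = t * p (x + s *\<^sub>R y)"
        using psc[of t "x + s *\<^sub>R y"] t by (simp add: algebra_simps)
      then have "sublinear_cut p y (t *\<^sub>R x) \<le> t * (p (x + s *\<^sub>R y) - s * p y)"
        using le[of "t * s" "t *\<^sub>R x"] s t by (simp add: algebra_simps)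
      then show "sublinear_cut p y (t *\<^sub>R x) / t \<le> p (x + s *\<^sub>R y) - s * p y"
        using t by (simp add: pos_divide_le_eq mult.commute)
    qed
    then show "sublinear_cut p y (t *\<^sub>R x) \<le> t * sublinear_cut p y x"
      using t by (simp add: pos_divide_le_eq mult.commute)
  qed
qed

text \<open>Zorn's lemma downwards. Along a chain the pointwise infimum is finite because every
  member is at least \<open>- p (- x)\<close> at \<open>x\<close>; it is subadditive because the
  smaller of two chain members serves both summands.\<close>

lemma minimal_sublinear:
  fixes p :: "'a::real_vector \<Rightarrow> real"
  assumes p: "sublinear p"
  shows "\<exists>q. sublinear q \<and> q \<le> p \<and> (\<forall>r. sublinear r \<longrightarrow> r \<le> q \<longrightarrow> r = q)"
proof -
  let ?A = "{q. sublinear q \<and> q \<le> p}"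
  let ?P = "\<lambda>a b. b \<le> (a :: 'a \<Rightarrow> real)"
  have "\<exists>m\<in>?A. \<forall>a\<in>?A. ?P m a \<longrightarrow> a = m"
  proof (rule predicate_Zorn)
    show "partial_order_on ?A (relation_of ?P ?A)"
      by (rule partial_order_on_relation_ofI) auto
    fix C assume C: "C \<in> Chains (relation_of ?P ?A)"
    then have CA: "\<And>q. q \<in> C \<Longrightarrow> sublinear q \<and> q \<le> p" and ch: "\<And>q r. q \<in> C \<Longrightarrow> r \<in> C \<Longrightarrow> q \<le> r \<or> r \<le> q"
      unfolding Chains_def relation_of_def by auto
    show "\<exists>u\<in>?A. \<forall>a\<in>C. ?P a u"
    proof (cases "C = {}")
      case True
      then show ?thesis using p by auto
    next
      case False
      define u where "u x = (INF q\<in>C. q x)" for x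
      have lb: "- p (- x) \<le> q x" if "q \<in> C" for q x
        using sublinear_minus[of q x] CA[OF that] le_funD[of q p "- x"] by fastforce
      have bdd: "bdd_below ((\<lambda>q. q x) ` C)" for x
        by (rule bdd_belowI[of _ "- p (- x)"]) (use lb in auto)
      have le: "u x \<le> q x" if "q \<in> C" for q x
        unfolding u_def by (rule cINF_lower[OF bdd that])
      have ge: "e \<le> u x" if "\<And>q. q \<in> C \<Longrightarrow> e \<le> q x" for e x
        unfolding u_def by (rule cINF_greatest[OF False]) (use that in auto)
      have qadd: "q (x + y) \<le> q x + q y" if "q \<in> C" for q x y
        using CA[OF that] by (simp add: sublinear_def)
      have "sublinear u"
      proof (rule sublinearI)
        fix x y
        have "u (x + y) - r y \<le> u x" if r: "r \<in> C" for r
        proof (rule ge)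
          fix q assume q: "q \<in> C"
          from ch[OF q r] show "u (x + y) - r y \<le> q x"
          proof
            assume "q \<le> r"
            then have "q y \<le> r y" by (rule le_funD)
            moreover have "u (x + y) \<le> q x + q y" using le[OF q, of "x + y"] qadd[OF q, of x y] by simp
            ultimately show ?thesis by simp
          next
            assume "r \<le> q"
            then have "r x \<le> q x" by (rule le_funD)
            moreover have "u (x + y) \<le> r x + r y" using le[OF r, of "x + y"] qadd[OF r, of x y] by simp
            ultimately show ?thesis by simp
          qed
        qed
        then have "u (x + y) - u x \<le> u y" by (intro ge) (simp add: algebra_simps)
        then show "u (x + y) \<le> u x + u y" by simp
      next
        have "q 0 = 0" if "q \<in> C" for q using CA[OF that] sublinear_zero by blast
        then have "u 0 = (INF q\<in>C. 0)" unfolding u_def by (intro INF_cong refl)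
        then show "u 0 = 0" using False by simp
      next
        fix t :: real and x assume t: "0 < t"
        have "u (t *\<^sub>R x) / t \<le> u x"
        proof (rule ge)
          fix q assume q: "q \<in> C"
          have "q (t *\<^sub>R x) = t * q x" using CA[OF q] t by (auto simp: sublinear_def)
          then show "u (t *\<^sub>R x) / t \<le> q x" using le[OF q, of "t *\<^sub>R x"] t by (simp add: pos_divide_le_eq mult.commute)
        qed
        then show "u (t *\<^sub>R x) \<le> t * u x" using t by (simp add: pos_divide_le_eq mult.commute)
      qed
      moreover have "u \<le> p"
      proof (rule le_funI)
        fix x
        obtain q where "q \<in> C" using False by blast
        then show "u x \<le> p x" using le[of q x] CA[of q] le_funD[of q p x] by auto
      qed
      ultimately show ?thesis using le by (intro bexI[of _ u]) (auto intro: le_funI)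
    qed
  qed
  then show ?thesis using order_trans[of _ _ p] by blast
qed

text \<open>The minimal functional is taken below the cut of \<open>p\<close> along \<open>z\<close>
  rather than below \<open>p\<close> itself. At \<open>- z\<close> the cut is at most
  \<open>- p z\<close>, and this forces \<open>f z = p z\<close> once minimality has made
  \<open>f\<close> linear.\<close>

theorem hahn_banach_support:
  fixes p :: "'a::real_vector \<Rightarrow> real"
  assumes p: "sublinear p"
  shows "\<exists>f. linear f \<and> (\<forall>x. f x \<le> p x) \<and> f z = p z"
proof -
  note cut1 = sublinear_cut(1)[OF p, of z] and cut2 = sublinear_cut(2)[OF p, where y = z]
  obtain f where f: "sublinear f" "f \<le> sublinear_cut p z" and min: "\<And>r. sublinear r \<Longrightarrow> r \<le> f \<Longrightarrow> r = f"
    using minimal_sublinear[OF cut1] by blast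
  have fadd: "f (x + y) \<le> f x + f y" and fsc: "0 \<le> t \<Longrightarrow> f (t *\<^sub>R x) = t * f x" for x y t
    using f(1) by (auto simp: sublinear_def)
  have super: "f x + f y \<le> f (x + y)" for x y
  proof -
    have "sublinear_cut f y = f"
    proof (rule min[OF sublinear_cut(1)[OF f(1)]], rule le_funI)
      show "sublinear_cut f y x \<le> f x" for x using sublinear_cut(2)[OF f(1), of 0 y x] by simp
    qed
    then show ?thesis using sublinear_cut(2)[OF f(1), of 1 y x] by simp
  qed
  have add: "f (x + y) = f x + f y" for x y using fadd super by (rule antisym)
  have neg: "f (- x) = - f x" for x using add[of x "- x"] sublinear_zero[OF f(1)] by simp
  have "linear f"
  proof (rule linearI)
    fix t x
    show "f (t *\<^sub>R x) = t *\<^sub>R f x"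
    proof (cases "0 \<le> t")
      case False
      then have "f ((- t) *\<^sub>R x) = (- t) * f x" by (intro fsc) simp
      then show ?thesis using neg[of "t *\<^sub>R x"] by simp
    qed (simp add: fsc)
  qed (rule add)
  moreover have "f x \<le> p x" for x
    using le_funD[OF f(2), of x] cut2[of 0 x] by simp
  moreover have "p z \<le> f z"
    using le_funD[OF f(2), of "- z"] cut2[of 1 "- z"] sublinear_zero[OF p] neg[of z] by simp
  ultimately show ?thesis by (intro exI[of _ f]) (auto intro: antisym)
qed

section \<open>Continuous functionals and weak compactness\<close>

lemma blinfun_of_dominated:
  fixes z :: "'e::real_normed_vector"
  assumes "sublinear p" and le: "\<And>x. p x \<le> norm x"
  shows "\<exists>\<phi> :: 'e \<Rightarrow>\<^sub>L real. (\<forall>x. \<phi> x \<le> p x) \<and> \<phi> z = p z"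
proof -
  obtain f where f: "linear f" "\<And>x. f x \<le> p x" "f z = p z" using hahn_banach_support[OF assms(1)] by blast
  have "\<bar>f x\<bar> \<le> norm x * 1" for x
    using f(2)[of x] f(2)[of "- x"] le[of x] le[of "- x"] linear_neg[OF f(1), of x] by simp
  then have "bounded_linear f"
    using f(1) by (intro bounded_linear_intro[of f 1]) (auto simp: linear_add linear_scale)
  then show ?thesis using f by (intro exI[of _ "Blinfun f"]) (simp add: bounded_linear_Blinfun_apply)
qed

lemma norming_functional: "\<exists>\<phi> :: 'e::real_normed_vector \<Rightarrow>\<^sub>L real. (\<forall>x. \<phi> x \<le> norm x) \<and> \<phi> z = norm z"
  by (rule blinfun_of_dominated) (auto simp: sublinear_def norm_triangle_ineq)

text \<open>The distance to \<open>S\<close> is sublinear, at most the norm, zero on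
  \<open>S\<close> and positive at \<open>z\<close>; a functional dominated by it and attaining it
  at \<open>z\<close> is as required.\<close>

lemma annihilating_functional:
  fixes S :: "'e::real_normed_vector set"
  assumes S: "subspace S" "closed S" and z: "z \<notin> S"
  shows "\<exists>\<phi> :: 'e \<Rightarrow>\<^sub>L real. (\<forall>x\<in>S. \<phi> x = 0) \<and> \<phi> z \<noteq> 0"
proof -
  have ne: "S \<noteq> {}" using subspace_0[OF S(1)] by blast
  have lower: "infdist x S \<le> dist x a" if "a \<in> S" for x a by (rule infdist_le[OF that])
  have great: "e \<le> infdist x S" if "\<And>a. a \<in> S \<Longrightarrow> e \<le> dist x a" for e x
    unfolding infdist_notempty[OF ne] by (rule cINF_greatest[OF ne that])
  have sub: "sublinear (\<lambda>x. infdist x S)"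
  proof (rule sublinearI)
    fix x y :: 'e
    have "infdist (x + y) S - dist y b \<le> infdist x S" if b: "b \<in> S" for b
    proof (rule great)
      fix a assume "a \<in> S"
      then have "infdist (x + y) S \<le> dist (x + y) (a + b)" using b S(1) by (intro lower subspace_add)
      then show "infdist (x + y) S - dist y b \<le> dist x a" using dist_triangle_add[of x y a b] by simp
    qed
    then have "infdist (x + y) S - infdist x S \<le> infdist y S" by (intro great) (simp add: algebra_simps)
    then show "infdist (x + y) S \<le> infdist x S + infdist y S" by simp
  next
    show "infdist 0 S = 0" using subspace_0[OF S(1)] by simp
  next
    fix t :: real and x :: 'e assume t: "0 < t"
    have "infdist (t *\<^sub>R x) S / t \<le> infdist x S"
    proof (rule great)
      fix a assume "a \<in> S"
      then have "infdist (t *\<^sub>R x) S \<le> dist (t *\<^sub>R x) (t *\<^sub>R a)" using S(1) by (intro lower subspace_scale)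
      also have "dist (t *\<^sub>R x) (t *\<^sub>R a) = t * dist x a"
        using t by (simp add: dist_norm flip: scaleR_diff_right)
      finally show "infdist (t *\<^sub>R x) S / t \<le> dist x a" using t by (simp add: pos_divide_le_eq mult.commute)
    qed
    then show "infdist (t *\<^sub>R x) S \<le> t * infdist x S" using t by (simp add: pos_divide_le_eq mult.commute)
  qed
  have "infdist x S \<le> norm x" for x using lower[OF subspace_0[OF S(1)], of x] by simp
  from blinfun_of_dominated[OF sub this, of z] obtain \<phi> :: "'e \<Rightarrow>\<^sub>L real"
    where \<phi>: "\<And>x. \<phi> x \<le> infdist x S" "\<phi> z = infdist z S" by blast
  have "\<phi> x = 0" if "x \<in> S" for x
  proof -
    have "\<phi> x \<le> 0" "\<phi> (- x) \<le> 0"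
      using \<phi>(1)[of x] \<phi>(1)[of "- x"] that subspace_neg[OF S(1) that] by simp_all
    then show ?thesis by (simp add: blinfun.minus_right)
  qed
  moreover have "infdist z S \<noteq> 0" using in_closed_iff_infdist_zero[OF S(2) ne] z by blast
  ultimately show ?thesis unfolding \<phi>(2)[symmetric] by (intro exI[of _ \<phi>] conjI ballI)
qed

text \<open>Alaoglu's theorem in the bidual, together with reflexivity and Mazur's theorem.\<close>

lemma weak_cluster_point:
  fixes x :: "nat \<Rightarrow> 'e::real_normed_vector"
  assumes refl: "reflexive_space TYPE('e)" and S: "subspace S" "closed S"
    and xS: "\<And>i. x i \<in> S" and B: "\<And>i. norm (x i) \<le> B" and F: "F \<noteq> bot"
  shows "\<exists>y\<in>S. \<exists>G. G \<noteq> bot \<and> G \<le> F \<and> (\<forall>\<phi> :: 'e \<Rightarrow>\<^sub>L real. ((\<lambda>i. \<phi> (x i)) \<longlongrightarrow> \<phi> y) G)"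
proof -
  define h where "h i = (\<lambda>\<phi> :: 'e \<Rightarrow>\<^sub>L real. blinfun_apply \<phi> (x i))" for i
  \<comment> \<open>Tychonoff's theorem applies: all evaluations stay in this product of compact
    intervals, one for each functional.\<close>
  define U where "U = (\<Pi>\<^sub>E \<phi>\<in>UNIV. cball (0::real) (norm (\<phi> :: 'e \<Rightarrow>\<^sub>L real) * B))"
  have "compactin (product_topology (\<lambda>_. euclidean) UNIV) U"
    unfolding U_def by (subst compactin_PiE) auto
  then have U: "compact U" by (simp add: euclidean_product_topology)
  have hU: "h i \<in> U" for i
  proof -
    have "\<bar>blinfun_apply \<phi> (x i)\<bar> \<le> norm \<phi> * B" for \<phi> :: "'e \<Rightarrow>\<^sub>L real"
      using norm_blinfun[of \<phi> "x i"] mult_left_mono[OF B[of i] norm_ge_zero[of \<phi>]] by simp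
    then show ?thesis by (auto simp: U_def h_def)
  qed
  have "filtermap h F \<noteq> bot" using F by (simp add: filtermap_bot_iff)
  moreover have "eventually (\<lambda>f. f \<in> U) (filtermap h F)" using hU by (simp add: eventually_filtermap)
  ultimately obtain \<Psi> where \<Psi>: "\<Psi> \<in> U" "inf (nhds \<Psi>) (filtermap h F) \<noteq> bot"
    using U unfolding compact_filter by blast
  \<comment> \<open>The cluster point lives in the function space. Pulling its neighbourhoods back
    gives a finer filter on the indices along which every functional converges.\<close>
  define G where "G = inf F (filtercomap h (nhds \<Psi>))"
  have G: "G \<noteq> bot"
  proof
    assume "G = bot"
    then have "eventually (\<lambda>_. False) G" by simp
    then obtain P Q where P: "eventually P F" and Q: "eventually Q (filtercomap h (nhds \<Psi>))"
      and PQ: "\<And>i. P i \<Longrightarrow> Q i \<Longrightarrow> False"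
      unfolding G_def eventually_inf by blast
    from Q obtain R where R: "eventually R (nhds \<Psi>)" "\<And>i. R (h i) \<Longrightarrow> Q i"
      unfolding eventually_filtercomap by blast
    have "eventually (\<lambda>f. \<not> R f) (filtermap h F)"
      unfolding eventually_filtermap using P by eventually_elim (use PQ R(2) in blast)
    then have "eventually (\<lambda>_. False) (inf (nhds \<Psi>) (filtermap h F))"
      unfolding eventually_inf using R(1) by blast
    then show False using \<Psi>(2) by (simp add: trivial_limit_def)
  qed
  have lim: "((\<lambda>i. blinfun_apply \<phi> (x i)) \<longlongrightarrow> \<Psi> \<phi>) G" for \<phi>
  proof -
    have "filterlim h (nhds \<Psi>) G"
      unfolding G_def by (rule filterlim_mono[OF filterlim_filtercomap order_refl]) simp
    moreover have "((\<lambda>f. f \<phi>) \<longlongrightarrow> \<Psi> \<phi>) (nhds \<Psi>)"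
    proof -
      have "((\<lambda>f. f \<phi>) \<longlongrightarrow> \<Psi> \<phi>) (at \<Psi>)"
        using continuous_on_product_coordinates[of \<phi>] unfolding continuous_on_def by blast
      then show ?thesis by (rule tendsto_at_iff_tendsto_nhds[THEN iffD1])
    qed
    ultimately have "((\<lambda>i. h i \<phi>) \<longlongrightarrow> \<Psi> \<phi>) G" by (rule filterlim_compose[rotated])
    then show ?thesis by (simp add: h_def)
  qed
  \<comment> \<open>Linearity and boundedness pass to the pointwise limit, so \<open>\<Psi>\<close>
    belongs to the bidual and reflexivity represents it by a vector.\<close>
  have bl: "bounded_linear \<Psi>"
  proof (rule bounded_linear_intro[of _ B])
    show "\<Psi> (\<phi> + \<psi>) = \<Psi> \<phi> + \<Psi> \<psi>" for \<phi> \<psi>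
      by (rule tendsto_unique[OF G lim]) (use tendsto_add[OF lim[of \<phi>] lim[of \<psi>]] in \<open>simp add: blinfun.add_left\<close>)
    show "\<Psi> (r *\<^sub>R \<phi>) = r *\<^sub>R \<Psi> \<phi>" for r \<phi>
      by (rule tendsto_unique[OF G lim]) (use tendsto_scaleR[OF tendsto_const lim[of \<phi>], of r] in \<open>simp add: blinfun.scaleR_left\<close>)
    show "norm (\<Psi> \<phi>) \<le> norm \<phi> * B" for \<phi> using \<Psi>(1) by (auto simp: U_def dest: PiE_mem)
  qed
  obtain y where y: "\<And>\<phi>. blinfun_apply (Blinfun \<Psi>) \<phi> = blinfun_apply \<phi> y"
    using refl unfolding reflexive_space_def by blast
  then have \<Psi>y: "\<Psi> \<phi> = blinfun_apply \<phi> y" for \<phi> by (simp add: bounded_linear_Blinfun_apply[OF bl])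
  \<comment> \<open>A functional vanishing on \<open>S\<close> vanishes along the whole sequence,
    hence also at \<open>y\<close>.\<close>
  have "y \<in> S"
  proof (rule ccontr)
    assume "y \<notin> S"
    then obtain \<phi> :: "'e \<Rightarrow>\<^sub>L real" where \<phi>: "\<And>s. s \<in> S \<Longrightarrow> \<phi> s = 0" "\<phi> y \<noteq> 0"
      using annihilating_functional[OF S] by blast
    have "((\<lambda>i. 0) \<longlongrightarrow> blinfun_apply \<phi> y) G" using lim[of \<phi>] by (simp add: \<Psi>y \<phi>(1)[OF xS])
    then have "blinfun_apply \<phi> y = 0" by (intro tendsto_unique[OF G _ tendsto_const])
    then show False using \<phi>(2) by simp
  qed
  moreover have "G \<le> F" unfolding G_def by simp
  ultimately show ?thesis using G lim unfolding \<Psi>y by blast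
qed

text \<open>All cluster points in \<open>S\<close> take the same values on \<open>D\<close>, so
  there is only one. If some functional failed to converge to its value at \<open>y\<close>, the
  indices staying \<open>e\<close> away would carry a second cluster point; for this, cluster points
  are taken along arbitrary filters.\<close>

lemma weakly_convergent_of_separating:
  fixes x :: "nat \<Rightarrow> 'e::real_normed_vector" and D :: "('e \<Rightarrow>\<^sub>L real) set"
  assumes refl: "reflexive_space TYPE('e)" and S: "subspace S" "closed S"
    and xS: "\<And>i. x i \<in> S" and B: "\<And>i. norm (x i) \<le> B"
    and sep: "\<And>y. y \<in> S \<Longrightarrow> (\<And>\<phi>. \<phi> \<in> D \<Longrightarrow> blinfun_apply \<phi> y = 0) \<Longrightarrow> y = 0"
    and conv: "\<And>\<phi>. \<phi> \<in> D \<Longrightarrow> convergent (\<lambda>i. blinfun_apply \<phi> (x i))"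
  shows "\<exists>y\<in>S. \<forall>\<phi> :: 'e \<Rightarrow>\<^sub>L real. (\<lambda>i. blinfun_apply \<phi> (x i)) \<longlonglongrightarrow> blinfun_apply \<phi> y"
proof -
  note cluster = weak_cluster_point[of S x B, OF refl S xS B]
  obtain y G where y: "y \<in> S" "G \<noteq> bot" "G \<le> sequentially" "\<And>\<phi> :: 'e \<Rightarrow>\<^sub>L real. ((\<lambda>i. blinfun_apply \<phi> (x i)) \<longlongrightarrow> blinfun_apply \<phi> y) G"
    using cluster[OF sequentially_bot] by blast
  have lims: "(\<lambda>i. blinfun_apply \<phi> (x i)) \<longlonglongrightarrow> blinfun_apply \<phi> z"
    if \<phi>: "\<phi> \<in> D" and H: "H \<noteq> bot" "H \<le> sequentially" and lim: "((\<lambda>i. blinfun_apply \<phi> (x i)) \<longlongrightarrow> blinfun_apply \<phi> z) H" for \<phi> z H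
  proof -
    obtain l where l: "(\<lambda>i. blinfun_apply \<phi> (x i)) \<longlonglongrightarrow> l" using conv[OF \<phi>] by (auto simp: convergent_def)
    from tendsto_mono[OF H(2) this] have "l = blinfun_apply \<phi> z" by (rule tendsto_unique[OF H(1) _ lim])
    then show ?thesis using l by simp
  qed
  have "(\<lambda>i. blinfun_apply \<phi> (x i)) \<longlonglongrightarrow> blinfun_apply \<phi> y" for \<phi> :: "'e \<Rightarrow>\<^sub>L real"
  proof (rule ccontr)
    assume "\<not> ?thesis"
    then obtain e where e: "0 < e" "\<not> eventually (\<lambda>i. dist (blinfun_apply \<phi> (x i)) (blinfun_apply \<phi> y) < e) sequentially"
      unfolding tendsto_iff by blast
    \<comment> \<open>Restricts the indices to those at which \<open>\<phi>\<close> stays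
      \<open>e\<close> away from its value at \<open>y\<close>; they occur infinitely often, so the
      filter is proper.\<close>
    define H where "H = inf sequentially (principal {i. e \<le> dist (blinfun_apply \<phi> (x i)) (blinfun_apply \<phi> y)})"
    have "H \<noteq> bot"
    proof
      assume "H = bot"
      then have "eventually (\<lambda>_. False) H" by simp
      then show False using e(2) unfolding H_def eventually_inf_principal by (simp add: not_le)
    qed
    from cluster[OF this] obtain z G' where z: "z \<in> S" "G' \<noteq> bot" "G' \<le> H" "\<And>\<phi> :: 'e \<Rightarrow>\<^sub>L real. ((\<lambda>i. blinfun_apply \<phi> (x i)) \<longlongrightarrow> blinfun_apply \<phi> z) G'"
      by blast
    have G's: "G' \<le> sequentially" using z(3) unfolding H_def by simp
    have "y - z = 0"
    proof (rule sep)
      show "y - z \<in> S" by (rule subspace_diff[OF S(1) y(1) z(1)])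
      fix \<psi> assume \<psi>: "\<psi> \<in> D"
      have "blinfun_apply \<psi> y = blinfun_apply \<psi> z"
        by (rule LIMSEQ_unique[OF lims[OF \<psi> y(2,3,4)] lims[OF \<psi> z(2) G's z(4)]])
      then show "blinfun_apply \<psi> (y - z) = 0" by (simp add: blinfun.diff_right)
    qed
    moreover have "e \<le> dist (blinfun_apply \<phi> z) (blinfun_apply \<phi> y)"
    proof (rule tendsto_lowerbound[OF tendsto_dist[OF z(4) tendsto_const] _ z(2)])
      have "eventually (\<lambda>i. e \<le> dist (blinfun_apply \<phi> (x i)) (blinfun_apply \<phi> y)) H"
        unfolding H_def eventually_inf_principal by simp
      then show "eventually (\<lambda>i. e \<le> dist (blinfun_apply \<phi> (x i)) (blinfun_apply \<phi> y)) G'"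
        using z(3) by (rule filter_leD[rotated])
    qed
    ultimately show False using e(1) by simp
  qed
  then show ?thesis using y(1) by blast
qed

section \<open>Separable subspaces and measurability\<close>

lemma countable_rational_module:
  fixes S :: "'e::real_vector set"
  assumes "countable S"
  shows "\<exists>R. countable R \<and> S \<subseteq> R \<and> 0 \<in> R \<and> (\<forall>x\<in>R. \<forall>y\<in>R. x + y \<in> R) \<and> (\<forall>q\<in>\<rat>. \<forall>x\<in>R. q *\<^sub>R x \<in> R)"
proof -
  define step where "step A = A \<union> (\<lambda>(x, y). x + y) ` (A \<times> A) \<union> (\<lambda>(q, x). q *\<^sub>R x) ` (\<rat> \<times> A)" for A :: "'e set"
  define R where "R n = (step ^^ n) (insert 0 S)" for n
  have R0: "R 0 = insert 0 S" and RS: "R (Suc n) = step (R n)" for n by (auto simp: R_def)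
  have cR: "countable (R n)" for n
  proof (induction n)
    case 0 show ?case using assms by (simp add: R0)
  next
    case (Suc n)
    then show ?case unfolding RS step_def
      by (intro countable_Un countable_image countable_SIGMA countable_rat) auto
  qed
  have inc: "R n \<subseteq> R m" if "n \<le> m" for n m
    using that by (induction m rule: dec_induct) (auto simp: RS step_def)
  show ?thesis
  proof (intro exI[of _ "\<Union>n. R n"] conjI ballI)
    show "countable (\<Union>n. R n)" using cR by auto
    show "S \<subseteq> (\<Union>n. R n)" "0 \<in> (\<Union>n. R n)" using R0 by auto
    fix x y assume "x \<in> (\<Union>n. R n)" "y \<in> (\<Union>n. R n)"
    then obtain n m where "x \<in> R n" "y \<in> R m" by auto
    then have "x \<in> R (max n m)" "y \<in> R (max n m)" using inc[of n "max n m"] inc[of m "max n m"] by auto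
    then have "x + y \<in> R (Suc (max n m))" unfolding RS step_def by force
    then show "x + y \<in> (\<Union>n. R n)" by blast
  next
    fix q :: real and x assume "q \<in> \<rat>" "x \<in> (\<Union>n. R n)"
    then obtain n where "x \<in> R n" by auto
    then have "q *\<^sub>R x \<in> R (Suc n)" unfolding RS step_def using \<open>q \<in> \<rat>\<close> by force
    then show "q *\<^sub>R x \<in> (\<Union>n. R n)" by blast
  qed
qed

text \<open>Real scalars are limits of rational ones, so closure under rational combinations,
  compatible with countability, is enough for the closure to be a real subspace.\<close>

lemma subspace_closure_rational_module:
  fixes R :: "'e::real_normed_vector set"
  assumes zero: "0 \<in> R" and add: "\<And>x y. x \<in> R \<Longrightarrow> y \<in> R \<Longrightarrow> x + y \<in> R" and sc: "\<And>q x. q \<in> \<rat> \<Longrightarrow> x \<in> R \<Longrightarrow> q *\<^sub>R x \<in> R"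
  shows "subspace (closure R)"
  unfolding subspace_def
proof (intro conjI ballI allI)
  show "0 \<in> closure R" using zero closure_subset by blast
next
  fix x y assume "x \<in> closure R" "y \<in> closure R"
  then obtain f g where fg: "\<And>n. f n \<in> R" "f \<longlonglongrightarrow> x" "\<And>n. g n \<in> R" "g \<longlonglongrightarrow> y" unfolding closure_sequential by blast
  then have "(\<lambda>n. f n + g n) \<longlonglongrightarrow> x + y" by (intro tendsto_add)
  then show "x + y \<in> closure R"
    unfolding closure_sequential by (intro exI[of _ "\<lambda>n. f n + g n"] conjI allI add fg)
next
  fix c :: real and x assume "x \<in> closure R"
  then obtain f where f: "\<And>n. f n \<in> R" "f \<longlonglongrightarrow> x" unfolding closure_sequential by blast
  have "c \<in> closure \<rat>"
    unfolding closure_approachable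
  proof (intro allI impI)
    fix e :: real assume "0 < e"
    then obtain r where "r \<in> \<rat>" "c < r" "r < c + e" using Rats_dense_in_real[of c "c + e"] by auto
    then show "\<exists>y\<in>\<rat>. dist y c < e" by (intro bexI[of _ r]) (auto simp: dist_real_def)
  qed
  then obtain q where q: "\<And>n. q n \<in> \<rat>" "q \<longlonglongrightarrow> c" unfolding closure_sequential by blast
  have "(\<lambda>n. q n *\<^sub>R f n) \<longlonglongrightarrow> c *\<^sub>R x" by (intro tendsto_scaleR q f)
  then show "c *\<^sub>R x \<in> closure R"
    unfolding closure_sequential by (intro exI[of _ "\<lambda>n. q n *\<^sub>R f n"] conjI allI sc f q)
qed

text \<open>Support functionals of the norm at the points of \<open>R\<close>. At a nearby
  \<open>x\<close> the value of \<open>f r\<close> falls short of the norm by at most twice the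
  distance from \<open>r\<close> to \<open>x\<close>, whence the factor 2 in the choice of
  \<open>r\<close>.\<close>

lemma countable_norming_set:
  fixes R :: "'e::real_normed_vector set"
  assumes "countable R"
  shows "\<exists>D :: ('e \<Rightarrow>\<^sub>L real) set. countable D \<and>
    (\<forall>\<phi>\<in>D. \<forall>x. blinfun_apply \<phi> x \<le> norm x) \<and>
    (\<forall>x\<in>closure R. \<forall>e<norm x. \<exists>\<phi>\<in>D. e < blinfun_apply \<phi> x)"
proof -
  have "\<forall>r. \<exists>\<phi> :: 'e \<Rightarrow>\<^sub>L real. (\<forall>x. \<phi> x \<le> norm x) \<and> \<phi> r = norm r"
    by (intro allI norming_functional)
  from choice[OF this] obtain f :: "'e \<Rightarrow> 'e \<Rightarrow>\<^sub>L real" where f: "\<And>r x. f r x \<le> norm x" "\<And>r. f r r = norm r" by blast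
  have "\<exists>\<phi>\<in>f ` R. e < blinfun_apply \<phi> x" if x: "x \<in> closure R" and e: "e < norm x" for x e
  proof -
    have "0 < (norm x - e) / 2" using e by simp
    then obtain r where r: "r \<in> R" "dist r x < (norm x - e) / 2" using x unfolding closure_approachable by blast
    have "f r x = f r r - f r (r - x)" by (simp add: blinfun.diff_right)
    moreover have "f r (r - x) \<le> dist r x" using f(1)[of r "r - x"] by (simp add: dist_norm)
    moreover have "norm x \<le> norm r + dist r x" using norm_triangle_ineq[of r "x - r"] by (simp add: dist_norm norm_minus_commute)
    moreover have "e < v" if "v = a - b" "b \<le> d" "n \<le> m + d" "a = m" "d < (n - e) / 2" for v a b d n m :: real
      using that by (simp add: field_simps)
    ultimately have "e < f r x" using f(2)[of r] r(2) by metis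
    then show ?thesis using r(1) by blast
  qed
  then show ?thesis using f(1) assms by (intro exI[of _ "f ` R"]) auto
qed

text \<open>Pettis' argument. Norming functionals turn closed balls about points of \<open>R\<close>
  into countable intersections of half-spaces, and within \<open>closure R\<close> an open set is
  covered by countably many such balls contained in it.\<close>

lemma weakly_measurable_imp_measurable:
  fixes g :: "'a \<Rightarrow> 'e::real_normed_vector" and D :: "('e \<Rightarrow>\<^sub>L real) set"
  assumes R: "countable R" and S: "subspace (closure R)" and D: "countable D"
    and D1: "\<And>\<phi> x. \<phi> \<in> D \<Longrightarrow> blinfun_apply \<phi> x \<le> norm x"
    and D2: "\<And>x e. x \<in> closure R \<Longrightarrow> e < norm x \<Longrightarrow> \<exists>\<phi>\<in>D. e < blinfun_apply \<phi> x"
    and gR: "\<And>w. w \<in> space M \<Longrightarrow> g w \<in> closure R"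
    and gD: "\<And>\<phi>. \<phi> \<in> D \<Longrightarrow> (\<lambda>w. blinfun_apply \<phi> (g w)) \<in> borel_measurable M"
  shows "g \<in> borel_measurable M"
proof (rule borel_measurableI)
  fix U :: "'e set" assume U: "open U"
  have ball: "{w \<in> space M. norm (g w - a) \<le> q} \<in> sets M" if a: "a \<in> R" for a q
  proof -
    have "norm (g w - a) \<le> q \<longleftrightarrow> (\<forall>\<phi>\<in>D. blinfun_apply \<phi> (g w) - blinfun_apply \<phi> a \<le> q)" if w: "w \<in> space M" for w
    proof
      assume "norm (g w - a) \<le> q"
      then show "\<forall>\<phi>\<in>D. blinfun_apply \<phi> (g w) - blinfun_apply \<phi> a \<le> q"
        using D1[of _ "g w - a"] by (auto simp: blinfun.diff_right intro: order_trans)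
    next
      assume *: "\<forall>\<phi>\<in>D. blinfun_apply \<phi> (g w) - blinfun_apply \<phi> a \<le> q"
      have "g w - a \<in> closure R" using S gR[OF w] closure_subset[of R] a by (intro subspace_diff) auto
      from D2[OF this, of q] show "norm (g w - a) \<le> q"
        using * by (force simp: blinfun.diff_right not_le)
    qed
    then have "{w \<in> space M. norm (g w - a) \<le> q} = {w \<in> space M. \<forall>\<phi>\<in>D. blinfun_apply \<phi> (g w) - blinfun_apply \<phi> a \<le> q}" by blast
    also have "\<dots> \<in> sets M"
    proof (rule sets.sets_Collect_countable_All'[OF _ D])
      fix \<phi> assume "\<phi> \<in> D"
      from gD[OF this] show "{w \<in> space M. blinfun_apply \<phi> (g w) - blinfun_apply \<phi> a \<le> q} \<in> sets M" by measurable
    qed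
    finally show ?thesis .
  qed
  define I where "I = {(a, q). a \<in> R \<and> q \<in> \<rat> \<and> cball a q \<subseteq> U}"
  have I: "countable I"
    by (rule countable_subset[of _ "R \<times> \<rat>"]) (use R countable_rat in \<open>auto simp: I_def\<close>)
  have "g -` U \<inter> space M = (\<Union>(a, q)\<in>I. {w \<in> space M. norm (g w - a) \<le> q})"
  proof (intro equalityI subsetI)
    fix w assume w: "w \<in> g -` U \<inter> space M"
    then obtain e where e: "0 < e" "ball (g w) e \<subseteq> U" using U unfolding open_contains_ball by blast
    \<comment> \<open>A centre within \<open>q\<close> of \<open>g w\<close> has its ball of radius
      \<open>q\<close> inside the ball of radius \<open>2 * q < e\<close> about
      \<open>g w\<close>.\<close>
    obtain q where q: "q \<in> \<rat>" "0 < q" "q < e / 2" using Rats_dense_in_real[of 0 "e / 2"] e(1) by auto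
    obtain a where a: "a \<in> R" "dist a (g w) < q" using gR[of w] w q(2) unfolding closure_approachable by blast
    have "cball a q \<subseteq> ball (g w) e"
    proof
      fix z assume "z \<in> cball a q"
      then have "dist (g w) z < e" using a(2) q(3) dist_triangle2[of "g w" z a] by (simp add: dist_commute)
      then show "z \<in> ball (g w) e" by simp
    qed
    then have "(a, q) \<in> I" using a(1) q(1) e(2) by (auto simp: I_def)
    moreover have "norm (g w - a) \<le> q" using a(2) by (simp add: dist_norm norm_minus_commute)
    ultimately show "w \<in> (\<Union>(a, q)\<in>I. {w \<in> space M. norm (g w - a) \<le> q})" using w by blast
  next
    fix w assume "w \<in> (\<Union>(a, q)\<in>I. {w \<in> space M. norm (g w - a) \<le> q})"
    then obtain a q where "(a, q) \<in> I" "w \<in> space M" "norm (g w - a) \<le> q" by blast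
    moreover from this have "g w \<in> cball a q" by (simp add: dist_norm norm_minus_commute)
    ultimately show "w \<in> g -` U \<inter> space M" by (auto simp: I_def)
  qed
  also have "\<dots> \<in> sets M"
    by (rule sets.countable_UN'[OF I]) (use ball in \<open>auto simp: I_def\<close>)
  finally show "g -` U \<inter> space M \<in> sets M" .
qed


section \<open>Families of Banach space valued martingales\<close>

lemma blinfun_abs_le:
  fixes \<phi> :: "'e::real_normed_vector \<Rightarrow>\<^sub>L real"
  assumes "\<And>x. blinfun_apply \<phi> x \<le> norm x"
  shows "\<bar>blinfun_apply \<phi> x\<bar> \<le> norm x"
  using assms[of x] assms[of "- x"] by (simp add: blinfun.minus_right)

lemma blinfun_borel_measurable:
  fixes \<phi> :: "'e::real_normed_vector \<Rightarrow>\<^sub>L real"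
  assumes "f \<in> borel_measurable M"
  shows "(\<lambda>w. blinfun_apply \<phi> (f w)) \<in> borel_measurable M"
proof -
  have "blinfun_apply \<phi> \<in> borel_measurable borel"
    by (intro borel_measurable_continuous_onI linear_continuous_on bounded_linear_blinfun_apply bounded_linear_ident)
  then show ?thesis by (rule measurable_compose[OF assms])
qed

text \<open>A functional dominated by the norm is contractive, so it maps approximating simple
  functions to approximating simple functions.\<close>

lemma has_bochner_int_blinfun:
  fixes \<phi> :: "'e::real_normed_vector \<Rightarrow>\<^sub>L real"
  assumes \<phi>: "\<And>x. blinfun_apply \<phi> x \<le> norm x" and f: "has_bochner_int M f x"
  shows "has_bochner_integral M (\<lambda>w. blinfun_apply \<phi> (f w)) (blinfun_apply \<phi> x)"
proof -
  obtain s where fm: "f \<in> borel_measurable M" and s: "\<And>i. Bochner_Integration.simple_bochner_integrable M (s i)"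
    and fs: "(\<lambda>i. \<integral>\<^sup>+w. ennreal (norm (f w - s i w)) \<partial>M) \<longlonglongrightarrow> 0"
    and sx: "(\<lambda>i. Bochner_Integration.simple_bochner_integral M (s i)) \<longlonglongrightarrow> x"
    using f unfolding has_bochner_int_def by blast
  show ?thesis
  proof (rule has_bochner_integral.intros)
    show "(\<lambda>w. blinfun_apply \<phi> (f w)) \<in> borel_measurable M" by (rule blinfun_borel_measurable[OF fm])
    show "Bochner_Integration.simple_bochner_integrable M (\<lambda>w. blinfun_apply \<phi> (s i w))" for i
      by (rule Bochner_Integration.simple_bochner_integrable_compose2[where p = "\<lambda>x y. blinfun_apply \<phi> x" and g = "s i"])
         (use s in auto)
    show "(\<lambda>i. \<integral>\<^sup>+w. ennreal (norm (blinfun_apply \<phi> (f w) - blinfun_apply \<phi> (s i w))) \<partial>M) \<longlonglongrightarrow> 0"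
    proof (rule tendsto_sandwich[OF _ _ tendsto_const fs])
      show "\<forall>\<^sub>F i in sequentially. (\<integral>\<^sup>+w. ennreal (norm (blinfun_apply \<phi> (f w) - blinfun_apply \<phi> (s i w))) \<partial>M)
          \<le> (\<integral>\<^sup>+w. ennreal (norm (f w - s i w)) \<partial>M)"
        using blinfun_abs_le[OF \<phi>]
        by (intro always_eventually allI nn_integral_mono ennreal_leI) (simp flip: blinfun.diff_right)
    qed simp
    have "Bochner_Integration.simple_bochner_integral M (\<lambda>w. blinfun_apply \<phi> (s i w)) =
        blinfun_apply \<phi> (Bochner_Integration.simple_bochner_integral M (s i))" for i
      by (rule Bochner_Integration.simple_bochner_integral_linear[OF _ s])
         (simp add: bounded_linear.linear blinfun.bounded_linear_right)
    then show "(\<lambda>i. Bochner_Integration.simple_bochner_integral M (\<lambda>w. blinfun_apply \<phi> (s i w))) \<longlonglongrightarrow> blinfun_apply \<phi> x"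
      using blinfun.tendsto[OF tendsto_const sx, of \<phi>] by simp
  qed
qed

lemma bochner_integrable_blinfun:
  fixes \<phi> :: "'e::real_normed_vector \<Rightarrow>\<^sub>L real"
  assumes "\<And>x. blinfun_apply \<phi> x \<le> norm x" and "bochner_integrable M f"
  shows "integrable M (\<lambda>w. blinfun_apply \<phi> (f w))"
proof -
  obtain x where "has_bochner_int M f x" using assms(2) unfolding bochner_integrable_def by blast
  from has_bochner_int_blinfun[OF assms(1) this] show ?thesis by (rule integrable.intros)
qed

text \<open>The values of the approximating simple functions form a countable set, and the mean
  distance of \<open>f\<close> to it is zero.\<close>

lemma bochner_integrable_separable:
  fixes f :: "'a \<Rightarrow> 'e::real_normed_vector"
  assumes "bochner_integrable M f"
  shows "\<exists>S. countable S \<and> (AE w in M. f w \<in> closure S)"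
proof -
  obtain s where fm: "f \<in> borel_measurable M" and s: "\<And>i. Bochner_Integration.simple_bochner_integrable M (s i)"
    and fs: "(\<lambda>i. \<integral>\<^sup>+w. ennreal (norm (f w - s i w)) \<partial>M) \<longlonglongrightarrow> 0"
    using assms unfolding bochner_integrable_def has_bochner_int_def by blast
  define S where "S = insert 0 (\<Union>i. s i ` space M)"
  have "finite (s i ` space M)" for i
    using s[of i] by (auto elim!: Bochner_Integration.simple_bochner_integrable.cases dest: simple_functionD)
  then have S: "countable S" unfolding S_def by (auto intro: countable_finite)
  have ne: "S \<noteq> {}" by (simp add: S_def)
  have m: "(\<lambda>w. infdist (f w) S) \<in> borel_measurable M"
    by (rule measurable_compose[OF fm]) (intro borel_measurable_continuous_onI continuous_on_infdist continuous_on_id)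
  have "(\<integral>\<^sup>+w. ennreal (infdist (f w) S) \<partial>M) \<le> (\<integral>\<^sup>+w. ennreal (norm (f w - s i w)) \<partial>M)" for i
  proof (intro nn_integral_mono ennreal_leI)
    fix w assume "w \<in> space M"
    then have "s i w \<in> S" by (auto simp: S_def)
    from infdist_le[OF this, of "f w"] show "infdist (f w) S \<le> norm (f w - s i w)" by (simp add: dist_norm)
  qed
  then have "(\<integral>\<^sup>+w. ennreal (infdist (f w) S) \<partial>M) \<le> 0" by (intro LIMSEQ_le_const[OF fs]) auto
  then have "AE w in M. ennreal (infdist (f w) S) = 0"
    using m by (subst nn_integral_0_iff_AE[symmetric]) auto
  then have "AE w in M. f w \<in> closure S"
    by eventually_elim (use ne infdist_nonneg in \<open>auto simp: in_closure_iff_infdist_zero ennreal_eq_0_iff intro: antisym\<close>)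
  then show ?thesis using S by blast
qed

lemma is_cond_exp_blinfun:
  fixes \<phi> :: "'e::real_normed_vector \<Rightarrow>\<^sub>L real"
  assumes "sigma_finite_subalgebra M G" and \<phi>: "\<And>x. blinfun_apply \<phi> x \<le> norm x" and ce: "is_cond_exp M G f g"
  shows "AE w in M. real_cond_exp M G (\<lambda>w. blinfun_apply \<phi> (f w)) w = blinfun_apply \<phi> (g w)"
proof -
  interpret sigma_finite_subalgebra M G by fact
  show ?thesis
  proof (rule real_cond_exp_charact)
    show "integrable M (\<lambda>w. blinfun_apply \<phi> (f w))" "integrable M (\<lambda>w. blinfun_apply \<phi> (g w))"
      using ce bochner_integrable_blinfun[OF \<phi>] by (auto simp: is_cond_exp_def)
    show "(\<lambda>w. blinfun_apply \<phi> (g w)) \<in> borel_measurable G"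
      using ce by (intro blinfun_borel_measurable) (simp add: is_cond_exp_def)
    fix A assume "A \<in> sets G"
    then obtain x where "has_bochner_int M (\<lambda>\<omega>. indicator A \<omega> *\<^sub>R f \<omega>) x" "has_bochner_int M (\<lambda>\<omega>. indicator A \<omega> *\<^sub>R g \<omega>) x"
      using ce unfolding is_cond_exp_def by blast
    from this[THEN has_bochner_int_blinfun[OF \<phi>], THEN has_bochner_integral_integral_eq]
    show "(\<integral>w\<in>A. blinfun_apply \<phi> (f w) \<partial>M) = (\<integral>w\<in>A. blinfun_apply \<phi> (g w) \<partial>M)"
      by (simp add: set_lebesgue_integral_def blinfun.scaleR_right)
  qed
qed

section \<open>Hitting times and optional processes\<close>

sublocale stochastic_basis \<subseteq> filtered_prob_space \<mu> F
  by unfold_locales (use subalgebra_F F_mono in auto)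

text \<open>The infimum runs over all indices of \<open>I\<close> at once; it is infinite when none
  of the processes ever exceeds \<open>l\<close> in modulus.\<close>

definition hitting_time :: "'i set \<Rightarrow> ('i \<Rightarrow> real \<Rightarrow> 'x \<Rightarrow> real) \<Rightarrow> real \<Rightarrow> 'x \<Rightarrow> ennreal" where
  "hitting_time I Y l w = (INF t\<in>{t. 0 \<le> t \<and> (\<exists>i\<in>I. l < \<bar>Y i t w\<bar>)}. ennreal t)"

lemma below_hitting_time:
  assumes "0 \<le> t" "ennreal t < hitting_time I Y l w" "i \<in> I"
  shows "\<bar>Y i t w\<bar> \<le> l"
proof (rule ccontr)
  assume "\<not> \<bar>Y i t w\<bar> \<le> l"
  then have "hitting_time I Y l w \<le> ennreal t"
    unfolding hitting_time_def using assms by (intro INF_lower) (auto simp: not_le)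
  then show False using assms(2) by simp
qed

context stochastic_basis
begin

text \<open>Strict exceedance persists to the right, so \<open>T < s\<close> is decided at countably
  many rational times before \<open>s\<close>. The closed inequality requires an arbitrarily short
  look ahead, which right-continuity of the filtration removes.\<close>

lemma ext_stopping_time_hitting_time:
  fixes Y :: "'i \<Rightarrow> real \<Rightarrow> 'x \<Rightarrow> real"
  assumes I: "countable I" and Ym: "\<And>i t. i \<in> I \<Longrightarrow> 0 \<le> t \<Longrightarrow> Y i t \<in> borel_measurable (F t)"
    and rc: "\<And>i t w. i \<in> I \<Longrightarrow> 0 \<le> t \<Longrightarrow> w \<in> space \<mu> \<Longrightarrow> ((\<lambda>s. Y i s w) \<longlongrightarrow> Y i t w) (at_right t)"
  shows "ext_stopping_time \<mu> F (hitting_time I Y l)"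
proof -
  let ?T = "hitting_time I Y l"
  have sp: "space (F t) = space \<mu>" if "0 \<le> t" for t using subF[OF that] by (simp add: subalgebra_def)
  have less_iff: "?T w < ennreal s \<longleftrightarrow> (\<exists>q\<in>\<rat> \<inter> {0..<s}. \<exists>i\<in>I. l < \<bar>Y i q w\<bar>)" if w: "w \<in> space \<mu>" for w s
  proof
    assume "?T w < ennreal s"
    then obtain t i where t: "0 \<le> t" "i \<in> I" "l < \<bar>Y i t w\<bar>" "ennreal t < ennreal s"
      unfolding hitting_time_def INF_less_iff by blast
    then have "t < s" by (simp add: ennreal_less_iff)
    have "eventually (\<lambda>u. l < \<bar>Y i u w\<bar>) (at_right t)"
      by (rule order_tendstoD(1)[OF tendsto_rabs[OF rc[OF t(2,1) w]] t(3)])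
    then obtain b where b: "t < b" "\<And>u. t < u \<Longrightarrow> u < b \<Longrightarrow> l < \<bar>Y i u w\<bar>"
      unfolding eventually_at_right_field by blast
    obtain q where q: "q \<in> \<rat>" "t < q" "q < min b s" using Rats_dense_in_real[of t "min b s"] b(1) \<open>t < s\<close> by auto
    show "\<exists>q\<in>\<rat> \<inter> {0..<s}. \<exists>i\<in>I. l < \<bar>Y i q w\<bar>"
      using q b(2)[of q] t(1,2) by (intro bexI[of _ q] bexI[of _ i]) auto
  next
    assume "\<exists>q\<in>\<rat> \<inter> {0..<s}. \<exists>i\<in>I. l < \<bar>Y i q w\<bar>"
    then obtain q i where q: "0 \<le> q" "q < s" "i \<in> I" "l < \<bar>Y i q w\<bar>" by auto
    then have "?T w \<le> ennreal q" unfolding hitting_time_def by (intro INF_lower) auto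
    also have "\<dots> < ennreal s" using q by (simp add: ennreal_less_iff)
    finally show "?T w < ennreal s" .
  qed
  have lessF: "{w \<in> space \<mu>. ?T w < ennreal s} \<in> sets (F s)" if s: "0 \<le> s" for s
  proof -
    have "{w \<in> space \<mu>. ?T w < ennreal s} = (\<Union>q\<in>\<rat> \<inter> {0..<s}. \<Union>i\<in>I. {w \<in> space \<mu>. l < \<bar>Y i q w\<bar>})"
      using less_iff by auto
    also have "\<dots> \<in> sets (F s)"
    proof (rule sets.countable_UN'[OF countable_Int1[OF countable_rat]], rule image_subsetI)
      fix q assume q: "q \<in> \<rat> \<inter> {0..<s}"
      show "(\<Union>i\<in>I. {w \<in> space \<mu>. l < \<bar>Y i q w\<bar>}) \<in> sets (F s)"
      proof (rule sets.countable_UN'[OF I], rule image_subsetI)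
        fix i assume i: "i \<in> I"
        have [measurable]: "Y i q \<in> borel_measurable (F q)" using Ym[OF i] q by simp
        have "{w \<in> space (F q). l < \<bar>Y i q w\<bar>} \<in> sets (F q)" by measurable
        moreover have "space (F q) = space \<mu>" by (rule sp) (use q in auto)
        ultimately have "{w \<in> space \<mu>. l < \<bar>Y i q w\<bar>} \<in> sets (F q)" by (simp only:)
        then show "{w \<in> space \<mu>. l < \<bar>Y i q w\<bar>} \<in> sets (F s)"
          by (rule subsetD[OF monoF, rotated -1]) (use q in auto)
      qed
    qed
    finally show ?thesis .
  qed
  have "{w \<in> space \<mu>. ?T w \<le> ennreal t} \<in> sets (F t)" if t: "0 \<le> t" for t
    unfolding F_right_cont[OF t]
  proof (rule INT_I)
    fix s assume "s \<in> {t<..}"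
    then have ts: "t < s" by simp
    \<comment> \<open>Times decreasing to \<open>t\<close> but never beyond \<open>s\<close>, so
      that all events involved are known at time \<open>s\<close>.\<close>
    define r where "r n = t + (s - t) / real (Suc n)" for n
    have r: "t < r n" "r n \<le> s" for n using ts by (auto simp: r_def field_simps intro!: mult_right_mono)
    have "{w \<in> space \<mu>. ?T w \<le> ennreal t} = (\<Inter>n. {w \<in> space \<mu>. ?T w < ennreal (r n)})"
    proof (intro equalityI subsetI)
      fix w assume "w \<in> {w \<in> space \<mu>. ?T w \<le> ennreal t}"
      then show "w \<in> (\<Inter>n. {w \<in> space \<mu>. ?T w < ennreal (r n)})"
        using r(1) t by (auto intro: le_less_trans simp: ennreal_less_iff)
    next
      fix w assume w: "w \<in> (\<Inter>n. {w \<in> space \<mu>. ?T w < ennreal (r n)})"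
      have "(\<lambda>n. t + (s - t) * inverse (real (Suc n))) \<longlonglongrightarrow> t + (s - t) * 0"
        by (intro tendsto_intros LIMSEQ_inverse_real_of_nat)
      then have "r \<longlonglongrightarrow> t" by (simp add: r_def[abs_def] divide_inverse)
      then have "(\<lambda>n. ennreal (r n)) \<longlonglongrightarrow> ennreal t" by (rule tendsto_ennrealI)
      then have "?T w \<le> ennreal t" by (rule LIMSEQ_le_const) (use w in \<open>auto intro: less_imp_le\<close>)
      then show "w \<in> {w \<in> space \<mu>. ?T w \<le> ennreal t}" using w by auto
    qed
    also have "\<dots> \<in> sets (F s)"
    proof (rule sets.countable_INT)
      show "range (\<lambda>n. {w \<in> space \<mu>. ?T w < ennreal (r n)}) \<subseteq> sets (F s)"
      proof (rule image_subsetI)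
        fix n
        have "0 \<le> r n" using r(1)[of n] t by simp
        then show "{w \<in> space \<mu>. ?T w < ennreal (r n)} \<in> sets (F s)"
          using lessF[of "r n"] monoF[of "r n" s] r(2)[of n] by blast
      qed
    qed simp
    finally show "{w \<in> space \<mu>. ?T w \<le> ennreal t} \<in> sets (F s)" .
  qed
  then show ?thesis unfolding ext_stopping_time_def by blast
qed

lemma optional_measurable:
  fixes Y :: "real \<times> 'x \<Rightarrow> real"
  assumes "right_continuous_process \<mu> Y" "adapted_process F Y"
  shows "Y \<in> borel_measurable (optional_algebra \<mu> F)"
proof (rule measurableI)
  let ?G = "{Y -` B \<inter> ({0..} \<times> space \<mu>) | (Y :: real \<times> 'x \<Rightarrow> real) B.
        right_continuous_process \<mu> Y \<and> adapted_process F Y \<and> B \<in> sets borel}"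
  have G: "?G \<subseteq> Pow ({0..} \<times> space \<mu>)" by auto
  fix A :: "real set" assume "A \<in> sets borel"
  then have "Y -` A \<inter> ({0..} \<times> space \<mu>) \<in> ?G" using assms by blast
  then show "Y -` A \<inter> space (optional_algebra \<mu> F) \<in> sets (optional_algebra \<mu> F)"
    unfolding optional_algebra_def space_measure_of[OF G] sets_measure_of[OF G] by (rule sigma_sets.Basic)
qed simp

lemma null_set_in_filtration: "A \<in> null_sets \<mu> \<Longrightarrow> 0 \<le> t \<Longrightarrow> A \<in> sets (F t)"
  using F_zero monoF[of 0 t] by (auto intro: sigma_sets.Basic)

end

section \<open>Scalar projections of convex combinations\<close>

locale martingale_family = stochastic_basis \<mu> F for \<mu> :: "'x measure" and F :: "real \<Rightarrow> 'x measure" +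
  fixes M :: "nat \<Rightarrow> real \<times> 'x \<Rightarrow> 'e::banach"
  assumes mart: "\<And>n. cadlag_martingale \<mu> F (M n)"
begin

definition proj :: "('e \<Rightarrow>\<^sub>L real) \<Rightarrow> (nat \<Rightarrow> real) \<Rightarrow> real \<Rightarrow> 'x \<Rightarrow> real" where
  "proj \<phi> w t \<omega> = comb w (\<lambda>m. blinfun_apply \<phi> (M m (t, \<omega>)))"

lemma right_continuous_M: "0 \<le> t \<Longrightarrow> \<omega> \<in> space \<mu> \<Longrightarrow> ((\<lambda>s. M n (s, \<omega>)) \<longlongrightarrow> M n (t, \<omega>)) (at_right t)"
  using mart[of n] by (simp add: cadlag_martingale_def cadlag_process_def right_continuous_process_def)

lemma left_limit_M:
  assumes "0 < t" "\<omega> \<in> space \<mu>"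
  shows "((\<lambda>s. M n (s, \<omega>)) \<longlongrightarrow> left_limit (M n) t \<omega>) (at_left t)"
proof -
  have "cadlag_process \<mu> (M n)" using mart[of n] by (simp add: cadlag_martingale_def)
  then obtain l where l: "((\<lambda>s. M n (s, \<omega>)) \<longlongrightarrow> l) (at_left t)"
    using assms unfolding cadlag_process_def by blast
  then have "Lim (at_left t) (\<lambda>s. M n (s, \<omega>)) = l" by (intro tendsto_Lim) auto
  then show ?thesis using l assms(1) by (simp add: left_limit_def)
qed

lemma proj_measurable: "0 \<le> t \<Longrightarrow> proj \<phi> w t \<in> borel_measurable (F t)"
  unfolding proj_def[abs_def] using mart
  by (intro comb_measurable blinfun_borel_measurable) (simp add: cadlag_martingale_def adapted_process_def)

lemma proj_right_continuous: "0 \<le> t \<Longrightarrow> \<omega> \<in> space \<mu> \<Longrightarrow> ((\<lambda>s. proj \<phi> w s \<omega>) \<longlongrightarrow> proj \<phi> w t \<omega>) (at_right t)"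
  unfolding proj_def by (intro comb_tendsto_filter blinfun.tendsto tendsto_const right_continuous_M)

context
  fixes \<phi> :: "'e \<Rightarrow>\<^sub>L real"
  assumes \<phi>: "\<And>x. blinfun_apply \<phi> x \<le> norm x"
begin

lemma proj_integrable: "0 \<le> t \<Longrightarrow> integrable \<mu> (proj \<phi> w t)"
  unfolding proj_def[abs_def] using mart
  by (intro comb_integrable(1) bochner_integrable_blinfun[OF \<phi>]) (simp add: cadlag_martingale_def)

lemma proj_martingale:
  assumes "0 \<le> s" "s \<le> t"
  shows "AE \<omega> in \<mu>. cexp s (proj \<phi> w t) \<omega> = proj \<phi> w s \<omega>"
proof -
  interpret s: sigma_finite_subalgebra \<mu> "F s" by (rule cexp_subalgebra[OF assms(1)])
  have "AE \<omega> in \<mu>. cexp s (\<lambda>\<omega>. blinfun_apply \<phi> (M n (t, \<omega>))) \<omega> = blinfun_apply \<phi> (M n (s, \<omega>))" for n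
    using mart[of n] assms
    by (intro is_cond_exp_blinfun[OF s.sigma_finite_subalgebra_axioms \<phi>]) (simp add: cadlag_martingale_def)
  then have "AE \<omega> in \<mu>. \<forall>n. cexp s (\<lambda>\<omega>. blinfun_apply \<phi> (M n (t, \<omega>))) \<omega> = blinfun_apply \<phi> (M n (s, \<omega>))"
    unfolding AE_all_countable by blast
  moreover have "integrable \<mu> (\<lambda>\<omega>. blinfun_apply \<phi> (M n (t, \<omega>)))" for n
    using mart[of n] assms by (intro bochner_integrable_blinfun[OF \<phi>]) (simp add: cadlag_martingale_def)
  from s.real_cond_exp_comb[of "\<lambda>n \<omega>. blinfun_apply \<phi> (M n (t, \<omega>))" w, OF this]
  have "AE \<omega> in \<mu>. cexp s (proj \<phi> w t) \<omega> = comb w (\<lambda>n. cexp s (\<lambda>\<omega>. blinfun_apply \<phi> (M n (t, \<omega>))) \<omega>)"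
    unfolding proj_def[abs_def] .
  ultimately show ?thesis by eventually_elim (simp add: proj_def)
qed

text \<open>Before \<open>T\<close> the process is bounded by \<open>l\<close>, hence so is its left
  limit at \<open>T\<close>; the remainder is the jump, which the functional does not
  enlarge.\<close>

lemma proj_at_stopping_time:
  assumes w: "w \<in> wts i" and \<omega>: "\<omega> \<in> space \<mu>" and T: "0 < T \<omega>" "T \<omega> < \<infinity>"
    and below: "\<And>t. 0 \<le> t \<Longrightarrow> ennreal t < T \<omega> \<Longrightarrow> \<bar>proj \<phi> w t \<omega>\<bar> \<le> l"
  shows "\<bar>proj \<phi> w (enn2real (T \<omega>)) \<omega>\<bar> \<le> l + comb w (\<lambda>m. norm (jump_at (M m) T \<omega>))"
proof -
  define t where "t = enn2real (T \<omega>)"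
  have t: "0 < t" "T \<omega> = ennreal t" using T by (auto simp: t_def enn2real_positive_iff)
  let ?l = "comb w (\<lambda>m. blinfun_apply \<phi> (left_limit (M m) t \<omega>))"
  have "((\<lambda>s. proj \<phi> w s \<omega>) \<longlongrightarrow> ?l) (at_left t)"
    unfolding proj_def by (intro comb_tendsto_filter blinfun.tendsto tendsto_const left_limit_M t \<omega>)
  moreover have "eventually (\<lambda>s. \<bar>proj \<phi> w s \<omega>\<bar> \<le> l) (at_left t)"
    using eventually_at_left_real[OF t(1)]
    by eventually_elim (use below t in \<open>auto simp: ennreal_less_iff\<close>)
  ultimately have 1: "\<bar>?l\<bar> \<le> l"
    by (intro tendsto_upperbound[OF tendsto_rabs]) auto
  have "blinfun_apply \<phi> (M m (t, \<omega>)) - blinfun_apply \<phi> (left_limit (M m) t \<omega>) = blinfun_apply \<phi> (jump_at (M m) T \<omega>)" for m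
    using T(2) by (auto simp: jump_at_def t_def blinfun.diff_right)
  then have "proj \<phi> w t \<omega> - ?l = comb w (\<lambda>m. blinfun_apply \<phi> (jump_at (M m) T \<omega>))"
    unfolding proj_def comb_diff[symmetric] by simp
  moreover have "\<bar>comb w (\<lambda>m. blinfun_apply \<phi> (jump_at (M m) T \<omega>))\<bar> \<le> comb w (\<lambda>m. \<bar>blinfun_apply \<phi> (jump_at (M m) T \<omega>)\<bar>)"
    using norm_comb_le[OF w, of "\<lambda>m. blinfun_apply \<phi> (jump_at (M m) T \<omega>)"] by simp
  moreover have "\<dots> \<le> comb w (\<lambda>m. norm (jump_at (M m) T \<omega>))"
    by (rule comb_mono[OF w]) (rule blinfun_abs_le[OF \<phi>])
  ultimately show ?thesis using 1 unfolding t_def[symmetric] by linarith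
qed

text \<open>The scalar theorem is fed with combinations by \<open>W\<close> of combinations by
  \<open>V\<close>. The bound \<open>l\<close> before \<open>T\<close> and the mean bound
  \<open>c\<close> on the jumps are convex conditions and pass to them, so the drift bound
  \<open>l + c + 1\<close> is the same for all \<open>n\<close>.\<close>

lemma stopped_forward_convex:
  assumes T: "ext_stopping_time \<mu> F T"
    and Ji: "\<And>m. integrable \<mu> (\<lambda>\<omega>. norm (jump_at (M m) T \<omega>))"
    and Jc: "\<And>m. (\<integral>\<omega>. norm (jump_at (M m) T \<omega>) \<partial>\<mu>) \<le> c"
    and V: "\<And>n. V n \<in> wts n" and W: "\<And>n. W n \<in> wts n" and l: "0 \<le> l"
    and below: "\<And>n t \<omega>. 0 \<le> t \<Longrightarrow> ennreal t < T \<omega> \<Longrightarrow> \<bar>proj \<phi> (V n) t \<omega>\<bar> \<le> l"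
  shows "\<exists>C. (\<forall>i. C i \<in> wts i) \<and>
    (AE \<omega> in \<mu>. \<forall>t. 0 \<le> t \<and> t < real K \<and> ennreal t < T \<omega> \<longrightarrow>
       convergent (\<lambda>i. comb (comp_wts (C i) W) (\<lambda>n. proj \<phi> (V n) t \<omega>)))"
proof -
  define v where "v n = comp_wts (W n) V" for n
  have v: "v n \<in> wts n" for n unfolding v_def by (rule comp_wts(1)[OF W V])
  have proj_v: "proj \<phi> (v n) t \<omega> = comb (W n) (\<lambda>k. proj \<phi> (V k) t \<omega>)" for n t \<omega>
    unfolding v_def proj_def by (rule comp_wts(2)[OF W V])
  have below_v: "\<bar>proj \<phi> (v n) t \<omega>\<bar> \<le> l" if "0 \<le> t" "ennreal t < T \<omega>" for n t \<omega>
    unfolding proj_v using norm_comb_bound[OF W[of n], of "\<lambda>k. proj \<phi> (V k) t \<omega>" l] below[OF that] by simp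
  define x where "x n t \<omega> = (if ennreal t < T \<omega> then proj \<phi> (v n) t \<omega> else 0)" for n t \<omega>
  have sp: "space (F t) = space \<mu>" if "0 \<le> t" for t using subF[OF that] by (simp add: subalgebra_def)
  have TF: "{\<omega> \<in> space \<mu>. T \<omega> \<le> ennreal t} \<in> sets (F t)" if "0 \<le> t" for t
    using T that unfolding ext_stopping_time_def by blast
  have "\<exists>C. (\<forall>i. C i \<in> wts i) \<and>
    (AE \<omega> in \<mu>. \<forall>t. 0 \<le> t \<and> t < real K \<longrightarrow> convergent (\<lambda>i. comb (C i) (\<lambda>n. x n t \<omega>)))"
  proof (rule quasimartingales_forward_convex)
    show "x n t \<in> borel_measurable (F t)" if t: "0 \<le> t" for n t
      unfolding x_def[abs_def]
    proof (rule measurable_If)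
      have "{\<omega> \<in> space (F t). ennreal t < T \<omega>} = space (F t) - {\<omega> \<in> space \<mu>. T \<omega> \<le> ennreal t}"
        using sp[OF t] by auto
      then show "{\<omega> \<in> space (F t). ennreal t < T \<omega>} \<in> sets (F t)" using TF[OF t] by simp
    qed (use proj_measurable[OF t] in auto)
    show "\<bar>x n t \<omega>\<bar> \<le> l" if "0 \<le> t" for n t \<omega>
      using below_v[OF that] l by (simp add: x_def)
    show "((\<lambda>s. x n s \<omega>) \<longlongrightarrow> x n t \<omega>) (at_right t)" if t: "0 \<le> t" and \<omega>: "\<omega> \<in> space \<mu>" for n t \<omega>
    proof (cases "ennreal t < T \<omega>")
      case True
      have "eventually (\<lambda>s. ennreal s < T \<omega>) (at_right t)"
        by (rule order_tendstoD(2)[OF tendsto_ennrealI[OF tendsto_ident_at] True])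
      then have "eventually (\<lambda>s. proj \<phi> (v n) s \<omega> = x n s \<omega>) (at_right t)"
        by eventually_elim (simp add: x_def)
      then have "((\<lambda>s. x n s \<omega>) \<longlongrightarrow> proj \<phi> (v n) t \<omega>) (at_right t)"
        by (rule Lim_transform_eventually[OF proj_right_continuous[OF t \<omega>]])
      then show ?thesis using True by (simp add: x_def)
    next
      case False
      have "eventually (\<lambda>s. s \<in> {t<..}) (at_right t)" by (auto simp: eventually_at_filter)
      then have "eventually (\<lambda>s. 0 = x n s \<omega>) (at_right t)"
      proof eventually_elim
        case (elim s)
        then have "ennreal t \<le> ennreal s" by (intro ennreal_leI) auto
        then show ?case using False by (auto simp: x_def)
      qed
      from Lim_transform_eventually[OF tendsto_const this] show ?thesis using False by (simp add: x_def)
    qed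
    fix n
    let ?J = "\<lambda>\<omega>. l + comb (v n) (\<lambda>m. norm (jump_at (M m) T \<omega>))"
    have Jnn: "0 \<le> comb (v n) (\<lambda>m. norm (jump_at (M m) T \<omega>))" for \<omega>
      by (rule comb_ge[OF v]) simp
    have cJ: "integrable \<mu> (\<lambda>\<omega>. comb (v n) (\<lambda>m. norm (jump_at (M m) T \<omega>)))" by (rule comb_integrable(1)[OF Ji])
    have J: "integrable \<mu> ?J" using cJ by simp
    have "comb (v n) (\<lambda>m. \<integral>\<omega>. norm (jump_at (M m) T \<omega>) \<partial>\<mu>) \<le> c" by (rule comb_le[OF v Jc])
    then have Jle: "(\<integral>\<omega>. ?J \<omega> \<partial>\<mu>) \<le> l + c"
      using cJ by (simp add: comb_integrable(2)[OF Ji] prob_space)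
    show "\<exists>m0. \<forall>m\<ge>m0. (\<Sum>k<K * 2 ^ m. \<integral>\<omega>. \<bar>cexp (dy m k) (\<lambda>\<omega>. x n (dy m (Suc k)) \<omega> - x n (dy m k) \<omega>) \<omega>\<bar> \<partial>\<mu>) \<le> (l + c) + 1"
      unfolding x_def
    proof (rule stopped_martingale_drift[where X = "proj \<phi> (v n)" and J = ?J])
      show "\<bar>proj \<phi> (v n) (enn2real (T \<omega>)) \<omega>\<bar> \<le> ?J \<omega>" if "\<omega> \<in> space \<mu>" "0 < T \<omega>" "T \<omega> < \<infinity>" for \<omega>
        by (rule proj_at_stopping_time[where i = n]) (use v that below_v in auto)
      show "0 \<le> ?J \<omega>" for \<omega> using l Jnn[of \<omega>] by simp
    qed (fact proj_measurable proj_integrable proj_martingale proj_right_continuous TF J Jle)+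
  qed
  then obtain C where C: "\<And>i. C i \<in> wts i"
    and ae: "AE \<omega> in \<mu>. \<forall>t. 0 \<le> t \<and> t < real K \<longrightarrow> convergent (\<lambda>i. comb (C i) (\<lambda>n. x n t \<omega>))" by blast
  have "AE \<omega> in \<mu>. \<forall>t. 0 \<le> t \<and> t < real K \<and> ennreal t < T \<omega> \<longrightarrow>
       convergent (\<lambda>i. comb (comp_wts (C i) W) (\<lambda>n. proj \<phi> (V n) t \<omega>))"
    using ae
  proof eventually_elim
    case (elim \<omega>)
    show ?case
    proof (intro allI impI)
      fix t assume t: "0 \<le> t \<and> t < real K \<and> ennreal t < T \<omega>"
      then have "convergent (\<lambda>i. comb (C i) (\<lambda>n. x n t \<omega>))" using elim by blast
      moreover have "(\<lambda>n. x n t \<omega>) = (\<lambda>n. comb (W n) (\<lambda>k. proj \<phi> (V k) t \<omega>))"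
        using t by (simp add: x_def proj_v)
      ultimately show "convergent (\<lambda>i. comb (comp_wts (C i) W) (\<lambda>n. proj \<phi> (V n) t \<omega>))"
        by (simp add: comp_wts(2)[OF C W])
    qed
  qed
  then show ?thesis using C by blast
qed

end

end

lemma norm_le_total_max:
  assumes "0 \<le> t" "total_max Z \<omega> < \<infinity>"
  shows "norm (Z (t, \<omega>)) \<le> enn2real (total_max Z \<omega>)"
proof -
  have "ennreal (norm (Z (t, \<omega>))) \<le> running_max Z (t + 1) \<omega>"
    unfolding running_max_def by (rule SUP_upper2[of t]) (use assms in auto)
  also have "\<dots> \<le> total_max Z \<omega>"
    unfolding total_max_def by (rule SUP_upper2[of "t + 1"]) (use assms in auto)
  finally have "enn2real (ennreal (norm (Z (t, \<omega>)))) \<le> enn2real (total_max Z \<omega>)"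
    using assms(2) by (intro enn2real_mono) auto
  then show ?thesis by simp
qed

text \<open>Each single random variable is almost surely separably valued, but off a null set
  depending on the time. Rational times are treated simultaneously, and right-continuity extends the
  inclusion to all times because \<open>closure R\<close> is closed.\<close>

lemma (in martingale_family) AE_separable_range:
  "\<exists>R. countable R \<and> subspace (closure R) \<and> (AE \<omega> in \<mu>. \<forall>n t. 0 \<le> t \<longrightarrow> M n (t, \<omega>) \<in> closure R)"
proof -
  have "\<forall>p :: nat \<times> real. \<exists>S. countable S \<and> (0 \<le> snd p \<longrightarrow> (AE \<omega> in \<mu>. M (fst p) (snd p, \<omega>) \<in> closure S))"
  proof
    fix p :: "nat \<times> real"
    show "\<exists>S. countable S \<and> (0 \<le> snd p \<longrightarrow> (AE \<omega> in \<mu>. M (fst p) (snd p, \<omega>) \<in> closure S))"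
    proof (cases "0 \<le> snd p")
      case True
      then have "bochner_integrable \<mu> (\<lambda>\<omega>. M (fst p) (snd p, \<omega>))"
        using mart[of "fst p"] by (simp add: cadlag_martingale_def)
      from bochner_integrable_separable[OF this] show ?thesis by blast
    next
      case False
      then show ?thesis by (intro exI[of _ "{}"]) simp
    qed
  qed
  from choice[OF this] obtain S where S':
    "\<forall>p. countable (S p) \<and> (0 \<le> snd p \<longrightarrow> (AE \<omega> in \<mu>. M (fst p) (snd p, \<omega>) \<in> closure (S p)))" ..
  have S: "countable (S p)" for p using S' by (rule allE[of _ p]) (rule conjunct1)
  have Sae: "AE \<omega> in \<mu>. M n (t, \<omega>) \<in> closure (S (n, t))" if "0 \<le> t" for n t
    using S'[THEN spec, of "(n, t)"] that by simp
  let ?Q = "\<rat> \<inter> {0..} :: real set"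
  have Q: "countable ?Q" by (rule countable_Int1[OF countable_rat])
  have "countable (\<Union>p\<in>UNIV \<times> ?Q. S p)"
    by (intro countable_UN countable_SIGMA Q S) auto
  from countable_rational_module[OF this] obtain R where R: "countable R" "(\<Union>p\<in>UNIV \<times> ?Q. S p) \<subseteq> R"
    and mod: "0 \<in> R" "\<forall>x\<in>R. \<forall>y\<in>R. x + y \<in> R" "\<forall>q\<in>\<rat>. \<forall>x\<in>R. q *\<^sub>R x \<in> R" by blast
  have sub: "subspace (closure R)" by (rule subspace_closure_rational_module) (use mod in auto)
  have "AE \<omega> in \<mu>. \<forall>n. \<forall>q\<in>?Q. M n (q, \<omega>) \<in> closure R"
    unfolding AE_all_countable AE_ball_countable[OF Q]
  proof (intro allI ballI)
    fix n q assume q: "q \<in> ?Q"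
    then have "closure (S (n, q)) \<subseteq> closure R" using R(2) by (intro closure_mono) blast
    moreover have "AE \<omega> in \<mu>. M n (q, \<omega>) \<in> closure (S (n, q))" using q by (intro Sae) simp
    ultimately show "AE \<omega> in \<mu>. M n (q, \<omega>) \<in> closure R" by (auto elim!: eventually_mono)
  qed
  then have "AE \<omega> in \<mu>. \<forall>n t. 0 \<le> t \<longrightarrow> M n (t, \<omega>) \<in> closure R"
    using AE_space
  proof eventually_elim
    case (elim \<omega>)
    show ?case
    proof (intro allI impI)
      fix n and t :: real assume t: "0 \<le> t"
      have "M n (t, \<omega>) \<in> closure (closure R)"
        unfolding closure_approachable[of _ "closure R"]
      proof (intro allI impI)
        fix e :: real assume "0 < e"
        then have "eventually (\<lambda>s. dist (M n (s, \<omega>)) (M n (t, \<omega>)) < e) (at_right t)"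
          using right_continuous_M[OF t elim(2), of n] by (rule tendstoD[rotated])
        then obtain b where b: "t < b" "\<And>s. t < s \<Longrightarrow> s < b \<Longrightarrow> dist (M n (s, \<omega>)) (M n (t, \<omega>)) < e"
          unfolding eventually_at_right_field by blast
        obtain q where q: "q \<in> \<rat>" "t < q" "q < b" using Rats_dense_in_real[OF b(1)] by blast
        have "M n (q, \<omega>) \<in> closure R" using elim(1) q t by auto
        then show "\<exists>y\<in>closure R. dist y (M n (t, \<omega>)) < e" using b(2)[OF q(2,3)] by blast
      qed
      then show "M n (t, \<omega>) \<in> closure R" by simp
    qed
  qed
  then show ?thesis using R(1) sub by blast
qed

section \<open>Assembly of the convex combinations and of their optional limit\<close>

theorem theorem3:
  fixes \<mu> :: "'x measure"
    and F :: "real \<Rightarrow> 'x measure"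
    and M :: "nat \<Rightarrow> real \<times> 'x \<Rightarrow> 'e::banach"
  assumes "stochastic_basis \<mu> F"
    and "reflexive_space TYPE('e)"
    and "\<And>n. cadlag_martingale \<mu> F (M n)"
    and "\<And>n. AE \<omega> in \<mu>. total_max (M n) \<omega> < \<infinity>"
    and "L0_bounded \<mu> (co {(\<lambda>\<omega>. enn2real (total_max (M n) \<omega>)) | n. True})"
    and "L1_bounded \<mu> {jump_at (M n) T | n T. ext_stopping_time \<mu> F T}"
  shows "\<exists>N Nlim A.
    (\<forall>i. N i \<in> co {M n | n. n \<ge> i}) \<and>
    Nlim \<in> borel_measurable (optional_algebra \<mu> F) \<and>
    evanescent \<mu> A \<and>
    (\<forall>t\<ge>0. \<forall>\<omega>\<in>space \<mu>. (t, \<omega>) \<notin> A \<longrightarrow>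
       limitin weak_topology (\<lambda>i. N i (t, \<omega>)) (Nlim (t, \<omega>)) sequentially)"
proof -
  interpret martingale_family \<mu> F M
    by (intro martingale_family.intro martingale_family_axioms.intro assms)
  obtain R where R: "countable R" and sub: "subspace (closure R)"
    and range: "AE \<omega> in \<mu>. \<forall>n t. 0 \<le> t \<longrightarrow> M n (t, \<omega>) \<in> closure R"
    using AE_separable_range by blast
  obtain D0 :: "('e \<Rightarrow>\<^sub>L real) set" where cD0: "countable D0"
    and D01: "\<forall>\<phi>\<in>D0. \<forall>x. blinfun_apply \<phi> x \<le> norm x"
    and D02: "\<forall>x\<in>closure R. \<forall>e<norm x. \<exists>\<phi>\<in>D0. e < blinfun_apply \<phi> x"
    using countable_norming_set[OF R] by (elim exE conjE)
  \<comment> \<open>The zero functional, itself dominated by the norm, guarantees that the set is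
    nonempty and can be enumerated by \<open>from_nat_into\<close>.\<close>
  define D where "D = insert 0 D0"
  have D: "countable D" "D \<noteq> {}" and D1: "\<And>\<phi> x. \<phi> \<in> D \<Longrightarrow> blinfun_apply \<phi> x \<le> norm x"
    and D2: "\<And>x e. x \<in> closure R \<Longrightarrow> e < norm x \<Longrightarrow> \<exists>\<phi>\<in>D. e < blinfun_apply \<phi> x"
  proof -
    show "countable D" "D \<noteq> {}" using cD0 by (auto simp: D_def)
    show "blinfun_apply \<phi> x \<le> norm x" if "\<phi> \<in> D" for \<phi> x
      using that D01 unfolding D_def by (elim insertE) simp_all
    show "\<exists>\<phi>\<in>D. e < blinfun_apply \<phi> x" if "x \<in> closure R" "e < norm x" for x e
    proof -
      from D02 that obtain \<phi> where "\<phi> \<in> D0" "e < blinfun_apply \<phi> x" by (elim ballE allE impE bexE) auto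
      then show ?thesis unfolding D_def by (intro bexI[of _ \<phi>]) auto
    qed
  qed
  define d where "d = from_nat_into D"
  have d: "d j \<in> D" for j unfolding d_def by (rule from_nat_into[OF D(2)])
  define f where "f n \<omega> = enn2real (total_max (M n) \<omega>)" for n \<omega>
  have co_f: "(\<lambda>\<omega>. comb w (\<lambda>n. f n \<omega>)) \<in> co {(\<lambda>\<omega>. enn2real (total_max (M n) \<omega>)) | n. True}" if "w \<in> wts 0" for w
    using comb_in_co[OF that, of f] by (simp add: f_def[abs_def])
  have fm: "f n \<in> borel_measurable \<mu>" for n
  proof -
    have "(\<lambda>k. if k = n then 1 else 0) \<in> wts 0" using unit_wts[of n] wts_antimono[of 0 n] by auto
    from co_f[OF this] show ?thesis using assms(5) by (auto simp: L0_bounded_def comb_unit)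
  qed
  have f0: "0 \<le> f n \<omega>" for n \<omega> by (simp add: f_def)
  \<comment> \<open>What is used later is only that convergent sequences are bounded: at almost
    every point the maxima combined by \<open>V\<close> have a common bound.\<close>
  have "\<exists>C. (\<forall>i. C i \<in> wts i) \<and> (AE \<omega> in \<mu>. convergent (\<lambda>i. comb (C i) (\<lambda>n. f n \<omega>)))"
  proof (rule nonneg_forward_convex[OF fm f0])
    fix \<epsilon> :: real assume "0 < \<epsilon>"
    then obtain \<delta> where \<delta>: "\<And>\<xi>. \<xi> \<in> co {(\<lambda>\<omega>. enn2real (total_max (M n) \<omega>)) | n. True} \<Longrightarrow>
        prob {\<omega> \<in> space \<mu>. \<delta> \<le> \<bar>\<xi> \<omega>\<bar>} \<le> \<epsilon>"
      using assms(5) unfolding L0_bounded_def by blast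
    have "prob {\<omega> \<in> space \<mu>. \<delta> \<le> comb w (\<lambda>n. f n \<omega>)} \<le> \<epsilon>" if w: "w \<in> wts 0" for w
    proof -
      have "\<bar>comb w (\<lambda>n. f n \<omega>)\<bar> = comb w (\<lambda>n. f n \<omega>)" for \<omega>
        by (rule abs_of_nonneg) (rule comb_ge[OF w f0])
      then show ?thesis using \<delta>[OF co_f[OF w]] by simp
    qed
    then show "\<exists>\<delta>. \<forall>w\<in>wts 0. prob {\<omega> \<in> space \<mu>. \<delta> \<le> comb w (\<lambda>n. f n \<omega>)} \<le> \<epsilon>" by blast
  qed
  then obtain V where V: "\<And>i. V i \<in> wts i" and Vc: "AE \<omega> in \<mu>. convergent (\<lambda>i. comb (V i) (\<lambda>n. f n \<omega>))" by blast
  \<comment> \<open>A single time for all \<open>n\<close> and all functionals in \<open>D\<close>: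
    before \<open>T l\<close> every projection with weights \<open>V n\<close> is at most
    \<open>l\<close> in modulus.\<close>
  define T where "T l = hitting_time (UNIV \<times> D) (\<lambda>(n, \<phi>). proj \<phi> (V n)) (real l)" for l
  have T: "ext_stopping_time \<mu> F (T l)" for l
    unfolding T_def
  proof (rule ext_stopping_time_hitting_time)
    show "countable (UNIV \<times> D :: (nat \<times> ('e \<Rightarrow>\<^sub>L real)) set)" using D(1) by (intro countable_SIGMA) auto
  qed (auto intro: proj_measurable proj_right_continuous)
  have below: "\<bar>proj \<phi> (V n) t \<omega>\<bar> \<le> real l" if "0 \<le> t" "ennreal t < T l \<omega>" "\<phi> \<in> D" for \<phi> n t \<omega> l
    using below_hitting_time[OF that(1) that(2)[unfolded T_def], of "(n, \<phi>)"] that(3) by simp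
  let ?J = "{jump_at (M n) T | n T. ext_stopping_time \<mu> F T}"
  have J1: "\<forall>f\<in>?J. bochner_integrable \<mu> f" and "\<exists>c::real. \<forall>f\<in>?J. (\<integral>\<^sup>+\<omega>. ennreal (norm (f \<omega>)) \<partial>\<mu>) \<le> ennreal c"
    using assms(6) unfolding L1_bounded_def by simp_all
  from this(2) obtain c :: real where J2: "\<forall>f\<in>?J. (\<integral>\<^sup>+\<omega>. ennreal (norm (f \<omega>)) \<partial>\<mu>) \<le> ennreal c" ..
  have c: "bochner_integrable \<mu> (jump_at (M m) S) \<and> (\<integral>\<^sup>+\<omega>. ennreal (norm (jump_at (M m) S \<omega>)) \<partial>\<mu>) \<le> ennreal c"
    if "ext_stopping_time \<mu> F S" for m S
  proof -
    have "jump_at (M m) S \<in> ?J" using that by blast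
    then show ?thesis using J1 J2 by simp
  qed
  have Ji: "integrable \<mu> (\<lambda>\<omega>. norm (jump_at (M m) (T l) \<omega>))"
    and Jc: "(\<integral>\<omega>. norm (jump_at (M m) (T l) \<omega>) \<partial>\<mu>) \<le> \<bar>c\<bar>" for m l
  proof -
    have "jump_at (M m) (T l) \<in> borel_measurable \<mu>"
      using c[OF T, of m l] unfolding bochner_integrable_def has_bochner_int_def by blast
    then have m: "(\<lambda>\<omega>. norm (jump_at (M m) (T l) \<omega>)) \<in> borel_measurable \<mu>" 
      by (rule measurable_compose) (intro borel_measurable_continuous_onI continuous_on_norm continuous_on_id)
    have le: "(\<integral>\<^sup>+\<omega>. ennreal (norm (jump_at (M m) (T l) \<omega>)) \<partial>\<mu>) \<le> ennreal \<bar>c\<bar>"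
      using c[OF T, of m l] ennreal_leI[OF abs_ge_self, of c] by (auto intro: order_trans)
    show i: "integrable \<mu> (\<lambda>\<omega>. norm (jump_at (M m) (T l) \<omega>))"
      by (rule integrableI_nonneg[OF m]) (use le in \<open>auto intro: le_less_trans\<close>)
    show "(\<integral>\<omega>. norm (jump_at (M m) (T l) \<omega>) \<partial>\<mu>) \<le> \<bar>c\<bar>"
      using le i by (simp add: nn_integral_eq_integral)
  qed
  text \<open>The number \<open>k\<close> codes the level \<open>l\<close>, the time horizon \<open>K\<close> and the index \<open>j\<close> of the functional.\<close>
  define P where "P k W \<longleftrightarrow> (AE \<omega> in \<mu>. \<forall>t. 0 \<le> t \<and> t < real (fst (prod_decode (snd (prod_decode k)))) \<and>
      ennreal t < T (fst (prod_decode k)) \<omega> \<longrightarrow>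
      convergent (\<lambda>i. comb (W i) (\<lambda>n. proj (d (snd (prod_decode (snd (prod_decode k))))) (V n) t \<omega>)))"
    for k :: nat and W :: "nat \<Rightarrow> nat \<Rightarrow> real"
  have "\<exists>W. (\<forall>i. W i \<in> wts i) \<and> (\<forall>k. P k W)"
  proof (rule diagonal_wts)
    show "\<exists>C. (\<forall>i. C i \<in> wts i) \<and> P k (\<lambda>i. comp_wts (C i) W)" if W: "\<And>i. W i \<in> wts i" for k W
      unfolding P_def
      by (rule stopped_forward_convex[OF D1[OF d] T Ji Jc V W of_nat_0_le_iff below[OF _ _ d]])
    show "P k U" if W: "\<And>i. W i \<in> wts i" and PW: "P k W" and C: "\<And>i. C i \<in> wts i"
      and U: "\<And>i. i0 \<le> i \<Longrightarrow> U i = comp_wts (C i) W" for k W C U i0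
      using PW unfolding P_def
      by eventually_elim (intro allI impI comp_wts_convergent[OF _ W C U], blast)
  qed
  then obtain W where W: "\<And>i. W i \<in> wts i" and PW: "\<And>k. P k W" by blast
  define E where "E i = comp_wts (W i) V" for i
  have E: "E i \<in> wts i" for i unfolding E_def by (rule comp_wts(1)[OF W V])
  define N where "N i z = comb (E i) (\<lambda>n. M n z)" for i z
  have NE: "blinfun_apply \<phi> (N i (t, \<omega>)) = proj \<phi> (E i) t \<omega>" for \<phi> i t \<omega>
    unfolding N_def proj_def by (rule comb_linear) (simp add: bounded_linear.linear blinfun.bounded_linear_right)
  have conv: "AE \<omega> in \<mu>. \<forall>k. \<forall>t. 0 \<le> t \<and> t < real (fst (prod_decode (snd (prod_decode k)))) \<and>
      ennreal t < T (fst (prod_decode k)) \<omega> \<longrightarrow>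
      convergent (\<lambda>i. comb (W i) (\<lambda>n. proj (d (snd (prod_decode (snd (prod_decode k))))) (V n) t \<omega>))"
    unfolding AE_all_countable using PW unfolding P_def by blast
  have fin: "AE \<omega> in \<mu>. \<forall>n. total_max (M n) \<omega> < \<infinity>"
    unfolding AE_all_countable using assms(4) by blast
  \<comment> \<open>Membership in \<open>closure R\<close> is part of the requirement because
    measurability of the limit is proved inside a separable subspace.\<close>
  define Q where "Q z y \<longleftrightarrow> y \<in> closure R \<and> (\<forall>\<phi> :: 'e \<Rightarrow>\<^sub>L real. (\<lambda>i. blinfun_apply \<phi> (N i z)) \<longlonglongrightarrow> blinfun_apply \<phi> y)" for z y
  have "AE \<omega> in \<mu>. \<forall>t\<ge>0. \<exists>y. Q (t, \<omega>) y"
    using range Vc fin conv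
  proof eventually_elim
    case (elim \<omega>)
    obtain b where b: "\<And>i. comb (V i) (\<lambda>n. f n \<omega>) \<le> b"
      using convergent_imp_Bseq[OF elim(2)] by (auto simp: Bseq_def intro: order_trans[OF abs_ge_self])
    obtain l where l: "b \<le> real l" using real_arch_simple by blast
    have Vb: "norm (comb (V i) (\<lambda>n. M n (t, \<omega>))) \<le> real l" if "0 \<le> t" for i t
    proof -
      have "norm (comb (V i) (\<lambda>n. M n (t, \<omega>))) \<le> comb (V i) (\<lambda>n. norm (M n (t, \<omega>)))" by (rule norm_comb_le[OF V])
      also have "\<dots> \<le> comb (V i) (\<lambda>n. f n \<omega>)"
        unfolding f_def by (rule comb_mono[OF V], rule norm_le_total_max[OF that elim(3)[rule_format]])
      finally show ?thesis using b[of i] l by linarith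
    qed
    have Nb: "norm (N i (t, \<omega>)) \<le> real l" if "0 \<le> t" for i t
      unfolding N_def E_def comp_wts(2)[OF W V] by (rule norm_comb_bound[OF W]) (rule Vb[OF that])
    \<comment> \<open>The bound \<open>l\<close> on this path holds for all times, so no projection
      ever leaves \<open>[-l, l]\<close> and every \<open>t\<close> falls under the convergence
      statement of level \<open>l\<close>.\<close>
    have Tinf: "T l \<omega> = \<infinity>"
    proof -
      have "\<bar>proj \<phi> (V n) t \<omega>\<bar> \<le> real l" if "0 \<le> t" "\<phi> \<in> D" for \<phi> n t
      proof -
        have "proj \<phi> (V n) t \<omega> = blinfun_apply \<phi> (comb (V n) (\<lambda>n. M n (t, \<omega>)))"
          unfolding proj_def by (rule comb_linear[symmetric]) (simp add: bounded_linear.linear blinfun.bounded_linear_right)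
        then show ?thesis using blinfun_abs_le[OF D1[OF that(2)], of "comb (V n) (\<lambda>n. M n (t, \<omega>))"] Vb[OF that(1), of n] by simp
      qed
      then have "{t. 0 \<le> t \<and> (\<exists>i\<in>UNIV \<times> D. real l < \<bar>(case i of (n, \<phi>) \<Rightarrow> proj \<phi> (V n)) t \<omega>\<bar>)} = {}"
        by (force simp: not_less[symmetric])
      then show ?thesis unfolding T_def hitting_time_def by (simp only: image_empty Inf_empty infinity_ennreal_def)
    qed
    show ?case
    proof (intro allI impI)
      fix t :: real assume t: "0 \<le> t"
      obtain K where K: "t < real K" using reals_Archimedean2 by blast
      have Dconv: "convergent (\<lambda>i. blinfun_apply \<phi> (N i (t, \<omega>)))" if \<phi>: "\<phi> \<in> D" for \<phi>
      proof -
        obtain j where j: "\<phi> = d j" unfolding d_def using from_nat_into_surj[OF D(1) \<phi>] by metis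
        have "convergent (\<lambda>i. comb (W i) (\<lambda>n. proj \<phi> (V n) t \<omega>))"
          using elim(4)[rule_format, of t "prod_encode (l, prod_encode (K, j))"] t K j Tinf by simp
        moreover have "blinfun_apply \<phi> (N i (t, \<omega>)) = comb (W i) (\<lambda>n. proj \<phi> (V n) t \<omega>)" for i
          unfolding NE E_def proj_def by (rule comp_wts(2)[OF W V])
        ultimately show ?thesis by simp
      qed
      have "\<exists>y\<in>closure R. \<forall>\<phi> :: 'e \<Rightarrow>\<^sub>L real. (\<lambda>i. blinfun_apply \<phi> (N i (t, \<omega>))) \<longlonglongrightarrow> blinfun_apply \<phi> y"
      proof (rule weakly_convergent_of_separating[OF assms(2) sub closed_closure _ _ _ Dconv])
        show "N i (t, \<omega>) \<in> closure R" for i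
          unfolding N_def comb_def by (intro subspace_sum subspace_scale sub) (use elim(1) t in blast)
        show "norm (N i (t, \<omega>)) \<le> real l" for i by (rule Nb[OF t])
        show "y = 0" if y: "y \<in> closure R" and z: "\<And>\<phi>. \<phi> \<in> D \<Longrightarrow> blinfun_apply \<phi> y = 0" for y
        proof (rule ccontr)
          assume "y \<noteq> 0"
          then obtain \<phi> where "\<phi> \<in> D" "0 < blinfun_apply \<phi> y" using D2[OF y, of 0] by auto
          then show False using z by simp
        qed
      qed
      then show "\<exists>y. Q (t, \<omega>) y" unfolding Q_def by blast
    qed
  qed
  then obtain B where B0: "{\<omega> \<in> space \<mu>. \<not> (\<forall>t\<ge>0. \<exists>y. Q (t, \<omega>) y)} \<subseteq> B" "emeasure \<mu> B = 0" "B \<in> sets \<mu>"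
    by (rule AE_E)
  have B: "B \<in> null_sets \<mu>" using B0 by (simp add: null_sets_def)
  have good: "\<exists>y. Q (t, \<omega>) y" if "\<omega> \<in> space \<mu>" "\<omega> \<notin> B" "0 \<le> t" for \<omega> t
    using B0(1) that by blast
  \<comment> \<open>Choosing the values pointwise does no harm to measurability: outside
    \<open>B\<close> each functional of \<open>L\<close> is a pointwise limit of optional
    processes.\<close>
  define L where "L z = (if snd z \<in> B then 0 else SOME y. Q z y)" for z
  have L: "Q (t, \<omega>) (L (t, \<omega>))" if "0 \<le> t" "\<omega> \<in> space \<mu>" "\<omega> \<notin> B" for t \<omega>
  proof -
    from someI_ex[OF good[OF that(2,3,1)]] show ?thesis using that(3) by (simp add: L_def)
  qed
  have spO: "space (optional_algebra \<mu> F) = {0..} \<times> space \<mu>"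
    unfolding optional_algebra_def by (rule space_measure_of) auto
  have "L \<in> borel_measurable (optional_algebra \<mu> F)"
  proof (rule weakly_measurable_imp_measurable[OF R sub D(1) D1 D2])
    show "L z \<in> closure R" if "z \<in> space (optional_algebra \<mu> F)" for z
    proof (cases "snd z \<in> B")
      case True
      then show ?thesis using subspace_0[OF sub] by (simp add: L_def)
    next
      case False
      then show ?thesis using L[of "fst z" "snd z"] that unfolding spO Q_def by auto
    qed
    fix \<phi> :: "'e \<Rightarrow>\<^sub>L real"
    \<comment> \<open>Setting the process to zero on \<open>B\<close> preserves adaptedness, since
      null sets belong to every \<open>F t\<close>, and right-continuity, since \<open>B\<close>
      does not depend on time.\<close>
    define Y where "Y i z = (if snd z \<in> B then 0 else blinfun_apply \<phi> (N i z))" for i z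
    show "(\<lambda>z. blinfun_apply \<phi> (L z)) \<in> borel_measurable (optional_algebra \<mu> F)"
    proof (rule borel_measurable_LIMSEQ_real)
      show "(\<lambda>i. Y i z) \<longlonglongrightarrow> blinfun_apply \<phi> (L z)" if "z \<in> space (optional_algebra \<mu> F)" for z
        using L[of "fst z" "snd z"] that unfolding spO Q_def Y_def by (cases "snd z \<in> B") (auto simp: L_def)
      show "Y i \<in> borel_measurable (optional_algebra \<mu> F)" for i
      proof (rule optional_measurable)
        show "right_continuous_process \<mu> (Y i)"
          unfolding right_continuous_process_def Y_def using proj_right_continuous by (simp add: NE)
        show "adapted_process F (Y i)"
          unfolding adapted_process_def Y_def
        proof (intro allI impI)
          fix t :: real assume t: "0 \<le> t"
          have [measurable]: "B \<in> sets (F t)" by (rule null_set_in_filtration[OF B t])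
          have [measurable]: "proj \<phi> (E i) t \<in> borel_measurable (F t)" by (rule proj_measurable[OF t])
          show "(\<lambda>\<omega>. if snd (t, \<omega>) \<in> B then 0 else blinfun_apply \<phi> (N i (t, \<omega>))) \<in> borel_measurable (F t)"
            unfolding NE snd_conv by measurable
        qed
      qed
    qed
  qed
  moreover have "evanescent \<mu> ({0..} \<times> B)"
  proof -
    have "B \<subseteq> space \<mu>" using B by (auto dest: null_setsD2 sets.sets_into_space)
    then have "{\<omega> \<in> space \<mu>. \<exists>t\<ge>0. (t, \<omega>) \<in> {0 :: real..} \<times> B} = B" by (auto intro: exI[of _ 0])
    then show ?thesis using B \<open>B \<subseteq> space \<mu>\<close> unfolding evanescent_def by auto
  qed
  moreover have "N i \<in> co {M n | n. n \<ge> i}" for i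
    using comb_in_co[OF E[of i], of M] by (simp add: N_def[abs_def])
  moreover have "limitin weak_topology (\<lambda>i. N i (t, \<omega>)) (L (t, \<omega>)) sequentially"
    if "0 \<le> t" "\<omega> \<in> space \<mu>" "(t, \<omega>) \<notin> {0..} \<times> B" for t \<omega>
    unfolding limitin_weak_topology_iff using L[of t \<omega>] that by (auto simp: Q_def)
  ultimately show ?thesis by blast
qed

end
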